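(* Let $\Sigma$ be a non-empty set of prime numbers, and let $S$ be a pro-$\Sigma$ surface group of genus $g\geq 2$. Then, for every integer $m\geq 2$, the maximal $m$-step solvable quotient $S^{m}$ of $S$ is torsion-free and center-free.
   Context: A pro-$\Sigma$ surface group of genus $g$ is the pro-$\Sigma$ completion of the group $\langle a_1,b_1,\dots,a_g,b_g\mid \prod_{i=1}^g[a_i,b_i]=1\rangle$ (pro-$\Sigma$: inverse limit of finite groups whose orders have all prime factors in $\Sigma$). The topological derived series of a profinite group $G$ is $G^{[0]}=G$, $G^{[m]}=\overline{[G^{[m-1]},G^{[m-1]}]}$ (closed subgroup topologically generated by commutators) for $m\ge 1$, and the maximal $m$-step solvable quotient of $G$ is $G^{m}:=G/G^{[m]}$. A group is torsion-free if it has no nontrivial element of finite order, and center-free if its center is trivial. *)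

theory Defs
  imports
    "HOL-Algebra.Product_Groups"
    "HOL-Algebra.Generated_Groups"
    "HOL-Analysis.Function_Topology"
    "HOL-Computational_Algebra.Primes"
begin

section \<open>Groups given by generators and relations\<close>

text \<open>A letter \<open>(x, True)\<close> stands for the generator \<open>x\<close>, and \<open>(x, False)\<close> for its inverse.\<close>

type_synonym 'x word = "('x \<times> bool) list"

definition words :: "'x set \<Rightarrow> 'x word set" where
  "words X = lists (X \<times> UNIV)"

text \<open>Two words over \<open>X\<close> are equivalent iff they represent the same element of
  \<open>\<langle>X | R\<rangle>\<close>. The set \<open>R\<close> of relators is meant to be a subset of \<open>words X\<close>.\<close>

inductive word_equiv :: "'x set \<Rightarrow> 'x word set \<Rightarrow> 'x word \<Rightarrow> 'x word \<Rightarrow> bool"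
  for X :: "'x set" and R :: "'x word set" where
  refl: "w \<in> words X \<Longrightarrow> word_equiv X R w w"
| sym: "word_equiv X R v w \<Longrightarrow> word_equiv X R w v"
| trans: "word_equiv X R u v \<Longrightarrow> word_equiv X R v w \<Longrightarrow> word_equiv X R u w"
| cancel: "u \<in> words X \<Longrightarrow> v \<in> words X \<Longrightarrow> x \<in> X \<Longrightarrow>
    word_equiv X R (u @ [(x, e), (x, \<not> e)] @ v) (u @ v)"
| relator: "u \<in> words X \<Longrightarrow> v \<in> words X \<Longrightarrow> r \<in> R \<Longrightarrow> r \<in> words X \<Longrightarrow>
    word_equiv X R (u @ r @ v) (u @ v)"

definition presented_group :: "'x set \<Rightarrow> 'x word set \<Rightarrow> 'x word set monoid" where
  "presented_group X R =
    \<lparr>carrier = words X // {(v, w). word_equiv X R v w},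
     monoid.mult = (\<lambda>A B. {w. \<exists>a\<in>A. \<exists>b\<in>B. word_equiv X R (a @ b) w}),
     one = {w. word_equiv X R [] w}\<rparr>"

datatype surface_gen = Gen_a nat | Gen_b nat

definition surface_relator :: "nat \<Rightarrow> surface_gen word" where
  "surface_relator g =
    concat (map (\<lambda>i. [(Gen_a i, True), (Gen_b i, True), (Gen_a i, False), (Gen_b i, False)])
      [1..<Suc g])"

definition surface_group :: "nat \<Rightarrow> surface_gen word set monoid" where
  "surface_group g = presented_group (Gen_a ` {1..g} \<union> Gen_b ` {1..g}) {surface_relator g}"


section \<open>Completion with respect to a set of primes\<close>

definition pro_normal_subgroups :: "nat set \<Rightarrow> ('a, 'b) monoid_scheme \<Rightarrow> 'a set set" where
  "pro_normal_subgroups \<Sigma> G =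
    {N. N \<lhd> G \<and> finite (carrier (G Mod N)) \<and>
        (\<forall>p. prime p \<and> p dvd order (G Mod N) \<longrightarrow> p \<in> \<Sigma>)}"

text \<open>The inverse limit of the quotients \<open>G Mod N\<close>: for \<open>N \<subseteq> M\<close> the transition map
  \<open>G Mod N \<rightarrow> G Mod M\<close> is \<open>C \<mapsto> M <#> C\<close>, which sends the coset \<open>N #> x\<close> to \<open>M #> x\<close>.\<close>

definition pro_completion ::
    "nat set \<Rightarrow> ('a, 'b) monoid_scheme \<Rightarrow> ('a set \<Rightarrow> 'a set) monoid" where
  "pro_completion \<Sigma> G =
    (let I = pro_normal_subgroups \<Sigma> G; P = product_group I (\<lambda>N. G Mod N) in
     P\<lparr>carrier := {x \<in> carrier P. \<forall>N\<in>I. \<forall>M\<in>I. N \<subseteq> M \<longrightarrow> x M = M <#>\<^bsub>G\<^esub> x N}\<rparr>)"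

definition pro_completion_topology ::
    "nat set \<Rightarrow> ('a, 'b) monoid_scheme \<Rightarrow> ('a set \<Rightarrow> 'a set) topology" where
  "pro_completion_topology \<Sigma> G =
    subtopology
      (product_topology (\<lambda>N. discrete_topology (carrier (G Mod N))) (pro_normal_subgroups \<Sigma> G))
      (carrier (pro_completion \<Sigma> G))"

text \<open>A topological group is given by a group \<open>S\<close> together with a topology \<open>T\<close> on its carrier;
  surface groups are taken up to isomorphism of topological groups.\<close>

definition pro_surface_group ::
    "nat set \<Rightarrow> nat \<Rightarrow> ('a, 'b) monoid_scheme \<Rightarrow> 'a topology \<Rightarrow> bool" where
  "pro_surface_group \<Sigma> g S T \<longleftrightarrow>
    group S \<and>
    (\<exists>h. h \<in> iso (pro_completion \<Sigma> (surface_group g)) S \<and>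
         homeomorphic_map (pro_completion_topology \<Sigma> (surface_group g)) T h)"


section \<open>Solvable quotients\<close>

primrec topological_derived ::
    "('a, 'b) monoid_scheme \<Rightarrow> 'a topology \<Rightarrow> nat \<Rightarrow> 'a set" where
  "topological_derived G T 0 = carrier G"
| "topological_derived G T (Suc m) = T closure_of derived G (topological_derived G T m)"

definition max_solvable_quotient ::
    "('a, 'b) monoid_scheme \<Rightarrow> 'a topology \<Rightarrow> nat \<Rightarrow> 'a set monoid" where
  "max_solvable_quotient G T m = G Mod topological_derived G T m"

definition torsion_free :: "('a, 'b) monoid_scheme \<Rightarrow> bool" where
  "torsion_free G \<longleftrightarrow>
    (\<forall>x\<in>carrier G. \<forall>n::nat. 0 < n \<and> x [^]\<^bsub>G\<^esub> n = \<one>\<^bsub>G\<^esub> \<longrightarrow> x = \<one>\<^bsub>G\<^esub>)"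

definition center :: "('a, 'b) monoid_scheme \<Rightarrow> 'a set" where
  "center G = {z \<in> carrier G. \<forall>x\<in>carrier G. z \<otimes>\<^bsub>G\<^esub> x = x \<otimes>\<^bsub>G\<^esub> z}"

definition center_free :: "('a, 'b) monoid_scheme \<Rightarrow> bool" where
  "center_free G \<longleftrightarrow> center G = {\<one>\<^bsub>G\<^esub>}"

end

theory Submission
  imports
    Defs
    "HOL-Algebra.Sylow"
    "HOL-Algebra.Multiplicative_Group"
    "HOL-Algebra.SndIsomorphismGrp"
    "HOL-Number_Theory.Cong"
begin

text \<open>Write \<open>\<Gamma>\<close> for the surface group. An element of \<open>S\<close> lies in \<open>S\<^sup>[\<^sup>m\<^sup>]\<close> iff it vanishes in every finite
  \<open>\<Sigma>\<close>-quotient of \<open>\<Gamma>\<close> that is solvable of length at most \<open>m\<close>, so everything takes place in finite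
  quotients \<open>\<Gamma>/H\<close> and the corresponding coverings of the surface. For normal \<open>H\<close> of finite index,
  a homomorphism \<open>H \<rightarrow> A\<close> is the same as a 1-cocycle on the covering complex, whose faces and
  vertices are the elements of \<open>\<Gamma>/H\<close>. As every edge lies on two faces with opposite
  orientations and the dual graph is connected, a character \<open>H \<rightarrow> \<int>/n\<close> always lifts to
  \<open>H \<rightarrow> \<int>\<close>; this makes the abelianization of \<open>H\<close> torsion-free, and torsion-freeness of \<open>S\<^sup>m\<close> follows
  one step of the derived series at a time.

  Let \<open>z\<close> be central modulo \<open>S\<^sup>[\<^sup>m\<^sup>]\<close>. Translation by \<open>z\<close> on the covering belonging to \<open>H\<close> then preserves all
  intersection numbers. Applied to lifts of \<open>a\<^sub>i\<close> and \<open>b\<^sub>i\<close>, which cross, this puts \<open>z\<close> into the product of the cyclic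
  groups generated by \<open>a\<^sub>i\<close> and \<open>b\<^sub>i\<close> modulo \<open>H\<close>, for \<open>i = 1\<close> and for \<open>i = 2\<close>. Comparing exponent sums
  modulo a multiple of \<open>|\<Gamma>/H|\<close> shows that \<open>z\<close> is trivial modulo \<open>H\<close>, i.e. \<open>z\<close> lies in \<open>S\<^sup>[\<^sup>m\<^sup>-\<^sup>1\<^sup>]\<close>. Finally, the transfer of
  a homomorphism \<open>H \<rightarrow> \<int>\<close> to \<open>\<Gamma>\<close> kills \<open>z\<close> but multiplies its value by \<open>|\<Gamma>/H|\<close>, so \<open>z\<close> vanishes.\<close>

section \<open>Presented groups\<close>

text \<open>An element of the completion carries no integers of its own: it is known only through
  representatives in \<Gamma> modulo subgroups of finite index, so each integer argument has to be
  run as a congruence. The device is always the same: intersect the current subgroup with the kernel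
  of a cocycle modulo a \<Sigma>-number that is chosen large enough for the congruence to suffice.
  The number is \<open>p * e\<close> for p-torsion, where cancelling \<open>p\<close> costs a factor
  \<open>p\<close>; a power of a prime of \<Sigma> that exceeds all crossing numbers involved, so
  that congruent ones are equal; and \<open>|\<Gamma>/H| * e\<close> for the transfer. A cocycle on
  all of \<Gamma>, in place of a homomorphism on \<open>H\<close>, carries all conjugates of a
  character at once, which makes these kernels normal in \<Gamma>. The condition on \<open>m\<close>
  enters because exponent sums and the transfer live in the abelianization, which must already be
  visible at level \<open>m - 1\<close>. The condition on the genus supplies the second pair of
  generators.\<close>

lemma words_append [simp]: "u @ v \<in> words X \<longleftrightarrow> u \<in> words X \<and> v \<in> words X"
  by (simp add: words_def)

lemma words_Nil [simp]: "[] \<in> words X"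
  by (simp add: words_def)

lemma words_Cons [simp]: "(x, e) # w \<in> words X \<longleftrightarrow> x \<in> X \<and> w \<in> words X"
  by (auto simp: words_def)

lemma word_equiv_words: "word_equiv X R u v \<Longrightarrow> u \<in> words X \<and> v \<in> words X"
  by (induction rule: word_equiv.induct) auto

lemma word_equiv_append_right:
  "word_equiv X R u v \<Longrightarrow> w \<in> words X \<Longrightarrow> word_equiv X R (u @ w) (v @ w)"
proof (induction rule: word_equiv.induct)
  case (cancel u v x e)
  then show ?case using word_equiv.cancel[of u X "v @ w" x R e] by simp
next
  case (relator u v r)
  then show ?case using word_equiv.relator[of u X "v @ w" r R] by simp
qed (auto intro: word_equiv.intros)

lemma word_equiv_append_left:
  "word_equiv X R u v \<Longrightarrow> w \<in> words X \<Longrightarrow> word_equiv X R (w @ u) (w @ v)"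
proof (induction rule: word_equiv.induct)
  case (cancel u v x e)
  then show ?case using word_equiv.cancel[of "w @ u" X v x R e] by simp
next
  case (relator u v r)
  then show ?case using word_equiv.relator[of "w @ u" X v r R] by simp
qed (auto intro: word_equiv.intros)

lemma word_equiv_append:
  assumes "word_equiv X R u u'" "word_equiv X R v v'"
  shows "word_equiv X R (u @ v) (u' @ v')"
  using word_equiv_append_right[OF assms(1)] word_equiv_append_left[OF assms(2)]
    word_equiv_words[OF assms(1)] word_equiv_words[OF assms(2)] word_equiv.trans by metis

definition inverse_word :: "'x word \<Rightarrow> 'x word" where
  "inverse_word w = rev (map (\<lambda>(x, e). (x, \<not> e)) w)"

lemma inverse_word_in_words [simp]: "inverse_word w \<in> words X \<longleftrightarrow> w \<in> words X"
  by (induction w) (auto simp: inverse_word_def)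

lemma word_equiv_inverse: "w \<in> words X \<Longrightarrow> word_equiv X R (inverse_word w @ w) []"
proof (induction w)
  case (Cons l w)
  obtain x e where l: "l = (x, e)" by fastforce
  \<comment> \<open>The double negation gives the pair the shape required by \<open>cancel\<close>,
    a letter followed by its opposite.\<close>
  have "word_equiv X R (inverse_word w @ [(x, \<not> e), (x, \<not> \<not> e)] @ w) (inverse_word w @ w)"
    using Cons.prems l by (intro word_equiv.cancel) auto
  moreover have "inverse_word (l # w) @ l # w = inverse_word w @ [(x, \<not> e), (x, \<not> \<not> e)] @ w"
    by (simp add: inverse_word_def l)
  ultimately show ?case using Cons l word_equiv.trans by fastforce
qed (simp add: inverse_word_def word_equiv.refl)

definition word_class :: "'x set \<Rightarrow> 'x word set \<Rightarrow> 'x word \<Rightarrow> 'x word set" where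
  "word_class X R w = {v. word_equiv X R w v}"

lemma word_class_eq_iff:
  "u \<in> words X \<Longrightarrow> word_class X R u = word_class X R v \<longleftrightarrow> word_equiv X R u v"
  unfolding word_class_def by (blast intro: word_equiv.intros)

lemma carrier_presented_group: "carrier (presented_group X R) = word_class X R ` words X"
  by (auto simp: presented_group_def quotient_def word_class_def)

lemma one_presented_group: "\<one>\<^bsub>presented_group X R\<^esub> = word_class X R []"
  by (simp add: presented_group_def word_class_def)

lemma mult_word_class:
  assumes "u \<in> words X" "v \<in> words X"
  shows "word_class X R u \<otimes>\<^bsub>presented_group X R\<^esub> word_class X R v = word_class X R (u @ v)"
proof -
  have "word_equiv X R (u @ v) w" if "word_equiv X R u a" "word_equiv X R v b"
      "word_equiv X R (a @ b) w" for a b w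
    using that word_equiv_append word_equiv.trans by blast
  then show ?thesis
    using assms by (auto simp: presented_group_def word_class_def intro: word_equiv.refl)
qed

lemma group_presented_group: "group (presented_group X R)"
proof (rule groupI)
  fix a assume "a \<in> carrier (presented_group X R)"
  then obtain w where w: "w \<in> words X" "a = word_class X R w"
    by (auto simp: carrier_presented_group)
  have "word_class X R (inverse_word w) \<otimes>\<^bsub>presented_group X R\<^esub> a = \<one>\<^bsub>presented_group X R\<^esub>"
    using w word_equiv_inverse[OF w(1)]
    by (simp add: mult_word_class one_presented_group word_class_eq_iff)
  then show "\<exists>b\<in>carrier (presented_group X R).
      b \<otimes>\<^bsub>presented_group X R\<^esub> a = \<one>\<^bsub>presented_group X R\<^esub>"
    using w by (auto simp: carrier_presented_group)
qed (auto simp: carrier_presented_group one_presented_group mult_word_class)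

section \<open>Evaluation of words in a group\<close>

definition (in group) letter_value :: "('x \<Rightarrow> 'a) \<Rightarrow> 'x \<times> bool \<Rightarrow> 'a" where
  "letter_value \<alpha> l = (if snd l then \<alpha> (fst l) else inv (\<alpha> (fst l)))"

primrec (in group) word_value :: "('x \<Rightarrow> 'a) \<Rightarrow> 'x word \<Rightarrow> 'a" where
  "word_value \<alpha> [] = \<one>"
| "word_value \<alpha> (l # w) = letter_value \<alpha> l \<otimes> word_value \<alpha> w"

lemma (in group) letter_value_closed:
  "fst l \<in> X \<Longrightarrow> \<alpha> \<in> X \<rightarrow> carrier G \<Longrightarrow> letter_value \<alpha> l \<in> carrier G"
  by (auto simp: letter_value_def)

lemma (in group) word_value_closed:
  "w \<in> words X \<Longrightarrow> \<alpha> \<in> X \<rightarrow> carrier G \<Longrightarrow> word_value \<alpha> w \<in> carrier G"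
  by (induction w) (auto simp: letter_value_closed)

lemma (in group) word_value_append:
  "u \<in> words X \<Longrightarrow> v \<in> words X \<Longrightarrow> \<alpha> \<in> X \<rightarrow> carrier G \<Longrightarrow>
    word_value \<alpha> (u @ v) = word_value \<alpha> u \<otimes> word_value \<alpha> v"
  by (induction u) (auto simp: letter_value_closed word_value_closed m_assoc)

definition gen_class :: "'x set \<Rightarrow> 'x word set \<Rightarrow> 'x \<Rightarrow> 'x word set" where
  "gen_class X R x = word_class X R [(x, True)]"

lemma gen_class_closed: "x \<in> X \<Longrightarrow> gen_class X R x \<in> carrier (presented_group X R)"
  by (auto simp: gen_class_def carrier_presented_group)

lemma inv_gen_class:
  assumes "x \<in> X"
  shows "inv\<^bsub>presented_group X R\<^esub> (gen_class X R x) = word_class X R [(x, False)]"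
proof -
  interpret group "presented_group X R" by (rule group_presented_group)
  have "word_equiv X R ([] @ [(x, False), (x, \<not> False)] @ []) ([] @ [])"
    using assms by (intro word_equiv.cancel) auto
  then have "word_class X R [(x, False)] \<otimes>\<^bsub>presented_group X R\<^esub> gen_class X R x
      = \<one>\<^bsub>presented_group X R\<^esub>"
    using assms by (simp add: gen_class_def mult_word_class one_presented_group word_class_eq_iff)
  then show ?thesis
    using assms gen_class_closed[of x X R]
    by (intro inv_equality) (auto simp: carrier_presented_group)
qed

text \<open>Bridge between words and group elements: homomorphisms can be computed letter by letter
  on any representing word.\<close>

lemma word_class_conv_word_value:
  "w \<in> words X \<Longrightarrow>
    word_class X R w = group.word_value (presented_group X R) (gen_class X R) w"
proof (induction w)
  case Nil
  interpret group "presented_group X R" by (rule group_presented_group)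
  show ?case by (simp add: one_presented_group)
next
  case (Cons l w)
  interpret group "presented_group X R" by (rule group_presented_group)
  obtain x e where l: "l = (x, e)" by fastforce
  have "word_class X R (l # w) = word_class X R [l] \<otimes>\<^bsub>presented_group X R\<^esub> word_class X R w"
    using Cons.prems l by (simp add: mult_word_class)
  moreover have "word_class X R [l] = letter_value (gen_class X R) l"
    using Cons.prems l inv_gen_class[of x X R] by (simp add: letter_value_def gen_class_def)
  ultimately show ?case using Cons l by simp
qed

lemma (in group_hom) hom_word_value:
  "w \<in> words X \<Longrightarrow> \<alpha> \<in> X \<rightarrow> carrier G \<Longrightarrow> h (G.word_value \<alpha> w) = H.word_value (h \<circ> \<alpha>) w"
proof (induction w)
  case (Cons l w)
  obtain x e where l: "l = (x, e)" by fastforce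
  have "\<alpha> x \<in> carrier G" "G.word_value \<alpha> w \<in> carrier G"
    using Cons.prems l by (auto intro: G.word_value_closed)
  then show ?case using Cons l by (simp add: G.letter_value_def H.letter_value_def)
qed simp

lemma presented_group_induct:
  assumes "subgroup K (presented_group X R)" "\<And>x. x \<in> X \<Longrightarrow> gen_class X R x \<in> K"
  shows "K = carrier (presented_group X R)"
proof -
  interpret group "presented_group X R" by (rule group_presented_group)
  interpret K: subgroup K "presented_group X R" by fact
  have "word_value (gen_class X R) w \<in> K" if "w \<in> words X" for w
    using that
    by (induction w) (auto simp: letter_value_def assms(2))
  then show ?thesis
    using K.subset by (auto simp: carrier_presented_group word_class_conv_word_value)
qed


section \<open>Cocycles from labelled Cayley graphs\<close>

text \<open>The sum of the labels along the path that starts at \<open>q\<close> and reads the word \<open>w\<close>,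
  where \<open>f q x\<close> labels the edge from \<open>q\<close> to \<open>q \<otimes> \<alpha> x\<close>.\<close>

primrec (in group) path_sum :: "('x \<Rightarrow> 'a) \<Rightarrow> ('a \<Rightarrow> 'x \<Rightarrow> int) \<Rightarrow> 'x word \<Rightarrow> 'a \<Rightarrow> int" where
  "path_sum \<alpha> f [] q = 0"
| "path_sum \<alpha> f (l # w) q =
    (if snd l then f q (fst l) else - f (q \<otimes> inv (\<alpha> (fst l))) (fst l))
      + path_sum \<alpha> f w (q \<otimes> letter_value \<alpha> l)"

lemma (in group) path_sum_append:
  "u \<in> words X \<Longrightarrow> \<alpha> \<in> X \<rightarrow> carrier G \<Longrightarrow> q \<in> carrier G \<Longrightarrow> v \<in> words X \<Longrightarrow>
    path_sum \<alpha> f (u @ v) q = path_sum \<alpha> f u q + path_sum \<alpha> f v (q \<otimes> word_value \<alpha> u)"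
proof (induction u arbitrary: q)
  case (Cons l u)
  obtain x e where l: "l = (x, e)" by fastforce
  have "letter_value \<alpha> l \<in> carrier G" "word_value \<alpha> u \<in> carrier G"
    using Cons.prems l by (auto intro: word_value_closed letter_value_closed)
  then show ?case using Cons l by (simp add: m_assoc)
qed simp

text \<open>Here \<open>\<pi>\<close> makes the group \<open>Q\<close> a quotient of \<open>G\<close>; a cocycle gives the sum of
  the labels along the path from \<open>q\<close> to \<open>q \<otimes> \<pi> x\<close> in the corresponding Cayley graph.\<close>

definition cocycle ::
    "('a, 'c) monoid_scheme \<Rightarrow> ('q, 'd) monoid_scheme \<Rightarrow> ('a \<Rightarrow> 'q) \<Rightarrow> ('q \<Rightarrow> 'a \<Rightarrow> int) \<Rightarrow> bool" where
  "cocycle G Q \<pi> \<Phi> \<longleftrightarrow> (\<forall>q\<in>carrier Q. \<forall>x\<in>carrier G. \<forall>y\<in>carrier G.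
     \<Phi> q (x \<otimes>\<^bsub>G\<^esub> y) = \<Phi> q x + \<Phi> (q \<otimes>\<^bsub>Q\<^esub> \<pi> x) y)"

text \<open>Integer representatives of a cocycle with values in the integers modulo
  \<open>n\<close>; residues are not normalized, so that lifting means correcting the same integers
  by multiples of \<open>n\<close>.\<close>

definition cocycle_mod ::
    "int \<Rightarrow> ('a, 'c) monoid_scheme \<Rightarrow> ('q, 'd) monoid_scheme \<Rightarrow> ('a \<Rightarrow> 'q) \<Rightarrow> ('q \<Rightarrow> 'a \<Rightarrow> int) \<Rightarrow> bool" where
  "cocycle_mod n G Q \<pi> \<Phi> \<longleftrightarrow> (\<forall>q\<in>carrier Q. \<forall>x\<in>carrier G. \<forall>y\<in>carrier G.
     [\<Phi> q (x \<otimes>\<^bsub>G\<^esub> y) = \<Phi> q x + \<Phi> (q \<otimes>\<^bsub>Q\<^esub> \<pi> x) y] (mod n))"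

lemma (in group_hom) cocycle_mod_one:
  assumes "cocycle_mod n G H h \<Phi>" "q \<in> carrier H"
  shows "[\<Phi> q \<one> = 0] (mod n)"
proof -
  have "[\<Phi> q (\<one> \<otimes> \<one>) = \<Phi> q \<one> + \<Phi> (q \<otimes>\<^bsub>H\<^esub> h \<one>) \<one>] (mod n)"
    using assms unfolding cocycle_mod_def by blast
  then have "[\<Phi> q \<one> = \<Phi> q \<one> + \<Phi> q \<one>] (mod n)" using assms by simp
  then show ?thesis by (simp add: cong_iff_dvd_diff)
qed

lemma (in group_hom) cocycle_mod_inv:
  assumes "cocycle_mod n G H h \<Phi>" "q \<in> carrier H" "x \<in> carrier G"
  shows "[\<Phi> q (inv x) = - \<Phi> (q \<otimes>\<^bsub>H\<^esub> inv\<^bsub>H\<^esub> h x) x] (mod n)"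
proof -
  have "[\<Phi> q (inv x \<otimes> x) = \<Phi> q (inv x) + \<Phi> (q \<otimes>\<^bsub>H\<^esub> h (inv x)) x] (mod n)"
    using assms unfolding cocycle_mod_def by blast
  then have "[\<Phi> q (inv x) + \<Phi> (q \<otimes>\<^bsub>H\<^esub> inv\<^bsub>H\<^esub> h x) x = 0] (mod n)"
    using assms cocycle_mod_one[OF assms(1,2)] cong_sym cong_trans by fastforce
  then show ?thesis
    by (simp add: cong_iff_dvd_diff)
qed

text \<open>A cocycle is determined by its values on generators. Labels may therefore be changed by
  multiples of \<open>n\<close> without losing the cocycle that they represent modulo
  \<open>n\<close>.\<close>

lemma (in group_hom) path_sum_cong_cocycle_mod:
  assumes \<Phi>: "cocycle_mod n G H h \<Phi>" and \<alpha>: "\<alpha> \<in> X \<rightarrow> carrier G"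
    and f: "\<And>q x. q \<in> carrier H \<Longrightarrow> x \<in> X \<Longrightarrow> [f q x = \<Phi> q (\<alpha> x)] (mod n)"
  shows "w \<in> words X \<Longrightarrow> q \<in> carrier H \<Longrightarrow>
    [H.path_sum (h \<circ> \<alpha>) f w q = \<Phi> q (G.word_value \<alpha> w)] (mod n)"
proof (induction w arbitrary: q)
  case Nil
  then show ?case using cocycle_mod_one[OF \<Phi>] by (simp add: cong_sym)
next
  case (Cons l w)
  obtain x e where l: "l = (x, e)" by fastforce
  have cl: "\<alpha> x \<in> carrier G" "x \<in> X" "G.word_value \<alpha> w \<in> carrier G"
      "G.letter_value \<alpha> l \<in> carrier G"
    using Cons.prems l \<alpha> by (auto intro: G.word_value_closed G.letter_value_closed)
  have hl: "h (G.letter_value \<alpha> l) = H.letter_value (h \<circ> \<alpha>) l"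
    using cl l by (simp add: G.letter_value_def H.letter_value_def)
  have step: "[(if e then f q x else - f (q \<otimes>\<^bsub>H\<^esub> inv\<^bsub>H\<^esub> (h (\<alpha> x))) x)
      = \<Phi> q (G.letter_value \<alpha> l)] (mod n)"
  proof (cases e)
    case True
    then show ?thesis using f[of q x] Cons.prems cl l by (simp add: G.letter_value_def)
  next
    case False
    have "[- f (q \<otimes>\<^bsub>H\<^esub> inv\<^bsub>H\<^esub> (h (\<alpha> x))) x = - \<Phi> (q \<otimes>\<^bsub>H\<^esub> inv\<^bsub>H\<^esub> (h (\<alpha> x))) (\<alpha> x)] (mod n)"
      using f Cons.prems cl by (simp add: cong_minus_minus_iff)
    then show ?thesis
      using cocycle_mod_inv[OF \<Phi>, of q "\<alpha> x"] Cons.prems cl l False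
      by (simp add: G.letter_value_def) (meson cong_sym cong_trans)
  qed
  have "[H.path_sum (h \<circ> \<alpha>) f w (q \<otimes>\<^bsub>H\<^esub> h (G.letter_value \<alpha> l))
      = \<Phi> (q \<otimes>\<^bsub>H\<^esub> h (G.letter_value \<alpha> l)) (G.word_value \<alpha> w)] (mod n)"
    using Cons.prems cl l by (intro Cons.IH) auto
  with step have "[H.path_sum (h \<circ> \<alpha>) f (l # w) q
      = \<Phi> q (G.letter_value \<alpha> l) + \<Phi> (q \<otimes>\<^bsub>H\<^esub> h (G.letter_value \<alpha> l)) (G.word_value \<alpha> w)] (mod n)"
    unfolding H.path_sum.simps l fst_conv snd_conv comp_apply hl[unfolded l comp_apply, symmetric]
    by (rule cong_add)
  moreover have "[\<Phi> q (G.word_value \<alpha> (l # w))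
      = \<Phi> q (G.letter_value \<alpha> l) + \<Phi> (q \<otimes>\<^bsub>H\<^esub> h (G.letter_value \<alpha> l)) (G.word_value \<alpha> w)] (mod n)"
    using \<Phi> cl Cons.prems unfolding cocycle_mod_def by simp
  ultimately show ?case using cong_sym cong_trans by blast
qed

text \<open>Integration of closed labels: a cancelling pair runs along an edge and back, and a
  relator contributes zero, so the path sum depends only on the group element. A relator may follow
  any prefix, hence closedness is required at every vertex \<open>q\<close>.\<close>

lemma cocycle_of_path_sum:
  assumes "group_hom (presented_group X R) Q \<pi>"
    and closed: "\<And>r q. r \<in> R \<Longrightarrow> r \<in> words X \<Longrightarrow> q \<in> carrier Q \<Longrightarrow>
      group.path_sum Q (\<pi> \<circ> gen_class X R) f r q = 0"
  obtains \<Phi> where "cocycle (presented_group X R) Q \<pi> \<Phi>"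
    "\<And>q w. q \<in> carrier Q \<Longrightarrow> w \<in> words X \<Longrightarrow>
      \<Phi> q (word_class X R w) = group.path_sum Q (\<pi> \<circ> gen_class X R) f w q"
proof -
  interpret group_hom "presented_group X R" Q \<pi> by fact
  define \<alpha> where "\<alpha> = \<pi> \<circ> gen_class X R"
  have \<alpha>: "\<alpha> \<in> X \<rightarrow> carrier Q" by (auto simp: \<alpha>_def gen_class_closed)
  have val: "\<pi> (word_class X R w) = H.word_value \<alpha> w" if "w \<in> words X" for w
    using that hom_word_value[of w X "gen_class X R"]
    by (auto simp: \<alpha>_def gen_class_closed word_class_conv_word_value)
  have inv: "H.path_sum \<alpha> f u q = H.path_sum \<alpha> f v q"
    if "word_equiv X R u v" "q \<in> carrier Q" for u v q
    using that
  proof (induction arbitrary: q rule: word_equiv.induct)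
    case (cancel u v x e)
    have c: "\<alpha> x \<in> carrier Q" "H.word_value \<alpha> u \<in> carrier Q"
      using cancel \<alpha> H.word_value_closed by auto
    then have "H.path_sum \<alpha> f ([(x, e), (x, \<not> e)] @ v) (q \<otimes>\<^bsub>Q\<^esub> H.word_value \<alpha> u)
      = H.path_sum \<alpha> f v (q \<otimes>\<^bsub>Q\<^esub> H.word_value \<alpha> u)"
      using cancel.prems by (simp add: H.letter_value_def H.m_assoc)
    moreover have "[(x, e), (x, \<not> e)] @ v \<in> words X" using cancel by simp
    ultimately show ?case
      using cancel.hyps cancel.prems \<alpha>
        H.path_sum_append[of u X \<alpha> q "[(x, e), (x, \<not> e)] @ v" f]
        H.path_sum_append[of u X \<alpha> q v f] by linarith
  next
    case (relator u v r)
    have c: "H.word_value \<alpha> u \<in> carrier Q" "H.word_value \<alpha> r \<in> carrier Q"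
      using relator \<alpha> H.word_value_closed by auto
    have "word_class X R r = \<one>\<^bsub>presented_group X R\<^esub>"
      using relator word_equiv.relator[of "[]" X "[]" r R]
      by (simp add: one_presented_group word_class_eq_iff)
    \<comment> \<open>The relator is a loop in the Cayley graph, so the path continues from the
      vertex where the relator began.\<close>
    then have r1: "H.word_value \<alpha> r = \<one>\<^bsub>Q\<^esub>" using val relator by (metis hom_one)
    have "H.path_sum \<alpha> f r (q \<otimes>\<^bsub>Q\<^esub> H.word_value \<alpha> u) = 0"
      using closed relator c by (simp add: \<alpha>_def)
    then show ?case
      using relator.hyps relator.prems \<alpha> c r1 H.path_sum_append[of u X \<alpha> q "r @ v" f]
        H.path_sum_append[of u X \<alpha> q v f]
        H.path_sum_append[of r X \<alpha> "q \<otimes>\<^bsub>Q\<^esub> H.word_value \<alpha> u" v f]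
      by simp
  qed auto
  define \<Phi> where "\<Phi> q A = H.path_sum \<alpha> f (SOME w. w \<in> words X \<and> word_class X R w = A) q" for q A
  have \<Phi>: "\<Phi> q (word_class X R w) = H.path_sum \<alpha> f w q" if "q \<in> carrier Q" "w \<in> words X" for q w
  proof -
    have "(\<lambda>v. v \<in> words X \<and> word_class X R v = word_class X R w)
        (SOME v. v \<in> words X \<and> word_class X R v = word_class X R w)"
      by (rule someI[of _ w]) (use that in simp)
    then show ?thesis
      using inv that by (auto simp: \<Phi>_def word_class_eq_iff)
  qed
  have "cocycle (presented_group X R) Q \<pi> \<Phi>"
    unfolding cocycle_def
  proof (intro ballI)
    fix q x y
    assume q: "q \<in> carrier Q" and "x \<in> carrier (presented_group X R)"
      "y \<in> carrier (presented_group X R)"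
    then obtain u v where uv: "u \<in> words X" "v \<in> words X" "x = word_class X R u" "y = word_class X R v"
      by (auto simp: carrier_presented_group)
    have "H.word_value \<alpha> u \<in> carrier Q" using uv \<alpha> H.word_value_closed by blast
    then show "\<Phi> q (x \<otimes>\<^bsub>presented_group X R\<^esub> y) = \<Phi> q x + \<Phi> (q \<otimes>\<^bsub>Q\<^esub> \<pi> x) y"
      using uv q \<alpha> H.path_sum_append[of u X \<alpha> q v f] by (simp add: mult_word_class \<Phi> val)
  qed
  then show thesis using that \<Phi> \<alpha>_def by blast
qed


section \<open>The surface relator\<close>

abbreviation surface_gens :: "nat \<Rightarrow> surface_gen set" where
  "surface_gens g \<equiv> Gen_a ` {1..g} \<union> Gen_b ` {1..g}"

lemma surface_relator_0 [simp]: "surface_relator 0 = []"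
  by (simp add: surface_relator_def)

lemma surface_relator_Suc [simp]:
  "surface_relator (Suc n) = surface_relator n @
    [(Gen_a (Suc n), True), (Gen_b (Suc n), True), (Gen_a (Suc n), False), (Gen_b (Suc n), False)]"
  by (simp add: surface_relator_def)

lemma surface_relator_in_words: "n \<le> g \<Longrightarrow> surface_relator n \<in> words (surface_gens g)"
  by (induction n) auto

section \<open>Boundaries of faces and connectedness of the dual graph\<close>

context group
begin

lemma inv_mult_cancel_left [simp]:
  "x \<in> carrier G \<Longrightarrow> y \<in> carrier G \<Longrightarrow> inv x \<otimes> (x \<otimes> y) = y"
  "x \<in> carrier G \<Longrightarrow> y \<in> carrier G \<Longrightarrow> x \<otimes> (inv x \<otimes> y) = y"
  by (simp_all flip: m_assoc)

lemma path_sum_lincomb: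
  "finite A \<Longrightarrow> path_sum \<alpha> (\<lambda>q x. \<Sum>i\<in>A. c i * f i q x) w q = (\<Sum>i\<in>A. c i * path_sum \<alpha> (f i) w q)"
  by (induction w arbitrary: q) (auto simp: algebra_simps sum.distrib sum_negf sum_subtractf)

lemma path_sum_add:
  "path_sum \<alpha> (\<lambda>q x. f q x + c * f' q x) w q = path_sum \<alpha> f w q + c * path_sum \<alpha> f' w q"
  by (induction w arbitrary: q) (auto simp: algebra_simps)

lemma word_value_surface_relator:
  assumes "\<alpha> \<in> surface_gens g \<rightarrow> carrier G" "n \<le> g"
  shows "word_value \<alpha> (surface_relator n) \<in> carrier G"
  using surface_relator_in_words[OF assms(2)] assms(1) by (rule word_value_closed)

lemma word_value_surface_relator_Suc:
  assumes "\<alpha> \<in> surface_gens g \<rightarrow> carrier G" "Suc n \<le> g"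
  shows "word_value \<alpha> (surface_relator (Suc n)) =
    word_value \<alpha> (surface_relator n) \<otimes> (\<alpha> (Gen_a (Suc n)) \<otimes> (\<alpha> (Gen_b (Suc n)) \<otimes>
      (inv \<alpha> (Gen_a (Suc n)) \<otimes> inv \<alpha> (Gen_b (Suc n)))))"
proof -
  have "\<alpha> (Gen_a (Suc n)) \<in> carrier G" "\<alpha> (Gen_b (Suc n)) \<in> carrier G"
    using assms by auto
  then show ?thesis
    using assms surface_relator_in_words[of n g]
    by (simp add: word_value_append[of _ "surface_gens g"] letter_value_def)
qed

text \<open>Each commutator runs along edges \<open>a\<close>, \<open>b\<close>, \<open>a\<close>,
  \<open>b\<close>, the last two backwards. A label sits at the initial vertex of its edge, so for a
  backward step it is read at the vertex reached; for the last step this is the prefix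
  \<open>w (Suc j)\<close>.\<close>

lemma path_sum_surface_relator:
  assumes "\<alpha> \<in> surface_gens g \<rightarrow> carrier G" "q \<in> carrier G"
  defines "w \<equiv> \<lambda>j. word_value \<alpha> (surface_relator j)"
  shows "n \<le> g \<Longrightarrow> path_sum \<alpha> f (surface_relator n) q = (\<Sum>j<n.
    f (q \<otimes> w j) (Gen_a (Suc j)) + f (q \<otimes> (w j \<otimes> \<alpha> (Gen_a (Suc j)))) (Gen_b (Suc j))
    - f (q \<otimes> (w j \<otimes> (\<alpha> (Gen_a (Suc j)) \<otimes> (\<alpha> (Gen_b (Suc j)) \<otimes> inv \<alpha> (Gen_a (Suc j)))))) (Gen_a (Suc j))
    - f (q \<otimes> w (Suc j)) (Gen_b (Suc j)))"
proof (induction n)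
  case (Suc n)
  have c: "\<alpha> (Gen_a (Suc n)) \<in> carrier G" "\<alpha> (Gen_b (Suc n)) \<in> carrier G" "w n \<in> carrier G"
    using assms Suc.prems word_value_surface_relator by (auto simp: w_def)
  have "w (Suc n) = w n \<otimes> (\<alpha> (Gen_a (Suc n)) \<otimes> (\<alpha> (Gen_b (Suc n)) \<otimes>
      (inv \<alpha> (Gen_a (Suc n)) \<otimes> inv \<alpha> (Gen_b (Suc n)))))"
    unfolding w_def using assms Suc.prems by (intro word_value_surface_relator_Suc)
  then show ?case
    unfolding surface_relator_Suc sum.lessThan_Suc
    using Suc c assms(1,2) surface_relator_in_words[of n g]
    by (subst path_sum_append[of _ "surface_gens g"]) (auto simp: letter_value_def m_assoc w_def)
qed simp

lemma sum_translate:
  assumes "c \<in> carrier G"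
  shows "(\<Sum>q\<in>carrier G. F (q \<otimes> c)) = (\<Sum>q\<in>carrier G. F q)"
  by (rule sum.reindex_bij_witness[where i = "\<lambda>q. q \<otimes> inv c" and j = "\<lambda>q. q \<otimes> c"])
     (use assms in \<open>auto simp: m_assoc\<close>)

text \<open>Every edge of the Cayley complex lies on exactly two faces, with opposite orientations.\<close>

lemma sum_path_sum_surface_relator:
  assumes \<alpha>: "\<alpha> \<in> surface_gens g \<rightarrow> carrier G" and "finite (carrier G)"
  shows "(\<Sum>q\<in>carrier G. path_sum \<alpha> f (surface_relator g) q) = (0::int)"
proof -
  let ?w = "\<lambda>j. word_value \<alpha> (surface_relator j)"
  let ?a = "\<lambda>j. \<alpha> (Gen_a (Suc j))" and ?b = "\<lambda>j. \<alpha> (Gen_b (Suc j))"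
  have c: "?w j \<in> carrier G" "?w (Suc j) \<in> carrier G" "?a j \<in> carrier G" "?b j \<in> carrier G"
    if "j < g" for j
    using that \<alpha> word_value_surface_relator[OF \<alpha>, of "Suc j"] word_value_surface_relator[OF \<alpha>, of j]
    by auto
  have "(\<Sum>q\<in>carrier G. path_sum \<alpha> f (surface_relator g) q) = (\<Sum>q\<in>carrier G. \<Sum>j<g.
    f (q \<otimes> ?w j) (Gen_a (Suc j)) + f (q \<otimes> (?w j \<otimes> ?a j)) (Gen_b (Suc j))
    - f (q \<otimes> (?w j \<otimes> (?a j \<otimes> (?b j \<otimes> inv ?a j)))) (Gen_a (Suc j))
    - f (q \<otimes> ?w (Suc j)) (Gen_b (Suc j)))"
    using path_sum_surface_relator[OF \<alpha>] by (intro sum.cong) auto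
  also have "\<dots> = (\<Sum>j<g. (\<Sum>q\<in>carrier G. f (q \<otimes> ?w j) (Gen_a (Suc j)))
    + (\<Sum>q\<in>carrier G. f (q \<otimes> (?w j \<otimes> ?a j)) (Gen_b (Suc j)))
    - (\<Sum>q\<in>carrier G. f (q \<otimes> (?w j \<otimes> (?a j \<otimes> (?b j \<otimes> inv ?a j)))) (Gen_a (Suc j)))
    - (\<Sum>q\<in>carrier G. f (q \<otimes> ?w (Suc j)) (Gen_b (Suc j))))"
    by (subst sum.swap) (simp add: sum.distrib sum_subtractf del: surface_relator_Suc)
  also have "\<dots> = 0"
  proof (rule sum.neutral, rule ballI)
    fix j assume "j \<in> {..<g}"
    then have j: "?w j \<in> carrier G" "?w (Suc j) \<in> carrier G" "?a j \<in> carrier G" "?b j \<in> carrier G"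
      using c by (auto simp del: surface_relator_Suc)
    then have j': "?w j \<otimes> ?a j \<in> carrier G"
      "?w j \<otimes> (?a j \<otimes> (?b j \<otimes> inv ?a j)) \<in> carrier G" by auto
    show "(\<Sum>q\<in>carrier G. f (q \<otimes> ?w j) (Gen_a (Suc j)))
    + (\<Sum>q\<in>carrier G. f (q \<otimes> (?w j \<otimes> ?a j)) (Gen_b (Suc j)))
    - (\<Sum>q\<in>carrier G. f (q \<otimes> (?w j \<otimes> (?a j \<otimes> (?b j \<otimes> inv ?a j)))) (Gen_a (Suc j)))
    - (\<Sum>q\<in>carrier G. f (q \<otimes> ?w (Suc j)) (Gen_b (Suc j))) = 0"
      unfolding sum_translate[OF j(1), of "\<lambda>q. f q (Gen_a (Suc j))"]
        sum_translate[OF j(2), of "\<lambda>q. f q (Gen_b (Suc j))"]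
        sum_translate[OF j'(1), of "\<lambda>q. f q (Gen_b (Suc j))"]
        sum_translate[OF j'(2), of "\<lambda>q. f q (Gen_a (Suc j))"] by simp
  qed
  finally show ?thesis .
qed

text \<open>The edges crossed by a path from the face \<open>x\<close> to the face \<open>y\<close> of the Cayley complex yield
  such a labelling \<open>e\<close>.\<close>

definition face_connected :: "nat \<Rightarrow> (surface_gen \<Rightarrow> 'a) \<Rightarrow> 'a \<Rightarrow> 'a \<Rightarrow> bool" where
  "face_connected g \<alpha> x y \<longleftrightarrow> (\<exists>e. \<forall>q\<in>carrier G.
     path_sum \<alpha> e (surface_relator g) q = of_bool (q = x) - of_bool (q = y))"

lemma face_connected_sym:
  assumes "face_connected g \<alpha> x y" shows "face_connected g \<alpha> y x"
proof -
  obtain e where e: "\<forall>q\<in>carrier G. path_sum \<alpha> e (surface_relator g) q = of_bool (q = x) - of_bool (q = y)"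
    using assms unfolding face_connected_def by blast
  \<comment> \<open>The negated labelling is written in the shape of
    \<open>path_sum_add\<close>.\<close>
  have "path_sum \<alpha> (\<lambda>q x. 0 + (- 1) * e q x) w q = - path_sum \<alpha> e w q" for w q
    unfolding path_sum_add by (induction w arbitrary: q) auto
  then show ?thesis
    unfolding face_connected_def using e by (intro exI[of _ "\<lambda>q x. 0 + (- 1) * e q x"]) auto
qed

lemma face_connected_trans:
  assumes "face_connected g \<alpha> x y" "face_connected g \<alpha> y z" shows "face_connected g \<alpha> x z"
proof -
  obtain e e' where
    "\<forall>q\<in>carrier G. path_sum \<alpha> e (surface_relator g) q = of_bool (q = x) - of_bool (q = y)"
    "\<forall>q\<in>carrier G. path_sum \<alpha> e' (surface_relator g) q = of_bool (q = y) - of_bool (q = z)"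
    using assms unfolding face_connected_def by blast
  then have "\<forall>q\<in>carrier G. path_sum \<alpha> (\<lambda>q x. e q x + 1 * e' q x) (surface_relator g) q
      = of_bool (q = x) - of_bool (q = z)"
    unfolding path_sum_add by simp
  then show ?thesis unfolding face_connected_def by blast
qed

text \<open>The indicator of a single edge has as coboundary the difference of the two faces on that
  edge. For the chosen \<open>a\<close>-edge and \<open>b\<close>-edge of the face \<open>x\<close>,
  the second face is found by solving for the base point at which the backward occurrence hits the
  same edge.\<close>

lemma face_connected_step:
  assumes \<alpha>: "\<alpha> \<in> surface_gens g \<rightarrow> carrier G" and i: "i < g" and x: "x \<in> carrier G"
  defines "w \<equiv> \<lambda>j. word_value \<alpha> (surface_relator j)"
    and "a \<equiv> \<alpha> (Gen_a (Suc i))" and "b \<equiv> \<alpha> (Gen_b (Suc i))"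
  shows "face_connected g \<alpha> x (x \<otimes> (w i \<otimes> inv (w i \<otimes> (a \<otimes> (b \<otimes> inv a)))))"
    and "face_connected g \<alpha> x (x \<otimes> (w i \<otimes> a \<otimes> inv (w (Suc i))))"
proof -
  have c: "w i \<in> carrier G" "w (Suc i) \<in> carrier G" "a \<in> carrier G" "b \<in> carrier G"
    using assms i word_value_surface_relator[OF \<alpha>, of "Suc i"] word_value_surface_relator[OF \<alpha>, of i]
    by auto
  have right: "q \<otimes> y = x \<otimes> z \<longleftrightarrow> q = x \<otimes> (z \<otimes> inv y)"
    if "q \<in> carrier G" "y \<in> carrier G" "z \<in> carrier G" for q y z
  proof
    assume "q \<otimes> y = x \<otimes> z"
    then have "q \<otimes> y \<otimes> inv y = x \<otimes> z \<otimes> inv y" by simp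
    then show "q = x \<otimes> (z \<otimes> inv y)" using that x by (simp add: m_assoc)
  qed (use that x in \<open>simp add: m_assoc\<close>)
  define ea where "ea = (\<lambda>q s. of_bool (q = x \<otimes> w i \<and> s = Gen_a (Suc i)) :: int)"
  define eb where "eb = (\<lambda>q s. of_bool (q = x \<otimes> (w i \<otimes> a) \<and> s = Gen_b (Suc i)) :: int)"
  have "path_sum \<alpha> ea (surface_relator g) q
      = of_bool (q = x) - of_bool (q = x \<otimes> (w i \<otimes> inv (w i \<otimes> (a \<otimes> (b \<otimes> inv a)))))"
    if q: "q \<in> carrier G" for q
  proof -
    have "path_sum \<alpha> ea (surface_relator g) q = (\<Sum>j<g. if j = i then
        of_bool (q \<otimes> w i = x \<otimes> w i) - of_bool (q \<otimes> (w i \<otimes> (a \<otimes> (b \<otimes> inv a))) = x \<otimes> w i) else 0)"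
      unfolding path_sum_surface_relator[OF \<alpha> q order.refl]
      by (intro sum.cong) (auto simp: ea_def w_def a_def b_def)
    also have "\<dots> = of_bool (q \<otimes> w i = x \<otimes> w i) - of_bool (q \<otimes> (w i \<otimes> (a \<otimes> (b \<otimes> inv a))) = x \<otimes> w i)"
      using i by simp
    finally show ?thesis
      using right[of q "w i \<otimes> (a \<otimes> (b \<otimes> inv a))" "w i"] c x q by simp
  qed
  then show "face_connected g \<alpha> x (x \<otimes> (w i \<otimes> inv (w i \<otimes> (a \<otimes> (b \<otimes> inv a)))))"
    unfolding face_connected_def by blast
  have "path_sum \<alpha> eb (surface_relator g) q
      = of_bool (q = x) - of_bool (q = x \<otimes> (w i \<otimes> a \<otimes> inv (w (Suc i))))"
    if q: "q \<in> carrier G" for q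
  proof -
    have "path_sum \<alpha> eb (surface_relator g) q = (\<Sum>j<g. if j = i then
        of_bool (q \<otimes> (w i \<otimes> a) = x \<otimes> (w i \<otimes> a)) - of_bool (q \<otimes> w (Suc i) = x \<otimes> (w i \<otimes> a)) else 0)"
      unfolding path_sum_surface_relator[OF \<alpha> q order.refl]
      by (intro sum.cong) (auto simp: eb_def w_def a_def b_def simp del: surface_relator_Suc)
    also have "\<dots> = of_bool (q \<otimes> (w i \<otimes> a) = x \<otimes> (w i \<otimes> a)) - of_bool (q \<otimes> w (Suc i) = x \<otimes> (w i \<otimes> a))"
      using i by simp
    finally show ?thesis
      using right[of q "w (Suc i)" "w i \<otimes> a"] c x q by simp
  qed
  then show "face_connected g \<alpha> x (x \<otimes> (w i \<otimes> a \<otimes> inv (w (Suc i))))"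
    unfolding face_connected_def by blast
qed

text \<open>The set \<open>D\<close> of translations that keep every face in its component is a
  subgroup. Let \<open>w\<close> be the product of the first \<open>j\<close> commutators. The two
  steps \<open>c1\<close>, \<open>c2\<close> across the edges of the next commutator satisfy
  \<open>c1 c2 c1^-1 = w a w^-1\<close> and \<open>c1^-1 = w a b a^-1 w^-1\<close>. Once
  \<open>w\<close> is in \<open>D\<close>, so are \<open>a\<close>, then \<open>b\<close>, then the
  next prefix.\<close>

lemma face_connected_generated:
  assumes \<alpha>: "\<alpha> \<in> surface_gens g \<rightarrow> carrier G"
    and gen: "\<And>K. subgroup K G \<Longrightarrow> \<alpha> ` surface_gens g \<subseteq> K \<Longrightarrow> K = carrier G"
    and xy: "x \<in> carrier G" "y \<in> carrier G"
  shows "face_connected g \<alpha> x y"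
proof -
  define D where "D = {c \<in> carrier G. \<forall>x\<in>carrier G. face_connected g \<alpha> x (x \<otimes> c)}"
  have "path_sum \<alpha> (\<lambda>q x. 0) w q = 0" for w q by (induction w arbitrary: q) auto
  then have refl: "face_connected g \<alpha> x x" for x
    unfolding face_connected_def by (intro exI[of _ "\<lambda>q x. 0"]) auto
  have D: "subgroup D G"
  proof (rule subgroupI)
    show "D \<noteq> {}" using refl by (auto simp: D_def intro!: exI[of _ \<one>])
    show "inv c \<in> D" if "c \<in> D" for c
    proof -
      have "face_connected g \<alpha> x (x \<otimes> inv c)" if "x \<in> carrier G" for x
      proof -
        have "face_connected g \<alpha> (x \<otimes> inv c) (x \<otimes> inv c \<otimes> c)" using that \<open>c \<in> D\<close> by (auto simp: D_def)
        moreover have "x \<otimes> inv c \<otimes> c = x" using that \<open>c \<in> D\<close> by (auto simp: D_def m_assoc)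
        ultimately show ?thesis using face_connected_sym by metis
      qed
      then show ?thesis using that by (auto simp: D_def)
    qed
    show "c \<otimes> d \<in> D" if "c \<in> D" "d \<in> D" for c d
    proof -
      have "face_connected g \<alpha> x (x \<otimes> (c \<otimes> d))" if "x \<in> carrier G" for x
      proof -
        have "face_connected g \<alpha> x (x \<otimes> c)" "face_connected g \<alpha> (x \<otimes> c) (x \<otimes> c \<otimes> d)"
          using that \<open>c \<in> D\<close> \<open>d \<in> D\<close> by (auto simp: D_def)
        moreover have "x \<otimes> c \<otimes> d = x \<otimes> (c \<otimes> d)" using that \<open>c \<in> D\<close> \<open>d \<in> D\<close> by (auto simp: D_def m_assoc)
        ultimately show ?thesis using face_connected_trans by metis
      qed
      then show ?thesis using that by (auto simp: D_def)
    qed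
  qed (auto simp: D_def)
  interpret D: subgroup D G by fact
  let ?w = "\<lambda>j. word_value \<alpha> (surface_relator j)"
  have step: "\<alpha> (Gen_a (Suc j)) \<in> D \<and> \<alpha> (Gen_b (Suc j)) \<in> D \<and> ?w (Suc j) \<in> D"
    if "j < g" "?w j \<in> D" for j
  proof -
    define a b w where abw: "a = \<alpha> (Gen_a (Suc j))" "b = \<alpha> (Gen_b (Suc j))" "w = ?w j"
    have c: "a \<in> carrier G" "b \<in> carrier G" "w \<in> carrier G"
      using that \<alpha> D.subset by (auto simp: abw)
    have w': "?w (Suc j) = w \<otimes> (a \<otimes> (b \<otimes> (inv a \<otimes> inv b)))"
      using word_value_surface_relator_Suc[OF \<alpha>, of j] that abw by simp
    then have c': "?w (Suc j) \<in> carrier G" using c by simp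
    define c1 c2 where c12: "c1 = w \<otimes> inv (w \<otimes> (a \<otimes> (b \<otimes> inv a)))" "c2 = w \<otimes> a \<otimes> inv ?w (Suc j)"
    have D1: "c1 \<in> D" "c2 \<in> D"
      using face_connected_step[OF \<alpha> \<open>j < g\<close>] c c' unfolding D_def c12 abw by auto
    have "c1 \<otimes> c2 \<otimes> inv c1 = w \<otimes> a \<otimes> inv w"
      unfolding c12 w' using c by (simp add: m_assoc inv_mult_group)
    then have "inv w \<otimes> (c1 \<otimes> c2 \<otimes> inv c1) \<otimes> w = a" using c by (simp add: m_assoc)
    moreover have "inv w \<otimes> (c1 \<otimes> c2 \<otimes> inv c1) \<otimes> w \<in> D"
      using D1 that by (intro D.m_closed D.m_inv_closed) (auto simp: abw)
    ultimately have a: "a \<in> D" by simp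
    have "inv a \<otimes> (inv w \<otimes> inv c1 \<otimes> w) \<otimes> a \<in> D"
      using D1 a that by (intro D.m_closed D.m_inv_closed) (auto simp: abw)
    moreover have "inv a \<otimes> (inv w \<otimes> inv c1 \<otimes> w) \<otimes> a = b"
      unfolding c12 using c by (simp add: m_assoc inv_mult_group)
    ultimately have b: "b \<in> D" by simp
    then have "?w (Suc j) \<in> D"
      unfolding w' using a that by (intro D.m_closed D.m_inv_closed) (auto simp: abw)
    then show ?thesis using a b by (simp only: abw)
  qed
  have "?w j \<in> D" if "j \<le> g" for j
    using that by (induction j) (use step in \<open>auto simp del: surface_relator_Suc\<close>)
  then have ab: "\<alpha> (Gen_a (Suc j)) \<in> D" "\<alpha> (Gen_b (Suc j)) \<in> D" if "j < g" for j
    using step that by auto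
  have "\<alpha> ` surface_gens g \<subseteq> D"
  proof -
    have "\<alpha> (Gen_a i) \<in> D" "\<alpha> (Gen_b i) \<in> D" if "i \<in> {1..g}" for i
      using ab[of "i - 1"] that by auto
    then show ?thesis by auto
  qed
  then have "D = carrier G" by (rule gen[OF D])
  then have "inv x \<otimes> y \<in> D" using xy by simp
  then have "face_connected g \<alpha> x (x \<otimes> (inv x \<otimes> y))" using xy(1) unfolding D_def by blast
  then show ?thesis using xy by simp
qed

text \<open>The coboundary from edges to faces reaches every integral face labelling of total sum zero,
  because the dual graph is connected.\<close>

lemma path_sum_surface_relator_surj:
  assumes \<alpha>: "\<alpha> \<in> surface_gens g \<rightarrow> carrier G"
    and gen: "\<And>K. subgroup K G \<Longrightarrow> \<alpha> ` surface_gens g \<subseteq> K \<Longrightarrow> K = carrier G"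
    and fin: "finite (carrier G)" and k: "(\<Sum>q\<in>carrier G. k q) = 0"
  obtains e where "\<And>q. q \<in> carrier G \<Longrightarrow> path_sum \<alpha> e (surface_relator g) q = k q"
proof -
  have "\<exists>e. \<forall>q\<in>carrier G. path_sum \<alpha> e (surface_relator g) q = of_bool (q = x) - of_bool (q = \<one>)"
    if "x \<in> carrier G" for x
    using face_connected_generated[OF \<alpha> gen that one_closed] by (auto simp: face_connected_def)
  then obtain E where E: "\<And>x q. x \<in> carrier G \<Longrightarrow> q \<in> carrier G \<Longrightarrow>
      path_sum \<alpha> (E x) (surface_relator g) q = of_bool (q = x) - of_bool (q = \<one>)"
    by metis
  \<comment> \<open>Every \<open>E x\<close> subtracts 1 at the base face; weighted by
    \<open>k\<close>, these contributions add up to the total sum of \<open>k\<close>, which is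
    zero.\<close>
  have "path_sum \<alpha> (\<lambda>q s. \<Sum>x\<in>carrier G. k x * E x q s) (surface_relator g) q = k q"
    if q: "q \<in> carrier G" for q
  proof -
    have "path_sum \<alpha> (\<lambda>q s. \<Sum>x\<in>carrier G. k x * E x q s) (surface_relator g) q
      = (\<Sum>x\<in>carrier G. k x * (of_bool (q = x) - of_bool (q = \<one>)))"
      unfolding path_sum_lincomb[OF fin] using E q by (intro sum.cong) auto
    also have "\<dots> = (\<Sum>x\<in>carrier G. k x * of_bool (q = x)) - (\<Sum>x\<in>carrier G. k x) * of_bool (q = \<one>)"
      by (simp add: algebra_simps sum_subtractf sum_distrib_left)
    also have "(\<Sum>x\<in>carrier G. k x * of_bool (q = x)) = (\<Sum>x\<in>carrier G. if x = q then k x else 0)"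
      by (intro sum.cong) auto
    also have "\<dots> = k q" using q fin by simp
    finally show ?thesis using k by simp
  qed
  then show thesis using that by blast
qed

end


section \<open>Cocycles on surface groups\<close>

text \<open>Products in a quotient stay abstract, so that the laws of the group
  \<open>G Mod H\<close> apply instead of those for set products.\<close>

declare mult_FactGroup [simp del] one_FactGroup [simp del]

lemma (in group_hom) subgroup_preimage:
  assumes "subgroup K H" shows "subgroup {x \<in> carrier G. h x \<in> K} G"
proof -
  interpret K: subgroup K H by fact
  show ?thesis by (rule G.subgroupI) (auto intro!: exI[of _ \<one>])
qed

abbreviation surface_gen_class :: "nat \<Rightarrow> surface_gen \<Rightarrow> surface_gen word set" where
  "surface_gen_class g \<equiv> gen_class (surface_gens g) {surface_relator g}"

lemma group_surface_group: "group (surface_group g)"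
  by (simp add: surface_group_def group_presented_group)

lemma surface_gen_class_closed:
  "x \<in> surface_gens g \<Longrightarrow> surface_gen_class g x \<in> carrier (surface_group g)"
  unfolding surface_group_def by (rule gen_class_closed)

lemma (in normal) group_hom_Mod: "group_hom G (G Mod H) (\<lambda>x. H #> x)"
  using r_coset_hom_Mod factorgroup_is_group
  by (intro group_hom.intro group_hom_axioms.intro) (simp_all add: is_group)

abbreviation coset_cocycle :: "('a, 'b) monoid_scheme \<Rightarrow> 'a set \<Rightarrow> ('a set \<Rightarrow> 'a \<Rightarrow> int) \<Rightarrow> bool" where
  "coset_cocycle G H \<equiv> cocycle G (G Mod H) (\<lambda>x. H #>\<^bsub>G\<^esub> x)"

text \<open>With a single relator, closedness has to be checked only around the faces, one for each
  coset \<open>q\<close>.\<close>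

lemma surface_cocycle:
  assumes "H \<lhd> surface_group g"
  defines "\<alpha> \<equiv> \<lambda>x. H #>\<^bsub>surface_group g\<^esub> surface_gen_class g x"
  assumes closed: "\<And>q. q \<in> carrier (surface_group g Mod H) \<Longrightarrow>
      group.path_sum (surface_group g Mod H) \<alpha> f (surface_relator g) q = 0"
  obtains \<Phi> where "coset_cocycle (surface_group g) H \<Phi>"
    "\<And>q w. q \<in> carrier (surface_group g Mod H) \<Longrightarrow> w \<in> words (surface_gens g) \<Longrightarrow>
      \<Phi> q (word_class (surface_gens g) {surface_relator g} w) =
      group.path_sum (surface_group g Mod H) \<alpha> f w q"
    "\<And>q x. q \<in> carrier (surface_group g Mod H) \<Longrightarrow> x \<in> surface_gens g \<Longrightarrow>
      \<Phi> q (surface_gen_class g x) = f q x"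
proof -
  interpret normal H "surface_group g" by fact
  interpret h: group_hom "surface_group g" "surface_group g Mod H" "\<lambda>x. H #>\<^bsub>surface_group g\<^esub> x"
    by (rule group_hom_Mod)
  have \<alpha>: "(\<lambda>x. H #>\<^bsub>surface_group g\<^esub> x) \<circ> surface_gen_class g = \<alpha>"
    by (auto simp: \<alpha>_def)
  obtain \<Phi> where \<Phi>: "coset_cocycle (surface_group g) H \<Phi>"
    "\<And>q w. q \<in> carrier (surface_group g Mod H) \<Longrightarrow> w \<in> words (surface_gens g) \<Longrightarrow>
      \<Phi> q (word_class (surface_gens g) {surface_relator g} w) =
      group.path_sum (surface_group g Mod H) \<alpha> f w q"
    using cocycle_of_path_sum[OF h.group_hom_axioms[unfolded surface_group_def], of f]
      closed \<alpha> unfolding surface_group_def by auto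
  moreover have "\<Phi> q (surface_gen_class g x) = f q x"
    if "q \<in> carrier (surface_group g Mod H)" "x \<in> surface_gens g" for q x
    unfolding gen_class_def using that \<Phi>(2)[of q "[(x, True)]"] by simp
  ultimately show thesis using that by blast
qed

lemma surface_gen_coset:
  assumes "H \<lhd> surface_group g"
  shows "(\<lambda>x. H #>\<^bsub>surface_group g\<^esub> surface_gen_class g x)
    \<in> surface_gens g \<rightarrow> carrier (surface_group g Mod H)"
  unfolding carrier_FactGroup by (intro Pi_I imageI surface_gen_class_closed)

text \<open>Labels that do not depend on the vertex close up because every generator occurs in the
  relator once with each sign. When \<open>H\<close> is the whole group, this is the exponent sum of
  \<open>s\<close>, a homomorphism to the integers.\<close>

lemma exponent_sum_cocycle:
  assumes "H \<lhd> surface_group g"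
  obtains \<Phi> where "coset_cocycle (surface_group g) H \<Phi>"
    "\<And>q x. q \<in> carrier (surface_group g Mod H) \<Longrightarrow> x \<in> surface_gens g \<Longrightarrow>
      \<Phi> q (surface_gen_class g x) = of_bool (x = s)"
proof -
  interpret normal H "surface_group g" by fact
  interpret Q: group "surface_group g Mod H" by (rule factorgroup_is_group)
  have "Q.path_sum (\<lambda>x. H #>\<^bsub>surface_group g\<^esub> surface_gen_class g x)
      (\<lambda>q x. of_bool (x = s)) (surface_relator g) q = 0"
    if "q \<in> carrier (surface_group g Mod H)" for q
    using Q.path_sum_surface_relator[OF surface_gen_coset[OF assms] that order.refl]
    by simp
  then obtain \<Phi> where "coset_cocycle (surface_group g) H \<Phi>"
    "\<And>q x. q \<in> carrier (surface_group g Mod H) \<Longrightarrow> x \<in> surface_gens g \<Longrightarrow>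
      \<Phi> q (surface_gen_class g x) = of_bool (x = s)"
    using surface_cocycle[OF assms, of "\<lambda>q x. of_bool (x = s)"] by metis
  then show thesis using that by blast
qed

text \<open>The labelling counts crossings with (a curve parallel to) the lift of \<open>a\<^sub>i\<close> to the covering
  surface, and is evaluated on the lifts of the powers of \<open>b\<^sub>i\<close>.\<close>

lemma crossing_cocycle:
  fixes H i g
  defines "G \<equiv> surface_group g"
  defines "\<alpha> \<equiv> \<lambda>x. H #>\<^bsub>G\<^esub> surface_gen_class g x"
  assumes H: "H \<lhd> G" and i: "i \<in> {1..g}"
  obtains \<Phi> where "coset_cocycle G H \<Phi>"
    "\<And>q e. q \<in> carrier (G Mod H) \<Longrightarrow>
      \<Phi> q (surface_gen_class g (Gen_b i) [^]\<^bsub>G\<^esub> (e::nat)) =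
      (\<Sum>j<e. of_bool (q \<otimes>\<^bsub>G Mod H\<^esub> \<alpha> (Gen_b i) [^]\<^bsub>G Mod H\<^esub> Suc j
        \<in> generate (G Mod H) {\<alpha> (Gen_a i)}))"
proof -
  let ?Q = "G Mod H"
  interpret normal H G by fact
  interpret h: group_hom G ?Q "\<lambda>x. H #>\<^bsub>G\<^esub> x" by (rule group_hom_Mod)
  define C where "C = generate ?Q {\<alpha> (Gen_a i)}"
  have \<alpha>: "\<alpha> \<in> surface_gens g \<rightarrow> carrier ?Q"
    using surface_gen_coset H unfolding G_def \<alpha>_def by blast
  then have ab: "\<alpha> (Gen_a i) \<in> carrier ?Q" "\<alpha> (Gen_b i) \<in> carrier ?Q" using i by auto
  then interpret C: subgroup C ?Q
    unfolding C_def by (intro h.H.generate_is_subgroup) auto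
  have aC: "\<alpha> (Gen_a i) \<in> C" unfolding C_def by (simp add: generate.incl)
  have C_iff: "y \<otimes>\<^bsub>?Q\<^esub> inv\<^bsub>?Q\<^esub> \<alpha> (Gen_a i) \<in> C \<longleftrightarrow> y \<in> C" if "y \<in> carrier ?Q" for y
  proof
    assume "y \<otimes>\<^bsub>?Q\<^esub> inv\<^bsub>?Q\<^esub> \<alpha> (Gen_a i) \<in> C"
    then have "y \<otimes>\<^bsub>?Q\<^esub> inv\<^bsub>?Q\<^esub> \<alpha> (Gen_a i) \<otimes>\<^bsub>?Q\<^esub> \<alpha> (Gen_a i) \<in> C" using aC by (rule C.m_closed)
    then show "y \<in> C" using that ab by (simp add: h.H.m_assoc)
  qed (use aC in auto)
  \<comment> \<open>Counted are the \<open>b\<close>-edges that end on the cycle \<open>C\<close>.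
    The two \<open>b\<close>-edges of a face with index \<open>i\<close> have end points that differ
    by a factor \<open>inv a\<close> on the right, so both end in \<open>C\<close> or neither
    does.\<close>
  define f where "f q x = (of_bool (x = Gen_b i \<and> q \<otimes>\<^bsub>?Q\<^esub> \<alpha> (Gen_b i) \<in> C) :: int)" for q x
  have "h.H.path_sum \<alpha> f (surface_relator g) q = 0" if q: "q \<in> carrier ?Q" for q
    unfolding h.H.path_sum_surface_relator[OF \<alpha> q order.refl]
  proof (rule sum.neutral, rule ballI)
    fix j assume j: "j \<in> {..<g}"
    let ?w = "\<lambda>j. h.H.word_value \<alpha> (surface_relator j)"
    let ?a = "\<alpha> (Gen_a (Suc j))" and ?b = "\<alpha> (Gen_b (Suc j))"
    have c: "?w j \<in> carrier ?Q" "?a \<in> carrier ?Q" "?b \<in> carrier ?Q"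
      using h.H.word_value_surface_relator[OF \<alpha>, of j] j \<alpha> by auto
    have w: "?w (Suc j) = ?w j \<otimes>\<^bsub>?Q\<^esub> (?a \<otimes>\<^bsub>?Q\<^esub> (?b \<otimes>\<^bsub>?Q\<^esub> (inv\<^bsub>?Q\<^esub> ?a \<otimes>\<^bsub>?Q\<^esub> inv\<^bsub>?Q\<^esub> ?b)))"
      using j by (intro h.H.word_value_surface_relator_Suc[OF \<alpha>]) auto
    have "f (q \<otimes>\<^bsub>?Q\<^esub> (?w j \<otimes>\<^bsub>?Q\<^esub> ?a)) (Gen_b (Suc j)) = f (q \<otimes>\<^bsub>?Q\<^esub> ?w (Suc j)) (Gen_b (Suc j))"
    proof (cases "Suc j = i")
      case True
      have "q \<otimes>\<^bsub>?Q\<^esub> ?w (Suc j) \<otimes>\<^bsub>?Q\<^esub> \<alpha> (Gen_b i)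
          = q \<otimes>\<^bsub>?Q\<^esub> (?w j \<otimes>\<^bsub>?Q\<^esub> ?a) \<otimes>\<^bsub>?Q\<^esub> \<alpha> (Gen_b i) \<otimes>\<^bsub>?Q\<^esub> inv\<^bsub>?Q\<^esub> \<alpha> (Gen_a i)"
        unfolding w using c q True by (simp add: h.H.m_assoc)
      moreover have "q \<otimes>\<^bsub>?Q\<^esub> (?w j \<otimes>\<^bsub>?Q\<^esub> ?a) \<otimes>\<^bsub>?Q\<^esub> \<alpha> (Gen_b i) \<in> carrier ?Q"
        using c q ab by simp
      ultimately have "q \<otimes>\<^bsub>?Q\<^esub> ?w (Suc j) \<otimes>\<^bsub>?Q\<^esub> \<alpha> (Gen_b i) \<in> C
          \<longleftrightarrow> q \<otimes>\<^bsub>?Q\<^esub> (?w j \<otimes>\<^bsub>?Q\<^esub> ?a) \<otimes>\<^bsub>?Q\<^esub> \<alpha> (Gen_b i) \<in> C"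
        using C_iff by metis
      then show ?thesis by (simp add: f_def del: surface_relator_Suc)
    qed (simp add: f_def)
    then show "f (q \<otimes>\<^bsub>?Q\<^esub> ?w j) (Gen_a (Suc j)) + f (q \<otimes>\<^bsub>?Q\<^esub> (?w j \<otimes>\<^bsub>?Q\<^esub> ?a)) (Gen_b (Suc j))
      - f (q \<otimes>\<^bsub>?Q\<^esub> (?w j \<otimes>\<^bsub>?Q\<^esub> (?a \<otimes>\<^bsub>?Q\<^esub> (?b \<otimes>\<^bsub>?Q\<^esub> inv\<^bsub>?Q\<^esub> ?a)))) (Gen_a (Suc j))
      - f (q \<otimes>\<^bsub>?Q\<^esub> ?w (Suc j)) (Gen_b (Suc j)) = 0"
      by (simp add: f_def)
  qed
  then obtain \<Phi> where \<Phi>: "coset_cocycle G H \<Phi>"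
    and gen: "\<And>q x. q \<in> carrier ?Q \<Longrightarrow> x \<in> surface_gens g \<Longrightarrow> \<Phi> q (surface_gen_class g x) = f q x"
    using surface_cocycle[of H g f] H unfolding G_def \<alpha>_def by metis
  have b: "surface_gen_class g (Gen_b i) \<in> carrier G"
    using surface_gen_class_closed[of "Gen_b i" g] i by (simp add: G_def)
  have "\<Phi> q (surface_gen_class g (Gen_b i) [^]\<^bsub>G\<^esub> e) =
      (\<Sum>j<e. of_bool (q \<otimes>\<^bsub>?Q\<^esub> \<alpha> (Gen_b i) [^]\<^bsub>?Q\<^esub> Suc j \<in> C))"
    if q: "q \<in> carrier ?Q" for q and e :: nat
  proof (induction e)
    case 0
    have "\<Phi> q (\<one>\<^bsub>G\<^esub> \<otimes>\<^bsub>G\<^esub> \<one>\<^bsub>G\<^esub>) = \<Phi> q \<one>\<^bsub>G\<^esub> + \<Phi> (q \<otimes>\<^bsub>?Q\<^esub> (H #>\<^bsub>G\<^esub> \<one>\<^bsub>G\<^esub>)) \<one>\<^bsub>G\<^esub>"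
      using \<Phi> q unfolding cocycle_def by blast
    moreover have "q \<otimes>\<^bsub>?Q\<^esub> (H #>\<^bsub>G\<^esub> \<one>\<^bsub>G\<^esub>) = q"
      using q by (metis h.H.r_one h.hom_one)
    ultimately show ?case by simp
  next
    case (Suc e)
    let ?b = "surface_gen_class g (Gen_b i)"
    have pow: "H #>\<^bsub>G\<^esub> (?b [^]\<^bsub>G\<^esub> e) = \<alpha> (Gen_b i) [^]\<^bsub>?Q\<^esub> e"
      using h.hom_nat_pow[OF b] by (simp add: \<alpha>_def)
    have "\<Phi> q (?b [^]\<^bsub>G\<^esub> Suc e) = \<Phi> q (?b [^]\<^bsub>G\<^esub> e) + \<Phi> (q \<otimes>\<^bsub>?Q\<^esub> (H #>\<^bsub>G\<^esub> (?b [^]\<^bsub>G\<^esub> e))) ?b"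
      using \<Phi> q b unfolding cocycle_def by simp
    also have "\<Phi> (q \<otimes>\<^bsub>?Q\<^esub> (H #>\<^bsub>G\<^esub> (?b [^]\<^bsub>G\<^esub> e))) ?b = f (q \<otimes>\<^bsub>?Q\<^esub> \<alpha> (Gen_b i) [^]\<^bsub>?Q\<^esub> e) (Gen_b i)"
      unfolding pow using gen q ab i by simp
    also have "\<dots> = of_bool (q \<otimes>\<^bsub>?Q\<^esub> \<alpha> (Gen_b i) [^]\<^bsub>?Q\<^esub> Suc e \<in> C)"
      unfolding f_def using q ab by (simp add: h.H.m_assoc)
    finally show ?case using Suc.IH by simp
  qed
  then show thesis using that \<Phi> unfolding C_def by blast
qed

text \<open>The obstruction to lifting a cocycle from \<open>\<int>/n\<close> to \<open>\<int>\<close> is a face labelling of total sum zero,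
  hence vanishes.\<close>

lemma surface_character_lift:
  fixes n :: int and g :: nat
  defines "G \<equiv> surface_group g"
  assumes H: "H \<lhd> G" and fin: "finite (carrier (G Mod H))" and n: "n > 0"
    and \<chi>: "\<And>x y. x \<in> H \<Longrightarrow> y \<in> H \<Longrightarrow> [\<chi> (x \<otimes>\<^bsub>G\<^esub> y) = \<chi> x + \<chi> y] (mod n)"
  obtains \<Phi> where "coset_cocycle G H \<Phi>" "\<And>x. x \<in> H \<Longrightarrow> [\<Phi> H x = \<chi> x] (mod n)"
proof -
  let ?Q = "G Mod H"
  interpret normal H G by fact
  interpret h: group_hom G ?Q "\<lambda>x. H #>\<^bsub>G\<^esub> x" by (rule group_hom_Mod)
  let ?gen = "surface_gen_class g"
  define \<alpha> where "\<alpha> = (\<lambda>x. H #>\<^bsub>G\<^esub> ?gen x)"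
  have \<alpha>_comp: "(\<lambda>x. H #>\<^bsub>G\<^esub> x) \<circ> ?gen = \<alpha>" by (auto simp: \<alpha>_def)
  have gen: "?gen \<in> surface_gens g \<rightarrow> carrier G"
    unfolding G_def by (rule Pi_I) (rule surface_gen_class_closed)
  have \<alpha>: "\<alpha> \<in> surface_gens g \<rightarrow> carrier ?Q"
    using surface_gen_coset H unfolding G_def \<alpha>_def by blast
  define r where "r q = (SOME x. x \<in> carrier G \<and> H #>\<^bsub>G\<^esub> x = q)" for q
  have r: "r q \<in> carrier G \<and> H #>\<^bsub>G\<^esub> r q = q" if "q \<in> carrier ?Q" for q
  proof -
    have "\<exists>x. x \<in> carrier G \<and> H #>\<^bsub>G\<^esub> x = q" using that by (auto simp: carrier_FactGroup)
    then show ?thesis unfolding r_def by (rule someI_ex)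
  qed
  have qx: "q \<otimes>\<^bsub>?Q\<^esub> (H #>\<^bsub>G\<^esub> x) \<in> carrier ?Q" if "q \<in> carrier ?Q" "x \<in> carrier G" for q x
    using that h.hom_closed h.H.m_closed by blast
  \<comment> \<open>The cocycle induced from \<open>H\<close> by the Shapiro construction:
    \<open>r\<close> is a transversal, and the argument of \<chi> closes the path from
    \<open>q\<close> up to an element of \<open>H\<close>. As \<chi> is additive only modulo
    \<open>n\<close>, so is \<open>P\<close>.\<close>
  define P where "P q x = \<chi> (r q \<otimes>\<^bsub>G\<^esub> x \<otimes>\<^bsub>G\<^esub> inv\<^bsub>G\<^esub> r (q \<otimes>\<^bsub>?Q\<^esub> (H #>\<^bsub>G\<^esub> x)))" for q x
  have inH: "r q \<otimes>\<^bsub>G\<^esub> x \<otimes>\<^bsub>G\<^esub> inv\<^bsub>G\<^esub> r (q \<otimes>\<^bsub>?Q\<^esub> (H #>\<^bsub>G\<^esub> x)) \<in> H"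
    if q: "q \<in> carrier ?Q" and x: "x \<in> carrier G" for q x
  proof -
    have c: "r q \<otimes>\<^bsub>G\<^esub> x \<in> carrier G" "r (q \<otimes>\<^bsub>?Q\<^esub> (H #>\<^bsub>G\<^esub> x)) \<in> carrier G"
      using r[OF q] r[OF qx[OF q x]] x by auto
    have "H #>\<^bsub>G\<^esub> (r q \<otimes>\<^bsub>G\<^esub> x) = q \<otimes>\<^bsub>?Q\<^esub> (H #>\<^bsub>G\<^esub> x)"
      using r[OF q] h.hom_mult[of "r q" x] x by simp
    also have "\<dots> = H #>\<^bsub>G\<^esub> r (q \<otimes>\<^bsub>?Q\<^esub> (H #>\<^bsub>G\<^esub> x))" using r[OF qx[OF q x]] by simp
    finally have "H #>\<^bsub>G\<^esub> (r q \<otimes>\<^bsub>G\<^esub> x) = H #>\<^bsub>G\<^esub> r (q \<otimes>\<^bsub>?Q\<^esub> (H #>\<^bsub>G\<^esub> x))" .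
    then show ?thesis
      using c rcos_module[OF is_group c(2,1)] rcos_self[OF c(1)] is_subgroup by auto
  qed
  have P: "cocycle_mod n G ?Q (\<lambda>x. H #>\<^bsub>G\<^esub> x) P"
    unfolding cocycle_mod_def
  proof (intro ballI)
    fix q x y assume q: "q \<in> carrier ?Q" and x: "x \<in> carrier G" and y: "y \<in> carrier G"
    let ?q = "q \<otimes>\<^bsub>?Q\<^esub> (H #>\<^bsub>G\<^esub> x)"
    have q': "?q \<in> carrier ?Q" using qx q x by blast
    have q'': "?q \<otimes>\<^bsub>?Q\<^esub> (H #>\<^bsub>G\<^esub> y) = q \<otimes>\<^bsub>?Q\<^esub> (H #>\<^bsub>G\<^esub> (x \<otimes>\<^bsub>G\<^esub> y))"
      using h.hom_mult[OF x y] h.H.m_assoc[OF q h.hom_closed[OF x] h.hom_closed[OF y]] by simp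
    have "(r q \<otimes>\<^bsub>G\<^esub> x \<otimes>\<^bsub>G\<^esub> inv\<^bsub>G\<^esub> r ?q) \<otimes>\<^bsub>G\<^esub>
        (r ?q \<otimes>\<^bsub>G\<^esub> y \<otimes>\<^bsub>G\<^esub> inv\<^bsub>G\<^esub> r (?q \<otimes>\<^bsub>?Q\<^esub> (H #>\<^bsub>G\<^esub> y)))
      = r q \<otimes>\<^bsub>G\<^esub> (x \<otimes>\<^bsub>G\<^esub> y) \<otimes>\<^bsub>G\<^esub> inv\<^bsub>G\<^esub> r (?q \<otimes>\<^bsub>?Q\<^esub> (H #>\<^bsub>G\<^esub> y))"
      using r[OF q] r[OF q'] r[OF qx[OF q' y]] x y by (simp add: m_assoc)
    then show "[P q (x \<otimes>\<^bsub>G\<^esub> y) = P q x + P ?q y] (mod n)"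
      using \<chi>[OF inH[OF q x] inH[OF q' y]] unfolding P_def q'' by simp
  qed
  define f where "f q x = P q (?gen x)" for q x
  have ps: "[h.H.path_sum \<alpha> f' w q = P q (word_value ?gen w)] (mod n)"
    if "\<And>q x. q \<in> carrier ?Q \<Longrightarrow> x \<in> surface_gens g \<Longrightarrow> [f' q x = f q x] (mod n)"
      "w \<in> words (surface_gens g)" "q \<in> carrier ?Q" for f' w q
    using h.path_sum_cong_cocycle_mod[OF P gen, of f' w q] that unfolding \<alpha>_comp f_def by blast
  have rel: "surface_relator g \<in> words (surface_gens g)" by (rule surface_relator_in_words) simp
  have "word_value ?gen (surface_relator g) = \<one>\<^bsub>G\<^esub>"
    using word_class_conv_word_value[OF rel, of "{surface_relator g}"]
      word_class_eq_iff[OF rel, of "{surface_relator g}" "[]"]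
      word_equiv.relator[of "[]" "surface_gens g" "[]" "surface_relator g" "{surface_relator g}"] rel
    by (simp add: G_def surface_group_def one_presented_group)
  then have "[h.H.path_sum \<alpha> f (surface_relator g) q = 0] (mod n)" if "q \<in> carrier ?Q" for q
    using ps[of f, OF _ rel that] h.cocycle_mod_one[OF P that] by (auto intro: cong_trans)
  then have nk: "n * (h.H.path_sum \<alpha> f (surface_relator g) q div n) = h.H.path_sum \<alpha> f (surface_relator g) q"
    if "q \<in> carrier ?Q" for q using that by (simp add: cong_0_iff)
  \<comment> \<open>The defect of \<open>f\<close> around a face is a multiple of \<open>n\<close>;
    the sign of \<open>k\<close> is chosen so that adding \<open>n * e\<close> cancels it.\<close>
  define k where "k q = - (h.H.path_sum \<alpha> f (surface_relator g) q div n)" for q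
  have "n * (\<Sum>q\<in>carrier ?Q. k q) = - (\<Sum>q\<in>carrier ?Q. h.H.path_sum \<alpha> f (surface_relator g) q)"
    unfolding sum_distrib_left sum_negf[symmetric] using nk by (intro sum.cong) (auto simp: k_def)
  then have k0: "(\<Sum>q\<in>carrier ?Q. k q) = 0"
    using h.H.sum_path_sum_surface_relator[OF \<alpha> fin] n by simp
  have generated: "K = carrier ?Q" if K: "subgroup K ?Q" "\<alpha> ` surface_gens g \<subseteq> K" for K
  proof -
    have "subgroup {x \<in> carrier G. H #>\<^bsub>G\<^esub> x \<in> K} G"
      by (rule h.subgroup_preimage[OF K(1)])
    then have "{x \<in> carrier G. H #>\<^bsub>G\<^esub> x \<in> K} = carrier G"
      using K(2) gen unfolding G_def surface_group_def \<alpha>_def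
      by (intro presented_group_induct) auto
    then have "carrier ?Q \<subseteq> K" unfolding carrier_FactGroup by blast
    then show ?thesis using subgroup.subset[OF K(1)] by blast
  qed
  obtain e where e: "\<And>q. q \<in> carrier ?Q \<Longrightarrow> h.H.path_sum \<alpha> e (surface_relator g) q = k q"
    using h.H.path_sum_surface_relator_surj[OF \<alpha> generated fin k0] by auto
  define f' where "f' q x = f q x + n * e q x" for q x
  have "h.H.path_sum \<alpha> f' (surface_relator g) q = 0" if "q \<in> carrier ?Q" for q
    unfolding f'_def h.H.path_sum_add using e[OF that] nk[OF that] by (simp add: k_def)
  then obtain \<Phi> where \<Phi>: "coset_cocycle G H \<Phi>"
    "\<And>q w. q \<in> carrier ?Q \<Longrightarrow> w \<in> words (surface_gens g) \<Longrightarrow>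
      \<Phi> q (word_class (surface_gens g) {surface_relator g} w) = h.H.path_sum \<alpha> f' w q"
    using surface_cocycle[of H g f'] H unfolding G_def \<alpha>_def by metis
  have "[\<Phi> H x = \<chi> x] (mod n)" if x: "x \<in> H" for x
  proof -
    have H1: "H \<in> carrier ?Q" using h.H.one_closed by (simp add: one_FactGroup)
    obtain w where w: "w \<in> words (surface_gens g)" "x = word_class (surface_gens g) {surface_relator g} w"
      using x subset unfolding G_def surface_group_def carrier_presented_group by blast
    have xw: "word_value ?gen w = x"
      using w word_class_conv_word_value[OF w(1), of "{surface_relator g}"]
      by (simp add: G_def surface_group_def)
    have \<Phi>P: "[\<Phi> H x = P H x] (mod n)"
      using ps[of f' w H] w H1 \<Phi>(2) xw unfolding f'_def by (simp add: cong_iff_dvd_diff)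
    have "H \<otimes>\<^bsub>?Q\<^esub> (H #>\<^bsub>G\<^esub> x) = H"
      using x rcos_const[OF is_group x] h.H.r_one[OF H1] by (simp add: one_FactGroup)
    then have P_eq: "P H x = \<chi> (r H \<otimes>\<^bsub>G\<^esub> x \<otimes>\<^bsub>G\<^esub> inv\<^bsub>G\<^esub> r H)" by (simp add: P_def)
    \<comment> \<open>The representative of the trivial coset need not be the identity, but it lies
      in \<open>H\<close>, so conjugation by it does not change \<chi> modulo
      \<open>n\<close>.\<close>
    have rH: "r H \<in> H" using r[OF H1] rcos_self[of "r H" H] is_subgroup by auto
    have "[\<chi> (r H \<otimes>\<^bsub>G\<^esub> x \<otimes>\<^bsub>G\<^esub> inv\<^bsub>G\<^esub> r H) = \<chi> (r H) + \<chi> x + \<chi> (inv\<^bsub>G\<^esub> r H)] (mod n)"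
      using \<chi>[OF subgroup.m_closed[OF is_subgroup rH x] m_inv_closed[OF rH]] \<chi>[OF rH x]
      by (meson cong_add_rcancel cong_trans)
    moreover have "[\<chi> (r H) + \<chi> (inv\<^bsub>G\<^esub> r H) = 0] (mod n)"
    proof -
      have "[\<chi> \<one>\<^bsub>G\<^esub> = \<chi> \<one>\<^bsub>G\<^esub> + \<chi> \<one>\<^bsub>G\<^esub>] (mod n)" using \<chi>[of "\<one>\<^bsub>G\<^esub>" "\<one>\<^bsub>G\<^esub>"] by simp
      then have "[\<chi> \<one>\<^bsub>G\<^esub> = 0] (mod n)" by (simp add: cong_iff_dvd_diff)
      moreover have "r H \<otimes>\<^bsub>G\<^esub> inv\<^bsub>G\<^esub> r H = \<one>\<^bsub>G\<^esub>" using r[OF H1] by simp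
      ultimately show ?thesis using \<chi>[OF rH m_inv_closed[OF rH]] by (metis cong_sym cong_trans)
    qed
    then have "[\<chi> (r H) + \<chi> x + \<chi> (inv\<^bsub>G\<^esub> r H) = \<chi> x] (mod n)"
      by (simp add: cong_iff_dvd_diff algebra_simps)
    ultimately show ?thesis using \<Phi>P unfolding P_eq by (meson cong_trans)
  qed
  then show thesis using that \<Phi>(1) by blast
qed


section \<open>Characters of finite abelian groups\<close>

lemma (in group) subgroup_nat_pow_closed:
  "subgroup K G \<Longrightarrow> x \<in> K \<Longrightarrow> x [^] (n::nat) \<in> K"
  by (induction n) (auto simp: subgroup.one_closed subgroup.m_closed)

lemma (in group) cauchy:
  assumes "finite (carrier G)" "prime p" "p dvd order G"
  obtains x where "x \<in> carrier G" "x \<noteq> \<one>" "x [^] p = \<one>"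
proof -
  obtain m where "order G = p ^ 1 * m" using assms(3) by (auto elim: dvdE)
  then obtain K where K: "subgroup K G" "card K = p"
    using sylow_thm[of p G 1 m] assms is_group by auto
  have "K \<noteq> {\<one>}" using K(2) assms(2) by (auto simp: prime_nat_iff)
  moreover have "\<one> \<in> K" using K(1) by (rule subgroup.one_closed)
  ultimately obtain x where x: "x \<in> K" "x \<noteq> \<one>" by blast
  interpret K: group "G\<lparr>carrier := K\<rparr>" using K(1) is_group by (rule subgroup.subgroup_is_group)
  have "x [^]\<^bsub>G\<lparr>carrier := K\<rparr>\<^esub> order (G\<lparr>carrier := K\<rparr>) = \<one>\<^bsub>G\<lparr>carrier := K\<rparr>\<^esub>"
    using x by (intro K.pow_order_eq_1) auto
  then have "x [^] p = \<one>" using K(2) nat_pow_consistent[of x p K] by (simp add: order_def)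
  then show thesis using that x subgroup.mem_carrier[OF K(1)] by blast
qed

text \<open>Real representatives of a homomorphism to the reals modulo 1. Values there can be
  divided by any positive integer, which is what extending a character to a larger subgroup
  takes.\<close>

definition real_character :: "('a, 'b) monoid_scheme \<Rightarrow> 'a set \<Rightarrow> ('a \<Rightarrow> real) \<Rightarrow> bool" where
  "real_character G B \<chi> \<longleftrightarrow> (\<forall>x\<in>B. \<forall>y\<in>B. \<chi> (x \<otimes>\<^bsub>G\<^esub> y) - \<chi> x - \<chi> y \<in> \<int>)"

lemma (in group) real_character_one:
  assumes "subgroup B G" "real_character G B \<chi>"
  shows "\<chi> \<one> \<in> \<int>"
proof -
  have "\<chi> (\<one> \<otimes> \<one>) - \<chi> \<one> - \<chi> \<one> \<in> \<int>"
    using assms subgroup.one_closed unfolding real_character_def by blast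
  then show ?thesis by (simp add: minus_in_Ints_iff)
qed

lemma (in group) real_character_pow:
  assumes "subgroup B G" "real_character G B \<chi>" "x \<in> B"
  shows "\<chi> (x [^] (k::nat)) - real k * \<chi> x \<in> \<int>"
proof (induction k)
  case 0
  then show ?case using real_character_one assms by simp
next
  case (Suc k)
  have "x [^] k \<in> B" using assms(1,3) by (simp add: subgroup_nat_pow_closed)
  then have "\<chi> (x [^] k \<otimes> x) - \<chi> (x [^] k) - \<chi> x \<in> \<int>"
    using assms unfolding real_character_def by blast
  from Ints_add[OF this Suc.IH] show ?case by (simp add: algebra_simps)
qed

text \<open>If \<open>d\<close> is the order of \<open>c\<close> modulo \<open>B\<close>, the value
  at \<open>c\<close> must be a d-th part of the value at \<open>c^d\<close>, and any such part
  works. The parameter \<open>m\<close> selects it: 1 makes the trivial character nontrivial at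
  \<open>c\<close>, 0 is enough for a mere extension.\<close>

lemma (in comm_group) real_character_extend:
  assumes fin: "finite (carrier G)" and B: "subgroup B G" and \<chi>: "real_character G B \<chi>"
    and c: "c \<in> carrier G" "c \<notin> B"
  obtains B' \<chi>' d where "subgroup B' G" "B \<subseteq> B'" "c \<in> B'" "real_character G B' \<chi>'"
    "\<And>b. b \<in> B \<Longrightarrow> \<chi>' b - \<chi> b \<in> \<int>"
    "d > (1::nat)" "\<chi>' c - (\<chi> (c [^] d) + of_int m) / real d \<in> \<int>"
proof -
  interpret B: subgroup B G by fact
  have powB: "b [^] k \<in> B" if "b \<in> B" for b and k :: nat
    using that B by (simp add: subgroup_nat_pow_closed)
  define d where "d = (LEAST d::nat. 0 < d \<and> c [^] d \<in> B)"
  have "0 < order G \<and> c [^] order G \<in> B"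
    using fin c pow_order_eq_1 order_gt_0_iff_finite by auto
  then have d: "0 < d \<and> c [^] d \<in> B" unfolding d_def by (rule LeastI)
  then have d1: "d > 1" using c by (cases "d = 1") auto
  have d_dvd: "d dvd k" if "c [^] k \<in> B" for k :: nat
  proof -
    have "c [^] k = c [^] (k mod d) \<otimes> (c [^] d) [^] (k div d)"
      using c by (simp add: nat_pow_pow nat_pow_mult)
    then have "c [^] (k mod d) = c [^] k \<otimes> inv ((c [^] d) [^] (k div d))"
      using c by (simp add: m_assoc)
    also have "\<dots> \<in> B" using that d powB by simp
    finally have "\<not> 0 < k mod d"
      using not_less_Least[of "k mod d" "\<lambda>d. 0 < d \<and> c [^] d \<in> B"] d unfolding d_def[symmetric] by auto
    then show ?thesis by auto
  qed
  define t where "t = (\<chi> (c [^] d) + of_int m) / real d"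
  have wd_le: "(\<chi> b + real j * t) - (\<chi> b' + real j' * t) \<in> \<int>"
    if b: "b \<in> B" "b' \<in> B" and eq: "b \<otimes> c [^] j = b' \<otimes> c [^] j'" and le: "j' \<le> j" for b b' j j'
  proof -
    have "c [^] j = c [^] (j - j') \<otimes> c [^] j'" using c le by (simp add: nat_pow_mult)
    then have "(b \<otimes> c [^] (j - j')) \<otimes> c [^] j' = b' \<otimes> c [^] j'"
      using eq b c by (simp add: m_assoc)
    then have b': "b' = b \<otimes> c [^] (j - j')" using b c by simp
    then have "c [^] (j - j') = inv b \<otimes> b'" using b c by simp
    then have "d dvd j - j'" using b by (intro d_dvd) simp
    then obtain s where s: "j - j' = d * s" by blast
    then have "b' = b \<otimes> (c [^] d) [^] s" using b' c by (simp add: nat_pow_pow)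
    then have "\<chi> b' - \<chi> b - \<chi> ((c [^] d) [^] s) \<in> \<int>"
      using \<chi> b d powB unfolding real_character_def by blast
    moreover have "\<chi> ((c [^] d) [^] s) - real s * \<chi> (c [^] d) \<in> \<int>"
      using real_character_pow[OF B \<chi>] d by blast
    moreover have "(\<chi> b + real j * t) - (\<chi> b' + real j' * t)
      = of_int (int s * m) - (\<chi> b' - \<chi> b - \<chi> ((c [^] d) [^] s)) - (\<chi> ((c [^] d) [^] s) - real s * \<chi> (c [^] d))"
    proof -
      have "real j = real j' + real d * real s" using s le by (metis of_nat_add of_nat_mult le_add_diff_inverse)
      moreover have "real d * t = \<chi> (c [^] d) + of_int m" using d by (simp add: t_def)
      ultimately have "real j * t = real j' * t + real s * (\<chi> (c [^] d) + of_int m)"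
        by (simp add: algebra_simps) (metis distrib_left mult.commute mult.left_commute)
      then show ?thesis by (simp add: algebra_simps)
    qed
    ultimately show ?thesis by (metis Ints_diff Ints_of_int)
  qed
  have wd: "(\<chi> b + real j * t) - (\<chi> b' + real j' * t) \<in> \<int>"
    if "b \<in> B" "b' \<in> B" "b \<otimes> c [^] j = b' \<otimes> c [^] j'" for b b' j j'
  proof (cases "j' \<le> j")
    case False
    then have "(\<chi> b' + real j' * t) - (\<chi> b + real j * t) \<in> \<int>"
      using wd_le[of b' b j' j] that by simp
    then show ?thesis by (metis Ints_minus minus_diff_eq)
  qed (use wd_le that in blast)
  \<comment> \<open>Natural exponents suffice because \<open>c\<close> has finite order.\<close>
  define B' where "B' = {b \<otimes> c [^] j | b j. b \<in> B \<and> j \<in> (UNIV :: nat set)}"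
  \<comment> \<open>The decomposition of \<open>x\<close> is not unique, but by \<open>wd\<close>
    its choice affects the value only by an integer.\<close>
  define \<chi>' where "\<chi>' x = (SOME v. \<exists>b j. b \<in> B \<and> x = b \<otimes> c [^] (j::nat) \<and> v = \<chi> b + real j * t)" for x
  have \<chi>': "\<chi>' (b \<otimes> c [^] j) - (\<chi> b + real j * t) \<in> \<int>" if "b \<in> B" for b and j :: nat
  proof -
    have "\<exists>b' j'. b' \<in> B \<and> b \<otimes> c [^] j = b' \<otimes> c [^] (j'::nat) \<and> \<chi>' (b \<otimes> c [^] j) = \<chi> b' + real j' * t"
      unfolding \<chi>'_def by (rule someI_ex) (use that in blast)
    then show ?thesis using wd that by metis
  qed
  have "subgroup B' G"
  proof (rule subgroupI)
    show "B' \<noteq> {}" using B.one_closed unfolding B'_def by blast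
    show "B' \<subseteq> carrier G" using c by (auto simp: B'_def)
    show "inv x \<in> B'" if x: "x \<in> B'" for x
    proof -
      obtain b j where bj: "b \<in> B" "x = b \<otimes> c [^] (j::nat)" using x by (auto simp: B'_def)
      have "j \<le> order G * j" using fin order_gt_0_iff_finite by simp
      then have "c [^] j \<otimes> c [^] (order G * j - j) = \<one>"
        using c by (simp add: nat_pow_mult pow_order_eq_1 flip: nat_pow_pow)
      then have "c [^] (order G * j - j) = inv (c [^] j)"
        using c by (metis inv_equality m_comm nat_pow_closed)
      then have "inv x = inv b \<otimes> c [^] (order G * j - j)"
        using bj c by (simp add: inv_mult)
      then show ?thesis using bj by (auto simp: B'_def)
    qed
    show "x \<otimes> y \<in> B'" if xy: "x \<in> B'" "y \<in> B'" for x y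
    proof -
      obtain b j b' j' where bj: "b \<in> B" "x = b \<otimes> c [^] (j::nat)" "b' \<in> B" "y = b' \<otimes> c [^] (j'::nat)"
        using xy by (auto simp: B'_def)
      then have "x \<otimes> y = (b \<otimes> b') \<otimes> c [^] (j + j')"
        using c by (simp add: m_ac flip: nat_pow_mult)
      then show ?thesis using bj by (auto simp: B'_def)
    qed
  qed
  moreover have "B \<subseteq> B'"
  proof
    fix b assume "b \<in> B"
    then have "b = b \<otimes> c [^] (0::nat)" by simp
    then show "b \<in> B'" using \<open>b \<in> B\<close> unfolding B'_def by blast
  qed
  moreover have "c \<in> B'"
  proof -
    have "c = \<one> \<otimes> c [^] (1::nat)" using c by simp
    then show ?thesis unfolding B'_def using B.one_closed by blast
  qed
  moreover have "real_character G B' \<chi>'"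
    unfolding real_character_def
  proof (intro ballI)
    fix x y assume "x \<in> B'" "y \<in> B'"
    then obtain b j b' j' where bj: "b \<in> B" "x = b \<otimes> c [^] (j::nat)" "b' \<in> B" "y = b' \<otimes> c [^] (j'::nat)"
      by (auto simp: B'_def)
    then have xy: "x \<otimes> y = (b \<otimes> b') \<otimes> c [^] (j + j')"
      using c by (simp add: m_ac flip: nat_pow_mult)
    have "\<chi> (b \<otimes> b') - \<chi> b - \<chi> b' \<in> \<int>" using \<chi> bj unfolding real_character_def by blast
    moreover have "\<chi>' (x \<otimes> y) - (\<chi> (b \<otimes> b') + real (j + j') * t) \<in> \<int>"
      unfolding xy using bj by (intro \<chi>') simp
    moreover have "\<chi>' x - (\<chi> b + real j * t) \<in> \<int>" "\<chi>' y - (\<chi> b' + real j' * t) \<in> \<int>"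
      using bj \<chi>' by auto
    moreover have "\<chi>' (x \<otimes> y) - \<chi>' x - \<chi>' y
      = (\<chi> (b \<otimes> b') - \<chi> b - \<chi> b') + (\<chi>' (x \<otimes> y) - (\<chi> (b \<otimes> b') + real (j + j') * t))
        - (\<chi>' x - (\<chi> b + real j * t)) - (\<chi>' y - (\<chi> b' + real j' * t))"
      by (simp add: algebra_simps)
    ultimately show "\<chi>' (x \<otimes> y) - \<chi>' x - \<chi>' y \<in> \<int>" by (metis Ints_add Ints_diff)
  qed
  moreover have "\<chi>' b - \<chi> b \<in> \<int>" if "b \<in> B" for b
    using \<chi>'[OF that, of 0] that by simp
  moreover have "\<chi>' c - (\<chi> (c [^] d) + of_int m) / real d \<in> \<int>"
  proof -
    have "\<chi>' c - (\<chi> \<one> + t) \<in> \<int>" using \<chi>'[of \<one> 1] c by simp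
    from Ints_add[OF this real_character_one[OF B \<chi>]] show ?thesis by (simp add: t_def)
  qed
  ultimately show thesis using that d d1 by blast
qed

text \<open>The extension with \<open>m = 1\<close> from the trivial subgroup gives \<open>a\<close>
  the value 1/d up to an integer, with \<open>d > 1\<close>. A subgroup of maximal size carrying a
  character that is nontrivial at \<open>a\<close> must be the whole group.\<close>

lemma (in comm_group) real_character_separating:
  assumes fin: "finite (carrier G)" and a: "a \<in> carrier G" "a \<noteq> \<one>"
  obtains \<chi> where "real_character G (carrier G) \<chi>" "\<chi> a \<notin> \<int>"
proof -
  define good where "good B \<longleftrightarrow> subgroup B G \<and> a \<in> B \<and> (\<exists>\<chi>. real_character G B \<chi> \<and> \<chi> a \<notin> \<int>)" for B
  have ints: "v \<in> \<int> \<longleftrightarrow> w \<in> \<int>" if "v - w \<in> \<int>" for v w :: real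
    using that by (metis Ints_add Ints_diff diff_add_cancel diff_diff_eq2 add_diff_cancel_left')
  have "\<exists>B. good B"
  proof -
    have "subgroup {\<one>} G" by (rule triv_subgroup)
    moreover have "real_character G {\<one>} (\<lambda>_. 0)" by (simp add: real_character_def)
    ultimately obtain B \<chi> and d :: nat where B: "subgroup B G" "a \<in> B" "real_character G B \<chi>"
      "d > 1" "\<chi> a - (0 + of_int 1) / real d \<in> \<int>"
      using real_character_extend[OF fin, of "{\<one>}" "\<lambda>_. 0" a 1] a by simp metis
    have "1 / real d \<notin> \<int>"
    proof
      assume "1 / real d \<in> \<int>"
      then obtain k :: int where "1 / real d = of_int k" by (auto elim: Ints_cases)
      moreover have "0 < 1 / real d" "1 / real d < 1" using B(4) by auto
      ultimately show False by simp
    qed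
    then have "\<chi> a \<notin> \<int>" using ints[OF B(5)] by simp
    then show ?thesis using B unfolding good_def by blast
  qed
  moreover have "card B < Suc (card (carrier G))" if "good B" for B
    using that fin by (auto simp: good_def less_Suc_eq_le intro!: card_mono dest: subgroup.subset)
  ultimately obtain B where B: "good B" "\<And>B'. good B' \<Longrightarrow> card B' \<le> card B"
    using ex_has_greatest_nat[of good _ card "Suc (card (carrier G))"] by blast
  then obtain \<chi> where \<chi>: "subgroup B G" "a \<in> B" "real_character G B \<chi>" "\<chi> a \<notin> \<int>"
    unfolding good_def by blast
  have "B = carrier G"
  proof (rule ccontr)
    assume "B \<noteq> carrier G"
    then obtain c where c: "c \<in> carrier G" "c \<notin> B" using subgroup.subset[OF \<chi>(1)] by blast
    obtain B' \<chi>' where B': "subgroup B' G" "B \<subseteq> B'" "c \<in> B'" "real_character G B' \<chi>'"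
      "\<And>b. b \<in> B \<Longrightarrow> \<chi>' b - \<chi> b \<in> \<int>"
      using real_character_extend[OF fin \<chi>(1,3) c, of 0] by metis
    have "good B'"
      using B' \<chi>(2,4) ints[OF B'(5)[OF \<chi>(2)]] unfolding good_def by blast
    moreover have "card B < card B'"
      using B' c fin by (intro psubset_card_mono) (auto dest: subgroup.subset intro: finite_subset)
    ultimately show False using B(2) by fastforce
  qed
  then show thesis using that \<chi> by blast
qed

text \<open>The group order annihilates every element, so multiplying a real character by it yields
  integers; the floor is exact and serves only to change the type.\<close>

lemma (in comm_group) character_separating:
  assumes fin: "finite (carrier G)" and a: "a \<in> carrier G" "a \<noteq> \<one>"
  obtains \<chi> :: "'a \<Rightarrow> int"
  where "\<And>x y. x \<in> carrier G \<Longrightarrow> y \<in> carrier G \<Longrightarrow> [\<chi> (x \<otimes> y) = \<chi> x + \<chi> y] (mod int (order G))"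
    "\<not> int (order G) dvd \<chi> a"
proof -
  obtain \<psi> where \<psi>: "real_character G (carrier G) \<psi>" "\<psi> a \<notin> \<int>"
    using real_character_separating[OF assms] .
  have e: "order G > 0" using fin order_gt_0_iff_finite by blast
  define \<chi> where "\<chi> x = \<lfloor>real (order G) * \<psi> x\<rfloor>" for x
  have \<chi>: "of_int (\<chi> x) = real (order G) * \<psi> x" if "x \<in> carrier G" for x
  proof -
    have "\<psi> (x [^] order G) - real (order G) * \<psi> x \<in> \<int>" "\<psi> \<one> \<in> \<int>"
      using real_character_pow[OF subgroup_self \<psi>(1) that] real_character_one[OF subgroup_self \<psi>(1)]
      by auto
    then have "\<psi> \<one> - (\<psi> \<one> - real (order G) * \<psi> x) \<in> \<int>"
      using that by (metis Ints_diff pow_order_eq_1)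
    then show ?thesis by (simp add: \<chi>_def)
  qed
  have "[\<chi> (x \<otimes> y) = \<chi> x + \<chi> y] (mod int (order G))" if xy: "x \<in> carrier G" "y \<in> carrier G" for x y
  proof -
    obtain k :: int where k: "\<psi> (x \<otimes> y) - \<psi> x - \<psi> y = of_int k"
      using \<psi>(1) xy unfolding real_character_def by (meson Ints_cases)
    have "real_of_int (\<chi> (x \<otimes> y) - (\<chi> x + \<chi> y)) = real (order G) * (\<psi> (x \<otimes> y) - \<psi> x - \<psi> y)"
      using xy by (simp add: \<chi> algebra_simps)
    also have "\<dots> = real_of_int (int (order G) * k)" using k by simp
    finally have "\<chi> (x \<otimes> y) - (\<chi> x + \<chi> y) = int (order G) * k" by (simp only: of_int_eq_iff)
    then show ?thesis by (simp add: cong_iff_dvd_diff)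
  qed
  moreover have "\<not> int (order G) dvd \<chi> a"
  proof
    assume "int (order G) dvd \<chi> a"
    then obtain k where "\<chi> a = int (order G) * k" by blast
    then have "real (order G) * \<psi> a = real (order G) * of_int k"
      using \<chi>[OF a(1)] by (metis of_int_mult of_int_of_nat_eq)
    then show False using \<psi>(2) e by auto
  qed
  ultimately show thesis using that by blast
qed


section \<open>Quotients of finite \<open>\<Sigma>\<close>-order\<close>

text \<open>Positivity excludes 0, which would otherwise qualify when \<Sigma> contains all
  primes.\<close>

definition sigma_number :: "nat set \<Rightarrow> nat \<Rightarrow> bool" where
  "sigma_number \<Sigma> n \<longleftrightarrow> n > 0 \<and> (\<forall>p. prime p \<and> p dvd n \<longrightarrow> p \<in> \<Sigma>)"

lemma sigma_number_mult: "sigma_number \<Sigma> m \<Longrightarrow> sigma_number \<Sigma> n \<Longrightarrow> sigma_number \<Sigma> (m * n)"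
  by (auto simp: sigma_number_def prime_dvd_mult_iff)

lemma sigma_number_dvd: "sigma_number \<Sigma> n \<Longrightarrow> m dvd n \<Longrightarrow> sigma_number \<Sigma> m"
  unfolding sigma_number_def by (meson dvd_pos_nat dvd_trans)

lemma sigma_number_prime_power: "prime p \<Longrightarrow> p \<in> \<Sigma> \<Longrightarrow> sigma_number \<Sigma> (p ^ k)"
  unfolding sigma_number_def by (metis prime_dvd_power primes_dvd_imp_eq prime_gt_0_nat zero_less_power)

lemma (in normal) rcos_eq_iff:
  assumes "x \<in> carrier G" "y \<in> carrier G"
  shows "H #> x = H #> y \<longleftrightarrow> x \<otimes> inv y \<in> H"
  using rcos_module[OF is_group assms(2,1)] rcos_self[OF assms(1) is_subgroup]
    repr_independence[OF _ assms(2) is_subgroup] by metis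

lemma (in normal) rcos_eq_self_iff:
  assumes "x \<in> carrier G" shows "H #> x = H \<longleftrightarrow> x \<in> H"
  using rcos_eq_iff[OF assms one_closed] assms subset by simp

text \<open>By Cauchy, every prime dividing the order of the quotient divides each exponent of it.
  Unlike the order, an exponent is easily produced for intersections, larger subgroups and kernels
  of cocycles.\<close>

lemma (in normal) pro_normal_subgroups_iff:
  "H \<in> pro_normal_subgroups \<Sigma> G \<longleftrightarrow> finite (carrier (G Mod H)) \<and>
    (\<exists>n. sigma_number \<Sigma> n \<and> (\<forall>x\<in>carrier G. x [^] n \<in> H))"
proof -
  interpret Q: group "G Mod H" by (rule factorgroup_is_group)
  have pow: "(H #> x) [^]\<^bsub>G Mod H\<^esub> n = \<one>\<^bsub>G Mod H\<^esub> \<longleftrightarrow> x [^] n \<in> H" if "x \<in> carrier G" for x and n :: nat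
    using that by (simp add: FactGroup_pow one_FactGroup rcos_eq_self_iff)
  show ?thesis
  proof
    assume H: "H \<in> pro_normal_subgroups \<Sigma> G"
    then have fin: "finite (carrier (G Mod H))" by (simp add: pro_normal_subgroups_def)
    moreover have "sigma_number \<Sigma> (order (G Mod H))"
      using H Q.order_gt_0_iff_finite by (simp add: pro_normal_subgroups_def sigma_number_def)
    moreover have "x [^] order (G Mod H) \<in> H" if "x \<in> carrier G" for x
      using that pow Q.pow_order_eq_1 by (auto simp: carrier_FactGroup)
    ultimately show "finite (carrier (G Mod H)) \<and>
        (\<exists>n. sigma_number \<Sigma> n \<and> (\<forall>x\<in>carrier G. x [^] n \<in> H))" by blast
  next
    assume "finite (carrier (G Mod H)) \<and>
        (\<exists>n. sigma_number \<Sigma> n \<and> (\<forall>x\<in>carrier G. x [^] n \<in> H))"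
    then obtain n where fin: "finite (carrier (G Mod H))" and n: "sigma_number \<Sigma> n"
      "\<And>x. x \<in> carrier G \<Longrightarrow> x [^] n \<in> H" by blast
    have "p \<in> \<Sigma>" if p: "prime p" "p dvd order (G Mod H)" for p
    proof -
      obtain q where q: "q \<in> carrier (G Mod H)" "q \<noteq> \<one>\<^bsub>G Mod H\<^esub>" "q [^]\<^bsub>G Mod H\<^esub> p = \<one>\<^bsub>G Mod H\<^esub>"
        using Q.cauchy[OF fin p] .
      have "q [^]\<^bsub>G Mod H\<^esub> n = \<one>\<^bsub>G Mod H\<^esub>"
        using q(1) pow n(2) by (auto simp: carrier_FactGroup)
      then have "Q.ord q dvd n" "Q.ord q dvd p" using q Q.pow_eq_id by blast+
      moreover have "Q.ord q \<noteq> 1" using q Q.ord_eq_1 by blast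
      ultimately have "p dvd n" using p by (metis prime_nat_iff)
      then show ?thesis using n(1) p by (simp add: sigma_number_def)
    qed
    then show "H \<in> pro_normal_subgroups \<Sigma> G"
      using fin normal_axioms by (simp add: pro_normal_subgroups_def)
  qed
qed

lemma pro_normal_subgroupsD:
  assumes "N \<in> pro_normal_subgroups \<Sigma> G"
  shows "N \<lhd> G" "finite (carrier (G Mod N))" "sigma_number \<Sigma> (order (G Mod N))"
proof -
  show 1: "N \<lhd> G" and 2: "finite (carrier (G Mod N))"
    using assms by (auto simp: pro_normal_subgroups_def)
  interpret Q: group "G Mod N" using 1 by (rule normal.factorgroup_is_group)
  show "sigma_number \<Sigma> (order (G Mod N))"
    using assms 2 Q.order_gt_0_iff_finite by (simp add: pro_normal_subgroups_def sigma_number_def)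
qed

lemma (in normal) pow_order_Mod:
  assumes "x \<in> carrier G" shows "x [^] order (G Mod H) \<in> H"
proof -
  interpret Q: group "G Mod H" by (rule factorgroup_is_group)
  have "(H #> x) [^]\<^bsub>G Mod H\<^esub> order (G Mod H) = \<one>\<^bsub>G Mod H\<^esub>"
    using assms by (intro Q.pow_order_eq_1) (auto simp: carrier_FactGroup)
  then show ?thesis using assms by (simp add: FactGroup_pow one_FactGroup rcos_eq_self_iff)
qed

text \<open>A function with finitely many values certifies finite index as soon as equal values
  imply equal cosets; it need not be a homomorphism.\<close>

lemma (in normal) finite_Mod:
  assumes "finite B" "\<And>x. x \<in> carrier G \<Longrightarrow> \<phi> x \<in> B"
    "\<And>x y. x \<in> carrier G \<Longrightarrow> y \<in> carrier G \<Longrightarrow> \<phi> x = \<phi> y \<Longrightarrow> x \<otimes> inv y \<in> H"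
  shows "finite (carrier (G Mod H))"
proof (rule finite_subset)
  show "carrier (G Mod H) \<subseteq> (\<lambda>b. H #> (SOME x. x \<in> carrier G \<and> \<phi> x = b)) ` B"
  proof
    fix q assume "q \<in> carrier (G Mod H)"
    then obtain x where x: "x \<in> carrier G" "q = H #> x" by (auto simp: carrier_FactGroup)
    define y where "y = (SOME y. y \<in> carrier G \<and> \<phi> y = \<phi> x)"
    have "y \<in> carrier G \<and> \<phi> y = \<phi> x" unfolding y_def by (rule someI[of _ x]) (use x in simp)
    then have "q = H #> y" using x rcos_eq_iff assms(3)[of x y] by simp
    then show "q \<in> (\<lambda>b. H #> (SOME x. x \<in> carrier G \<and> \<phi> x = b)) ` B"
      using assms(2) x unfolding y_def by blast
  qed
qed (use assms in simp)

lemma (in group) pro_normal_subgroups_carrier: "carrier G \<in> pro_normal_subgroups \<Sigma> G"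
proof -
  interpret normal "carrier G" G by (rule normalI) (auto simp: subgroup_self coset_join2 coset_join3)
  have "finite (carrier (G Mod carrier G))" by (rule finite_Mod[of "{()}"]) auto
  moreover have "sigma_number \<Sigma> 1" by (simp add: sigma_number_def)
  ultimately show ?thesis unfolding pro_normal_subgroups_iff by (auto intro!: exI[of _ 1])
qed

lemma (in group) pro_normal_subgroups_Int:
  assumes M: "M \<in> pro_normal_subgroups \<Sigma> G" and N: "N \<in> pro_normal_subgroups \<Sigma> G"
  shows "M \<inter> N \<in> pro_normal_subgroups \<Sigma> G"
proof -
  interpret M: normal M G using M by (rule pro_normal_subgroupsD)
  interpret N: normal N G using N by (rule pro_normal_subgroupsD)
  interpret MN: normal "M \<inter> N" G
    using M.normal_axioms N.normal_axioms by (rule normal_subgroup_intersect)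
  have "finite (carrier (G Mod (M \<inter> N)))"
  proof (rule MN.finite_Mod)
    show "finite (carrier (G Mod M) \<times> carrier (G Mod N))"
      using pro_normal_subgroupsD(2)[OF M] pro_normal_subgroupsD(2)[OF N] by simp
    show "(M #> x, N #> x) \<in> carrier (G Mod M) \<times> carrier (G Mod N)" if "x \<in> carrier G" for x
      using that by (auto simp: carrier_FactGroup)
  qed (auto simp: M.rcos_eq_iff N.rcos_eq_iff)
  moreover obtain m n where "sigma_number \<Sigma> m" "sigma_number \<Sigma> n"
    "\<And>x. x \<in> carrier G \<Longrightarrow> x [^] m \<in> M" "\<And>x. x \<in> carrier G \<Longrightarrow> x [^] n \<in> N"
    using M N M.pro_normal_subgroups_iff N.pro_normal_subgroups_iff by blast
  then have "sigma_number \<Sigma> (m * n)" "x [^] (m * n) \<in> M \<inter> N" if "x \<in> carrier G" for x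
  proof -
    have "(x [^] m) [^] n \<in> M" "(x [^] n) [^] m \<in> N"
      using \<open>\<And>x. x \<in> carrier G \<Longrightarrow> x [^] m \<in> M\<close> \<open>\<And>x. x \<in> carrier G \<Longrightarrow> x [^] n \<in> N\<close> that
        subgroup_nat_pow_closed M.is_subgroup N.is_subgroup by blast+
    then show "x [^] (m * n) \<in> M \<inter> N" using that by (simp add: nat_pow_pow mult.commute)
  qed (rule sigma_number_mult)
  ultimately show ?thesis unfolding MN.pro_normal_subgroups_iff using one_closed by blast
qed

lemma (in group) pro_normal_subgroups_superset:
  assumes N: "N \<in> pro_normal_subgroups \<Sigma> G" and "N \<subseteq> M" "M \<lhd> G"
  shows "M \<in> pro_normal_subgroups \<Sigma> G"
proof -
  interpret N: normal N G using N by (rule pro_normal_subgroupsD)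
  interpret M: normal M G by fact
  have "finite (carrier (G Mod M))"
  proof (rule M.finite_Mod)
    show "finite (carrier (G Mod N))" using N by (rule pro_normal_subgroupsD)
    show "N #> x \<in> carrier (G Mod N)" if "x \<in> carrier G" for x
      using that by (auto simp: carrier_FactGroup)
  qed (use assms(2) in \<open>auto simp: N.rcos_eq_iff\<close>)
  then show ?thesis
    using N assms(2) unfolding M.pro_normal_subgroups_iff N.pro_normal_subgroups_iff by blast
qed

section \<open>Kernels of the solvable finite quotients\<close>

definition solvable_subgroups :: "nat set \<Rightarrow> ('a, 'b) monoid_scheme \<Rightarrow> nat \<Rightarrow> 'a set set" where
  "solvable_subgroups \<Sigma> G m =
    {N \<in> pro_normal_subgroups \<Sigma> G. (derived G ^^ m) (carrier G) \<subseteq> N}"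

lemma (in group) exp_of_derived_normal: "(derived G ^^ m) (carrier G) \<lhd> G"
proof (induction m)
  case 0
  show ?case by (simp add: normalI subgroup_self coset_join2 coset_join3)
qed (simp add: derived_is_normal)

lemma (in group) exp_of_derived_antimono:
  assumes "k \<le> m" shows "(derived G ^^ m) (carrier G) \<subseteq> (derived G ^^ k) (carrier G)"
  using assms
proof (induction rule: dec_induct)
  case (step m)
  have "derived G ((derived G ^^ m) (carrier G)) \<subseteq> (derived G ^^ m) (carrier G)"
    using derived_incl exp_of_derived_is_subgroup[OF subgroup_self] by blast
  with step show ?case by simp
qed simp

lemma (in group) solvable_subgroups_mono:
  "k \<le> m \<Longrightarrow> solvable_subgroups \<Sigma> G k \<subseteq> solvable_subgroups \<Sigma> G m"
  using exp_of_derived_antimono[of k m] by (auto simp: solvable_subgroups_def)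

lemma (in group) solvable_subgroups_Int:
  "M \<in> solvable_subgroups \<Sigma> G m \<Longrightarrow> N \<in> solvable_subgroups \<Sigma> G m \<Longrightarrow> M \<inter> N \<in> solvable_subgroups \<Sigma> G m"
  by (simp add: solvable_subgroups_def pro_normal_subgroups_Int)

lemma (in group) solvable_subgroups_0: "carrier G \<in> solvable_subgroups \<Sigma> G 0"
  by (simp add: solvable_subgroups_def pro_normal_subgroups_carrier)

text \<open>\<open>N <#> D\<close> is the kernel of the largest quotient of \<open>G Mod N\<close>
  that is solvable of length at most \<open>m\<close>. It allows conditions at an arbitrary
  \<open>N\<close> to be tested at a solvable level.\<close>

lemma (in group) set_mult_exp_of_derived:
  fixes m :: nat
  defines "D \<equiv> (derived G ^^ m) (carrier G)"
  assumes N: "N \<in> pro_normal_subgroups \<Sigma> G"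
  shows "N <#> D \<in> solvable_subgroups \<Sigma> G m" "N \<subseteq> N <#> D"
proof -
  interpret N: normal N G using N by (rule pro_normal_subgroupsD)
  interpret D: normal D G unfolding D_def by (rule exp_of_derived_normal)
  have "N <#> D \<lhd> G"
    using N.normal_axioms D.normal_axioms by (rule normal_subgroup_set_mult_closed)
  moreover have "y \<in> N <#> D" if "y \<in> N" for y
  proof -
    have "y = y \<otimes> \<one>" using that by simp
    then show ?thesis using that D.one_closed unfolding set_mult_def by blast
  qed
  then show "N \<subseteq> N <#> D" by blast
  moreover have "y \<in> N <#> D" if "y \<in> D" for y
  proof -
    have "y = \<one> \<otimes> y" using that by simp
    then show ?thesis using that N.one_closed unfolding set_mult_def by blast
  qed
  ultimately show "N <#> D \<in> solvable_subgroups \<Sigma> G m"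
    using pro_normal_subgroups_superset[OF N] by (auto simp: solvable_subgroups_def D_def)
qed

section \<open>Kernels of cocycles\<close>

context normal
begin

lemma cocycle_add:
  assumes "coset_cocycle G H \<Phi>" "q \<in> carrier (G Mod H)" "x \<in> carrier G" "y \<in> carrier G"
  shows "\<Phi> q (x \<otimes> y) = \<Phi> q x + \<Phi> (q \<otimes>\<^bsub>G Mod H\<^esub> (H #> x)) y"
  using assms unfolding cocycle_def by blast

lemma cocycle_one:
  assumes "coset_cocycle G H \<Phi>" "q \<in> carrier (G Mod H)"
  shows "\<Phi> q \<one> = 0"
proof -
  interpret h: group_hom G "G Mod H" "\<lambda>x. H #> x" by (rule group_hom_Mod)
  show ?thesis using cocycle_add[OF assms, of \<one> \<one>] assms h.hom_one by simp
qed

lemma cocycle_inv: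
  assumes "coset_cocycle G H \<Phi>" "q \<in> carrier (G Mod H)" "x \<in> carrier G"
  shows "\<Phi> (q \<otimes>\<^bsub>G Mod H\<^esub> (H #> x)) (inv x) = - \<Phi> q x"
  using cocycle_add[OF assms inv_closed[OF assms(3)]] cocycle_one[OF assms(1,2)] assms by simp

lemma coset_mult_closed:
  "q \<in> carrier (G Mod H) \<Longrightarrow> x \<in> carrier G \<Longrightarrow> q \<otimes>\<^bsub>G Mod H\<^esub> (H #> x) \<in> carrier (G Mod H)"
  using group_hom.hom_closed[OF group_hom_Mod] monoid.m_closed[OF group.is_monoid[OF factorgroup_is_group]]
  by blast

lemma coset_mult_subgroup:
  assumes "q \<in> carrier (G Mod H)" "x \<in> H"
  shows "q \<otimes>\<^bsub>G Mod H\<^esub> (H #> x) = q"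
  using assms rcos_eq_self_iff[of x] subset monoid.r_one[OF group.is_monoid[OF factorgroup_is_group]]
  by (auto simp: one_FactGroup)

lemma cocycle_add_subgroup:
  assumes "coset_cocycle G H \<Phi>" "q \<in> carrier (G Mod H)" "x \<in> H" "y \<in> carrier G"
  shows "\<Phi> q (x \<otimes> y) = \<Phi> q x + \<Phi> q y"
  using cocycle_add[OF assms(1,2) _ assms(4), of x] assms coset_mult_subgroup by auto

lemma cocycle_inv_subgroup:
  assumes "coset_cocycle G H \<Phi>" "q \<in> carrier (G Mod H)" "x \<in> H"
  shows "\<Phi> q (inv x) = - \<Phi> q x"
  using cocycle_inv[OF assms(1,2), of x] assms coset_mult_subgroup by auto

lemma cocycle_pow_subgroup:
  assumes \<Phi>: "coset_cocycle G H \<Phi>" and q: "q \<in> carrier (G Mod H)" and x: "x \<in> H"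
  shows "\<Phi> q (x [^] (k::nat)) = int k * \<Phi> q x"
proof (induction k)
  case (Suc k)
  have "x [^] k \<in> H" using x is_subgroup by (simp add: subgroup_nat_pow_closed)
  then show ?case
    using cocycle_add_subgroup[OF \<Phi> q, of "x [^] k" x] x Suc by (auto simp: algebra_simps)
qed (use cocycle_one[OF \<Phi> q] in simp)

text \<open>The way out along \<open>x\<close> and the way back cancel, so conjugation only moves
  the base point.\<close>

lemma cocycle_conjugate:
  assumes \<Phi>: "coset_cocycle G H \<Phi>" and q: "q \<in> carrier (G Mod H)" and x: "x \<in> carrier G" and h: "h \<in> H"
  shows "\<Phi> q (x \<otimes> h \<otimes> inv x) = \<Phi> (q \<otimes>\<^bsub>G Mod H\<^esub> (H #> x)) h"
proof -
  let ?q = "q \<otimes>\<^bsub>G Mod H\<^esub> (H #> x)"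
  have q': "?q \<in> carrier (G Mod H)" using q x by (rule coset_mult_closed)
  have "\<Phi> q (x \<otimes> (h \<otimes> inv x)) = \<Phi> q x + (\<Phi> ?q h + \<Phi> ?q (inv x))"
    using cocycle_add[OF \<Phi> q x, of "h \<otimes> inv x"] cocycle_add_subgroup[OF \<Phi> q' h, of "inv x"] x h by simp
  then show ?thesis using cocycle_inv[OF \<Phi> q x] x h by (simp add: m_assoc)
qed

end

text \<open>All base points are used together: conjugation permutes them, so the intersection is
  normal in \<open>G\<close>.\<close>

definition cocycle_kernel ::
    "('a, 'b) monoid_scheme \<Rightarrow> 'a set \<Rightarrow> ('a set \<Rightarrow> 'a \<Rightarrow> int) \<Rightarrow> nat \<Rightarrow> 'a set" where
  "cocycle_kernel G H \<Phi> n = {x \<in> H. \<forall>q\<in>carrier (G Mod H). int n dvd \<Phi> q x}"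

context normal
begin

lemma cocycle_kernel_normal:
  assumes \<Phi>: "coset_cocycle G H \<Phi>"
  shows "cocycle_kernel G H \<Phi> n \<lhd> G"
proof -
  have "subgroup (cocycle_kernel G H \<Phi> n) G"
  proof (rule subgroupI)
    show "cocycle_kernel G H \<Phi> n \<noteq> {}"
      using cocycle_one[OF \<Phi>] by (auto simp: cocycle_kernel_def intro!: exI[of _ \<one>])
  qed (auto simp: cocycle_kernel_def cocycle_inv_subgroup[OF \<Phi>] cocycle_add_subgroup[OF \<Phi>])
  moreover have "x \<otimes> h \<otimes> inv x \<in> cocycle_kernel G H \<Phi> n"
    if "x \<in> carrier G" "h \<in> cocycle_kernel G H \<Phi> n" for x h
    using that by (auto simp: cocycle_kernel_def inv_op_closed2 cocycle_conjugate[OF \<Phi>] coset_mult_closed)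
  ultimately show ?thesis unfolding normal_inv_iff by blast
qed

lemma derived_subset_cocycle_kernel:
  assumes \<Phi>: "coset_cocycle G H \<Phi>"
  shows "derived G H \<subseteq> cocycle_kernel G H \<Phi> n"
  unfolding derived_def
proof (rule generate_subgroup_incl)
  show "subgroup (cocycle_kernel G H \<Phi> n) G"
    using cocycle_kernel_normal[OF \<Phi>] by (rule normal_imp_subgroup)
  show "derived_set G H \<subseteq> cocycle_kernel G H \<Phi> n"
    by (auto simp: cocycle_kernel_def cocycle_add_subgroup[OF \<Phi>] cocycle_inv_subgroup[OF \<Phi>])
qed

text \<open>The values of \<open>\<Phi> q\<close> modulo \<open>n\<close>, taken over all
  \<open>q\<close>, embed \<open>H\<close> modulo the kernel into a power of the integers modulo
  \<open>n\<close>. The new layer is abelian of exponent \<open>n\<close>, so the derived length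
  grows by at most one and the exponent by a factor \<open>n\<close>.\<close>

lemma cocycle_kernel_solvable:
  assumes \<Phi>: "coset_cocycle G H \<Phi>" and H: "H \<in> solvable_subgroups \<Sigma> G m" and n: "sigma_number \<Sigma> n"
  shows "cocycle_kernel G H \<Phi> n \<in> solvable_subgroups \<Sigma> G (Suc m)"
proof -
  let ?K = "cocycle_kernel G H \<Phi> n"
  interpret K: normal ?K G by (rule cocycle_kernel_normal[OF \<Phi>])
  have HI: "H \<in> pro_normal_subgroups \<Sigma> G" using H by (simp add: solvable_subgroups_def)
  have n0: "n > 0" using n by (simp add: sigma_number_def)
  \<comment> \<open>Outside \<open>H\<close> the second component is not additive, but on elements
    of the same coset of \<open>H\<close> its differences are the values at
    \<open>x \<otimes> inv y\<close>.\<close>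
  define \<phi> where "\<phi> x = (H #> x, restrict (\<lambda>q. \<Phi> q x mod int n) (carrier (G Mod H)))" for x
  have "finite (carrier (G Mod ?K))"
  proof (rule K.finite_Mod)
    show "finite (carrier (G Mod H) \<times> (carrier (G Mod H) \<rightarrow>\<^sub>E {0..<int n}))"
      using pro_normal_subgroupsD(2)[OF HI] by (intro finite_cartesian_product finite_PiE) auto
    show "\<phi> x \<in> carrier (G Mod H) \<times> (carrier (G Mod H) \<rightarrow>\<^sub>E {0..<int n})" if "x \<in> carrier G" for x
      using that n0 by (auto simp: \<phi>_def carrier_FactGroup)
    show "x \<otimes> inv y \<in> ?K" if xy: "x \<in> carrier G" "y \<in> carrier G" and eq: "\<phi> x = \<phi> y" for x y
    proof -
      have cos: "H #> x = H #> y" using eq by (simp add: \<phi>_def)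
      have "int n dvd \<Phi> q (x \<otimes> inv y)" if q: "q \<in> carrier (G Mod H)" for q
      proof -
        have "\<Phi> q x mod int n = \<Phi> q y mod int n"
          using eq q unfolding \<phi>_def by (auto dest: fun_cong[of _ _ q])
        moreover have "\<Phi> q (x \<otimes> inv y) = \<Phi> q x - \<Phi> q y"
          using cocycle_add[OF \<Phi> q xy(1), of "inv y"] cocycle_inv[OF \<Phi> q xy(2)] xy cos by simp
        ultimately show ?thesis by (simp add: mod_eq_dvd_iff)
      qed
      then show ?thesis using cos xy rcos_eq_iff by (simp add: cocycle_kernel_def)
    qed
  qed
  moreover have "\<exists>k. sigma_number \<Sigma> k \<and> (\<forall>x\<in>carrier G. x [^] k \<in> ?K)"
  proof (intro exI conjI ballI)
    show "sigma_number \<Sigma> (order (G Mod H) * n)"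
      using pro_normal_subgroupsD(3)[OF HI] n by (rule sigma_number_mult)
    fix x assume x: "x \<in> carrier G"
    define y where "y = x [^] order (G Mod H)"
    have y: "y \<in> H" unfolding y_def using x by (rule pow_order_Mod)
    have "y [^] n \<in> ?K"
      using y is_subgroup
      by (simp add: cocycle_kernel_def subgroup_nat_pow_closed cocycle_pow_subgroup[OF \<Phi>])
    then show "x [^] (order (G Mod H) * n) \<in> ?K" using x by (simp add: y_def nat_pow_pow)
  qed
  moreover have "(derived G ^^ Suc m) (carrier G) \<subseteq> ?K"
  proof -
    have "derived G ((derived G ^^ m) (carrier G)) \<subseteq> derived G H"
      using H subset by (intro mono_derived) (auto simp: solvable_subgroups_def)
    then show ?thesis using derived_subset_cocycle_kernel[OF \<Phi>] by force
  qed
  ultimately show ?thesis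
    using K.pro_normal_subgroups_iff by (simp add: solvable_subgroups_def)
qed

text \<open>Commutators of \<open>K\<close> lie in \<open>H\<close>, so the image of
  \<open>K\<close> in \<open>G Mod H\<close> is abelian, and a character of this image is pulled
  back. Its order \<open>e\<close> divides that of \<open>G Mod H\<close>, so being a
  \<Sigma>-number is inherited.\<close>

lemma subgroup_character_separating:
  assumes fin: "finite (carrier (G Mod H))" and K: "subgroup K G" "H \<subseteq> K" "derived G K \<subseteq> H"
    and x: "x \<in> K" "x \<notin> H"
  obtains \<chi> :: "'a \<Rightarrow> int" and e :: nat where "e dvd order (G Mod H)"
    "\<And>y z. y \<in> K \<Longrightarrow> z \<in> K \<Longrightarrow> [\<chi> (y \<otimes> z) = \<chi> y + \<chi> z] (mod int e)"
    "\<And>y z. y \<in> K \<Longrightarrow> z \<in> K \<Longrightarrow> H #> y = H #> z \<Longrightarrow> \<chi> y = \<chi> z"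
    "\<not> int e dvd \<chi> x"
proof -
  let ?Q = "G Mod H"
  interpret h: group_hom G ?Q "\<lambda>x. H #> x" by (rule group_hom_Mod)
  define A where "A = (\<lambda>x. H #> x) ` K"
  have A: "subgroup A ?Q" unfolding A_def using K(1) by (rule h.subgroup_img_is_subgroup)
  interpret A: group "?Q\<lparr>carrier := A\<rparr>" using A h.H.is_group by (rule subgroup.subgroup_is_group)
  interpret A: comm_group "?Q\<lparr>carrier := A\<rparr>"
  proof (rule A.group_comm_groupI)
    fix a b assume "a \<in> carrier (?Q\<lparr>carrier := A\<rparr>)" "b \<in> carrier (?Q\<lparr>carrier := A\<rparr>)"
    then obtain y z where yz: "y \<in> K" "z \<in> K" "a = H #> y" "b = H #> z" by (auto simp: A_def)
    have c: "y \<in> carrier G" "z \<in> carrier G" using yz subgroup.mem_carrier[OF K(1)] by auto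
    have "y \<otimes> z \<otimes> inv y \<otimes> inv z \<in> derived G K"
      unfolding derived_def using yz by (intro generate.incl) blast
    then have "(y \<otimes> z) \<otimes> inv (z \<otimes> y) \<in> H"
      using K(3) c by (auto simp: m_assoc inv_mult_group)
    then have "H #> (y \<otimes> z) = H #> (z \<otimes> y)"
      using c rcos_eq_iff[of "y \<otimes> z" "z \<otimes> y"] by blast
    then show "a \<otimes>\<^bsub>?Q\<lparr>carrier := A\<rparr>\<^esub> b = b \<otimes>\<^bsub>?Q\<lparr>carrier := A\<rparr>\<^esub> a"
      unfolding yz using h.hom_mult[OF c] h.hom_mult[OF c(2,1)] by simp
  qed
  have "finite (carrier (?Q\<lparr>carrier := A\<rparr>))"
    using subgroup.subset[OF A] fin finite_subset by auto
  moreover have "H #> x \<in> carrier (?Q\<lparr>carrier := A\<rparr>)" using x by (simp add: A_def)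
  moreover have "H #> x \<noteq> \<one>\<^bsub>?Q\<lparr>carrier := A\<rparr>\<^esub>"
    using x subgroup.mem_carrier[OF K(1)] rcos_eq_self_iff by (simp add: one_FactGroup)
  ultimately obtain \<chi> :: "'a set \<Rightarrow> int" where \<chi>: "\<And>a b. a \<in> A \<Longrightarrow> b \<in> A \<Longrightarrow>
      [\<chi> (a \<otimes>\<^bsub>?Q\<^esub> b) = \<chi> a + \<chi> b] (mod int (order (?Q\<lparr>carrier := A\<rparr>)))"
    "\<not> int (order (?Q\<lparr>carrier := A\<rparr>)) dvd \<chi> (H #> x)"
    using A.character_separating[of "H #> x"] by auto
  show thesis
  proof (rule that[of "order (?Q\<lparr>carrier := A\<rparr>)" "\<lambda>y. \<chi> (H #> y)"])
    show "order (?Q\<lparr>carrier := A\<rparr>) dvd order ?Q"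
      using h.H.lagrange[OF A] by (metis dvd_triv_right order_def partial_object.select_convs(1)
          partial_object.update_convs(1) partial_object.surjective)
    fix y z assume yz: "y \<in> K" "z \<in> K"
    then have "H #> (y \<otimes> z) = (H #> y) \<otimes>\<^bsub>?Q\<^esub> (H #> z)"
      using subgroup.mem_carrier[OF K(1)] by simp
    then show "[\<chi> (H #> (y \<otimes> z)) = \<chi> (H #> y) + \<chi> (H #> z)] (mod int (order (?Q\<lparr>carrier := A\<rparr>)))"
      using \<chi>(1) yz by (simp add: A_def)
  qed (use \<chi>(2) in auto)
qed

end


section \<open>The derived series of a pro-\<open>\<Sigma>\<close> completion\<close>

text \<open>The map \<open>proj N\<close> is the projection of the completion onto its component \<open>G Mod N\<close>.\<close>

locale pro_group = G: group G + S: group S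
  for \<Sigma> :: "nat set" and G :: "('g, 'c) monoid_scheme" (structure)
    and S :: "('a, 'b) monoid_scheme" and T :: "'a topology" +
  fixes proj :: "'g set \<Rightarrow> 'a \<Rightarrow> 'g set"
  assumes proj_hom: "N \<in> pro_normal_subgroups \<Sigma> G \<Longrightarrow> proj N \<in> hom S (G Mod N)"
    and proj_mono: "N \<in> pro_normal_subgroups \<Sigma> G \<Longrightarrow> M \<in> pro_normal_subgroups \<Sigma> G \<Longrightarrow> N \<subseteq> M \<Longrightarrow>
      x \<in> carrier S \<Longrightarrow> \<gamma> \<in> carrier G \<Longrightarrow> proj N x = N #> \<gamma> \<Longrightarrow> proj M x = M #> \<gamma>"
    and dense: "\<gamma> \<in> carrier G \<Longrightarrow>
      \<exists>x\<in>carrier S. \<forall>N\<in>pro_normal_subgroups \<Sigma> G. proj N x = N #> \<gamma>"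
    and closure_of_iff: "A \<subseteq> carrier S \<Longrightarrow> x \<in> T closure_of A \<longleftrightarrow>
      x \<in> carrier S \<and> (\<forall>N\<in>pro_normal_subgroups \<Sigma> G. \<exists>y\<in>A. proj N y = proj N x)"

section \<open>The inverse limit and its topology\<close>

context
  fixes \<Sigma> :: "nat set" and G :: "('g, 'c) monoid_scheme" (structure)
  assumes G: "group G"
begin

interpretation group G by (rule G)

lemma carrier_pro_completion: "carrier (pro_completion \<Sigma> G) =
    {x \<in> (\<Pi>\<^sub>E N\<in>pro_normal_subgroups \<Sigma> G. carrier (G Mod N)).
      \<forall>N\<in>pro_normal_subgroups \<Sigma> G. \<forall>M\<in>pro_normal_subgroups \<Sigma> G. N \<subseteq> M \<longrightarrow> x M = M <#> x N}"
  by (simp add: pro_completion_def Let_def product_group_def)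

lemma mult_pro_completion: "x \<otimes>\<^bsub>pro_completion \<Sigma> G\<^esub> y =
    (\<lambda>N\<in>pro_normal_subgroups \<Sigma> G. x N \<otimes>\<^bsub>G Mod N\<^esub> y N)"
  by (simp add: pro_completion_def Let_def product_group_def)

lemma pro_completion_PiE: "x \<in> carrier (pro_completion \<Sigma> G) \<Longrightarrow>
    x \<in> (\<Pi>\<^sub>E N\<in>pro_normal_subgroups \<Sigma> G. carrier (G Mod N))"
  unfolding carrier_pro_completion by blast

lemma set_mult_rcos_superset:
  assumes "N \<lhd> G" "M \<lhd> G" "N \<subseteq> M" "\<gamma> \<in> carrier G"
  shows "M <#> (N #> \<gamma>) = M #> \<gamma>"
proof -
  interpret M: normal M G by fact
  interpret N: normal N G by fact
  have "M <#> N \<subseteq> M" using assms(3) by (auto simp: set_mult_def)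
  moreover have "y \<in> M <#> N" if "y \<in> M" for y
  proof -
    have "y = y \<otimes> \<one>" using that by simp
    then show ?thesis using that N.one_closed unfolding set_mult_def by blast
  qed
  ultimately have "M <#> N = M" by blast
  then show ?thesis using setmult_rcos_assoc[OF M.subset N.subset assms(4)] by simp
qed

lemma pro_completion_coset:
  assumes "x \<in> carrier (pro_completion \<Sigma> G)" "N \<in> pro_normal_subgroups \<Sigma> G"
  obtains \<gamma> where "\<gamma> \<in> carrier G" "x N = N #> \<gamma>"
proof -
  have "x N \<in> carrier (G Mod N)" using pro_completion_PiE[OF assms(1)] assms(2) by (rule PiE_mem)
  then show thesis using that unfolding carrier_FactGroup by blast
qed

lemma pro_completion_mono:
  assumes "x \<in> carrier (pro_completion \<Sigma> G)" "N \<in> pro_normal_subgroups \<Sigma> G"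
    "M \<in> pro_normal_subgroups \<Sigma> G" "N \<subseteq> M" "\<gamma> \<in> carrier G" "x N = N #> \<gamma>"
  shows "x M = M #> \<gamma>"
proof -
  have "x M = M <#> x N" using assms(1-4) unfolding carrier_pro_completion by blast
  then show ?thesis
    using assms(2-6) set_mult_rcos_superset[of N M \<gamma>] pro_normal_subgroupsD(1)[of _ \<Sigma> G] by simp
qed

lemma pro_completion_dense:
  assumes "\<gamma> \<in> carrier G"
  shows "(\<lambda>N\<in>pro_normal_subgroups \<Sigma> G. N #> \<gamma>) \<in> carrier (pro_completion \<Sigma> G)"
  unfolding carrier_pro_completion
proof (intro CollectI conjI ballI impI)
  show "(\<lambda>N\<in>pro_normal_subgroups \<Sigma> G. N #> \<gamma>)
      \<in> (\<Pi>\<^sub>E N\<in>pro_normal_subgroups \<Sigma> G. carrier (G Mod N))"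
    using assms by (auto simp: carrier_FactGroup)
  fix N M assume NM: "N \<in> pro_normal_subgroups \<Sigma> G" "M \<in> pro_normal_subgroups \<Sigma> G" "N \<subseteq> M"
  then have "M <#> (N #> \<gamma>) = M #> \<gamma>"
    using assms by (intro set_mult_rcos_superset) (auto dest: pro_normal_subgroupsD)
  then show "(\<lambda>N\<in>pro_normal_subgroups \<Sigma> G. N #> \<gamma>) M
      = M <#> (\<lambda>N\<in>pro_normal_subgroups \<Sigma> G. N #> \<gamma>) N"
    using NM by simp
qed

lemma pro_completion_m_closed:
  assumes x: "x \<in> carrier (pro_completion \<Sigma> G)" and y: "y \<in> carrier (pro_completion \<Sigma> G)"
  shows "x \<otimes>\<^bsub>pro_completion \<Sigma> G\<^esub> y \<in> carrier (pro_completion \<Sigma> G)"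
  unfolding carrier_pro_completion
proof (intro CollectI conjI ballI impI)
  show "x \<otimes>\<^bsub>pro_completion \<Sigma> G\<^esub> y \<in> (\<Pi>\<^sub>E N\<in>pro_normal_subgroups \<Sigma> G. carrier (G Mod N))"
    unfolding mult_pro_completion
  proof (rule restrict_PiE_iff[THEN iffD2], rule ballI)
    fix N assume N: "N \<in> pro_normal_subgroups \<Sigma> G"
    interpret Q: group "G Mod N" using pro_normal_subgroupsD(1)[OF N] by (rule normal.factorgroup_is_group)
    have "x N \<in> carrier (G Mod N)" "y N \<in> carrier (G Mod N)"
      using PiE_mem[OF pro_completion_PiE N] x y by auto
    then show "x N \<otimes>\<^bsub>G Mod N\<^esub> y N \<in> carrier (G Mod N)" by (rule Q.m_closed)
  qed
next
  fix N M assume N: "N \<in> pro_normal_subgroups \<Sigma> G" and M: "M \<in> pro_normal_subgroups \<Sigma> G" and "N \<subseteq> M"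
  interpret M: normal M G using M by (rule pro_normal_subgroupsD)
  interpret N: normal N G using N by (rule pro_normal_subgroupsD)
  obtain a b where ab: "a \<in> carrier G" "x N = N #> a" "b \<in> carrier G" "y N = N #> b"
    using pro_completion_coset[OF x N] pro_completion_coset[OF y N] by metis
  then have "x M = M #> a" "y M = M #> b"
    using pro_completion_mono[OF x N M \<open>N \<subseteq> M\<close>] pro_completion_mono[OF y N M \<open>N \<subseteq> M\<close>] by auto
  then show "(x \<otimes>\<^bsub>pro_completion \<Sigma> G\<^esub> y) M = M <#> (x \<otimes>\<^bsub>pro_completion \<Sigma> G\<^esub> y) N"
    using N M ab M.rcos_sum N.rcos_sum
      set_mult_rcos_superset[OF N.normal_axioms M.normal_axioms \<open>N \<subseteq> M\<close>, of "a \<otimes> b"]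
    by (simp add: mult_pro_completion mult_FactGroup)
qed

lemma topspace_pro_completion:
  "topspace (pro_completion_topology \<Sigma> G) = carrier (pro_completion \<Sigma> G)"
  using pro_completion_PiE by (auto simp: pro_completion_topology_def)

lemma pro_normal_subgroups_INT:
  assumes "finite J" "J \<subseteq> pro_normal_subgroups \<Sigma> G"
  shows "\<exists>N\<in>pro_normal_subgroups \<Sigma> G. \<forall>M\<in>J. N \<subseteq> M"
  using assms
proof (induction J)
  case empty
  then show ?case using pro_normal_subgroups_carrier by blast
next
  case (insert M J)
  then obtain N where "N \<in> pro_normal_subgroups \<Sigma> G" "\<forall>M\<in>J. N \<subseteq> M" by blast
  then show ?case using insert.prems pro_normal_subgroups_Int[of M \<Sigma> N]
    by (intro bexI[of _ "M \<inter> N"]) auto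
qed

text \<open>A basic open set restricts finitely many coordinates. Their indices contain a common
  \<open>N\<close>, and by compatibility the coordinate at \<open>N\<close> determines the others,
  so agreement at one \<open>N\<close> at a time suffices.\<close>

lemma closure_of_pro_completion:
  assumes A: "A \<subseteq> carrier (pro_completion \<Sigma> G)"
  shows "x \<in> pro_completion_topology \<Sigma> G closure_of A \<longleftrightarrow>
    x \<in> carrier (pro_completion \<Sigma> G) \<and> (\<forall>N\<in>pro_normal_subgroups \<Sigma> G. \<exists>y\<in>A. y N = x N)"
    (is "_ \<in> ?cl \<longleftrightarrow> _ \<and> ?R")
proof -
  let ?I = "pro_normal_subgroups \<Sigma> G"
  let ?X = "\<lambda>N. discrete_topology (carrier (G Mod N))"
  have eq: "x \<in> ?cl \<longleftrightarrow> ?R" if x: "x \<in> carrier (pro_completion \<Sigma> G)"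
  proof
    assume cl: "x \<in> ?cl"
    show ?R
    proof
      fix N assume N: "N \<in> ?I"
      have "continuous_map (product_topology ?X ?I) (?X N) (\<lambda>y. y N)"
        using N by (rule continuous_map_product_projection)
      then have "openin (product_topology ?X ?I) {y \<in> topspace (product_topology ?X ?I). y N \<in> {x N}}"
        using PiE_mem[OF pro_completion_PiE[OF x] N] by (intro openin_continuous_map_preimage) auto
      then have "openin (pro_completion_topology \<Sigma> G)
          ({y \<in> topspace (product_topology ?X ?I). y N \<in> {x N}} \<inter> carrier (pro_completion \<Sigma> G))"
        unfolding pro_completion_topology_def by (rule openin_subtopology_Int)
      moreover have "x \<in> {y \<in> topspace (product_topology ?X ?I). y N \<in> {x N}} \<inter> carrier (pro_completion \<Sigma> G)"
        using x pro_completion_PiE[OF x] by simp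
      ultimately obtain y where "y \<in> A"
          "y \<in> {y \<in> topspace (product_topology ?X ?I). y N \<in> {x N}} \<inter> carrier (pro_completion \<Sigma> G)"
        using cl unfolding in_closure_of by meson
      then show "\<exists>y\<in>A. y N = x N" by auto
    qed
  next
    assume R: ?R
    show "x \<in> ?cl"
      unfolding in_closure_of topspace_pro_completion
    proof (intro conjI allI impI x)
      fix U assume U: "x \<in> U \<and> openin (pro_completion_topology \<Sigma> G) U"
      then obtain V where V: "openin (product_topology ?X ?I) V" "U = V \<inter> carrier (pro_completion \<Sigma> G)"
        unfolding pro_completion_topology_def openin_subtopology by blast
      have "x \<in> V" using U V(2) by simp
      with V(1)[unfolded openin_product_topology_alt]
      have "\<exists>B. finite {N \<in> ?I. B N \<noteq> topspace (?X N)} \<and>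
          (\<forall>N\<in>?I. openin (?X N) (B N)) \<and> x \<in> Pi\<^sub>E ?I B \<and> Pi\<^sub>E ?I B \<subseteq> V"
        by (rule bspec)
      then obtain B where B: "finite {N \<in> ?I. B N \<noteq> topspace (?X N)}" "x \<in> Pi\<^sub>E ?I B" "Pi\<^sub>E ?I B \<subseteq> V"
        by (elim exE conjE)
      have "{N \<in> ?I. B N \<noteq> topspace (?X N)} \<subseteq> ?I" by (rule Collect_restrict)
      from pro_normal_subgroups_INT[OF B(1) this]
      obtain N where N1: "N \<in> ?I" and N2: "\<forall>M\<in>{N \<in> ?I. B N \<noteq> topspace (?X N)}. N \<subseteq> M" ..
      have N: "N \<in> ?I" "M \<in> ?I \<Longrightarrow> B M \<noteq> topspace (?X M) \<Longrightarrow> N \<subseteq> M" for M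
        using N1 bspec[OF N2, of M] by (simp_all only: mem_Collect_eq simp_thms)
      then obtain y where y: "y \<in> A" "y N = x N" using R by blast
      have yc: "y \<in> carrier (pro_completion \<Sigma> G)" using y A by blast
      have "y M \<in> B M" if M: "M \<in> ?I" for M
      proof (cases "B M = topspace (?X M)")
        case True
        then show ?thesis using PiE_mem[OF pro_completion_PiE[OF yc] M] by simp
      next
        case False
        obtain \<gamma> where \<gamma>: "\<gamma> \<in> carrier G" "x N = N #> \<gamma>" using pro_completion_coset[OF x N(1)] .
        have "y M = x M"
          using pro_completion_mono[OF x N(1) M N(2)[OF M False] \<gamma>]
            pro_completion_mono[OF yc N(1) M N(2)[OF M False] \<gamma>(1)] \<gamma>(2) y(2) by simp
        then show ?thesis using PiE_mem[OF B(2) M] by simp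
      qed
      then have "y \<in> Pi\<^sub>E ?I B" using pro_completion_PiE[OF yc] by (simp add: PiE_iff)
      then have "y \<in> U" unfolding V(2) using B(3) yc by (intro IntI subsetD[OF B(3)])
      with y(1) show "\<exists>y. y \<in> A \<and> y \<in> U" by (intro exI conjI)
    qed
  qed
  have "?cl \<subseteq> carrier (pro_completion \<Sigma> G)"
    using closure_of_subset_topspace[of "pro_completion_topology \<Sigma> G" A]
    unfolding topspace_pro_completion .
  then show ?thesis using eq subsetD[of ?cl] by meson
qed

lemma pro_group_of_iso:
  assumes S: "group S" and h: "h \<in> iso (pro_completion \<Sigma> G) S"
    and homeo: "homeomorphic_map (pro_completion_topology \<Sigma> G) T h"
  shows "pro_group \<Sigma> G S T (\<lambda>N x. inv_into (carrier (pro_completion \<Sigma> G)) h x N)"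
proof -
  let ?P = "pro_completion \<Sigma> G"
  let ?I = "pro_normal_subgroups \<Sigma> G"
  let ?k = "inv_into (carrier ?P) h"
  have bij: "bij_betw h (carrier ?P) (carrier S)" and hom: "h \<in> hom ?P S"
    using h by (auto simp: iso_def)
  have kS: "?k x \<in> carrier ?P" and hk: "h (?k x) = x" if "x \<in> carrier S" for x
    using that bij by (auto simp: bij_betw_def inv_into_into f_inv_into_f)
  have kh: "?k (h y) = y" if "y \<in> carrier ?P" for y
    using that bij by (simp add: bij_betw_def)
  have hP: "h y \<in> carrier S" if "y \<in> carrier ?P" for y using that bij by (auto simp: bij_betw_def)
  have k_mult: "?k (x \<otimes>\<^bsub>S\<^esub> y) = ?k x \<otimes>\<^bsub>?P\<^esub> ?k y" if xy: "x \<in> carrier S" "y \<in> carrier S" for x y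
  proof -
    have "h (?k x \<otimes>\<^bsub>?P\<^esub> ?k y) = x \<otimes>\<^bsub>S\<^esub> y"
      using hom xy kS hk unfolding hom_def by simp
    then show ?thesis using kh[OF pro_completion_m_closed[OF kS[OF xy(1)] kS[OF xy(2)]]] by simp
  qed
  show ?thesis
  proof (intro pro_group.intro pro_group_axioms.intro G S)
    show "(\<lambda>x. ?k x N) \<in> hom S (G Mod N)" if N: "N \<in> ?I" for N
    proof (rule homI)
      show "?k x N \<in> carrier (G Mod N)" if "x \<in> carrier S" for x
        using pro_completion_PiE[OF kS[OF that]] N by (rule PiE_mem)
      show "?k (x \<otimes>\<^bsub>S\<^esub> y) N = ?k x N \<otimes>\<^bsub>G Mod N\<^esub> ?k y N" if "x \<in> carrier S" "y \<in> carrier S" for x y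
        using that k_mult N by (simp add: mult_pro_completion)
    qed
    show "?k x M = M #> \<gamma>" if "N \<in> ?I" "M \<in> ?I" "N \<subseteq> M" "x \<in> carrier S" "\<gamma> \<in> carrier G" "?k x N = N #> \<gamma>"
      for N M x \<gamma> using that pro_completion_mono[OF kS] by blast
    show "\<exists>x\<in>carrier S. \<forall>N\<in>?I. ?k x N = N #> \<gamma>" if "\<gamma> \<in> carrier G" for \<gamma>
      using pro_completion_dense[OF that] hP kh by (intro bexI[of _ "h (\<lambda>N\<in>?I. N #> \<gamma>)"]) auto
    show "x \<in> T closure_of A \<longleftrightarrow> x \<in> carrier S \<and> (\<forall>N\<in>?I. \<exists>y\<in>A. ?k y N = ?k x N)"
      if A: "A \<subseteq> carrier S" for A x
    proof -
      have kA: "?k ` A \<subseteq> carrier ?P" using A kS by blast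
      have "h ` ?k ` A = A" using A hk by force
      then have cl: "T closure_of A = h ` (pro_completion_topology \<Sigma> G closure_of (?k ` A))"
        using homeomorphic_map_closure_of[OF homeo, of "?k ` A"] kA topspace_pro_completion by simp
      show ?thesis
      proof
        assume "x \<in> T closure_of A"
        then obtain y where y: "y \<in> pro_completion_topology \<Sigma> G closure_of (?k ` A)" "x = h y"
          using cl by blast
        then show "x \<in> carrier S \<and> (\<forall>N\<in>?I. \<exists>y\<in>A. ?k y N = ?k x N)"
          using closure_of_pro_completion[OF kA] hP kh by auto
      next
        assume x: "x \<in> carrier S \<and> (\<forall>N\<in>?I. \<exists>y\<in>A. ?k y N = ?k x N)"
        then have "?k x \<in> pro_completion_topology \<Sigma> G closure_of (?k ` A)"
          using closure_of_pro_completion[OF kA] kS by auto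
        then show "x \<in> T closure_of A" using cl hk x by force
      qed
    qed
  qed
qed

end

section \<open>The topological derived series seen in finite quotients\<close>

context pro_group
begin

abbreviation "I \<equiv> pro_normal_subgroups \<Sigma> G"

lemma proj_group_hom: "N \<in> I \<Longrightarrow> group_hom S (G Mod N) (proj N)"
  using proj_hom normal.factorgroup_is_group[OF pro_normal_subgroupsD(1)] S.is_group
  by (intro group_hom.intro group_hom_axioms.intro)

lemma proj_coset:
  assumes "N \<in> I" "x \<in> carrier S"
  obtains \<gamma> where "\<gamma> \<in> carrier G" "proj N x = N #> \<gamma>"
proof -
  have "proj N x \<in> carrier (G Mod N)" using proj_hom[OF assms(1)] assms(2) by (auto simp: hom_def)
  then show thesis using that unfolding carrier_FactGroup by blast
qed

text \<open>By density, each term of the series projects onto the full image of the discrete derived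
  subgroup; homomorphisms commute with \<open>derived\<close>, and closures are tested level by
  level. The inclusion in the carrier is part of the induction because \<open>closure_of_iff\<close>
  asks for it.\<close>

lemma topological_derived_iff:
  "topological_derived S T m \<subseteq> carrier S \<and>
   (\<forall>x\<in>carrier S. x \<in> topological_derived S T m \<longleftrightarrow>
     (\<forall>N\<in>I. proj N x \<in> (\<lambda>\<gamma>. N #> \<gamma>) ` (derived G ^^ m) (carrier G)))"
proof (induction m)
  case 0
  show ?case using proj_coset by (auto simp: image_iff) metis
next
  case (Suc m)
  let ?D = "topological_derived S T m" and ?E = "(derived G ^^ m) (carrier G)"
  have E: "?E \<subseteq> carrier G" by (rule G.exp_of_derived_in_carrier) simp
  have img: "proj N ` ?D = (\<lambda>\<gamma>. N #> \<gamma>) ` ?E" if N: "N \<in> I" for N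
  proof
    show "proj N ` ?D \<subseteq> (\<lambda>\<gamma>. N #> \<gamma>) ` ?E" using Suc N by blast
    show "(\<lambda>\<gamma>. N #> \<gamma>) ` ?E \<subseteq> proj N ` ?D"
    proof
      fix q assume "q \<in> (\<lambda>\<gamma>. N #> \<gamma>) ` ?E"
      then obtain \<gamma> where \<gamma>: "\<gamma> \<in> ?E" "q = N #> \<gamma>" by blast
      then obtain x where "x \<in> carrier S" "\<forall>N\<in>I. proj N x = N #> \<gamma>" using dense E by blast
      moreover from this have "x \<in> ?D" using Suc \<gamma> by auto
      ultimately show "q \<in> proj N ` ?D" using \<gamma> N by auto
    qed
  qed
  have imgS: "proj N ` derived S ?D = (\<lambda>\<gamma>. N #> \<gamma>) ` (derived G ^^ Suc m) (carrier G)" if N: "N \<in> I" for N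
  proof -
    interpret p: group_hom S "G Mod N" "proj N" using N by (rule proj_group_hom)
    interpret normal N G using N by (rule pro_normal_subgroupsD)
    interpret q: group_hom G "G Mod N" "\<lambda>\<gamma>. N #> \<gamma>" by (rule group_hom_Mod)
    have "proj N ` derived S ?D = derived (G Mod N) (proj N ` ?D)"
      using p.derived_img Suc by metis
    also have "\<dots> = (\<lambda>\<gamma>. N #> \<gamma>) ` derived G ?E" unfolding img[OF N] using q.derived_img E by metis
    finally show ?thesis by simp
  qed
  have dS: "derived S ?D \<subseteq> carrier S" using Suc by (intro S.derived_in_carrier) blast
  have "x \<in> topological_derived S T (Suc m) \<longleftrightarrow>
     (\<forall>N\<in>I. proj N x \<in> (\<lambda>\<gamma>. N #> \<gamma>) ` (derived G ^^ Suc m) (carrier G))" if x: "x \<in> carrier S" for x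
  proof -
    have "x \<in> topological_derived S T (Suc m) \<longleftrightarrow> (\<forall>N\<in>I. proj N x \<in> proj N ` derived S ?D)"
      unfolding topological_derived.simps closure_of_iff[OF dS]
      using x by (simp add: image_iff eq_commute)
    then show ?thesis using imgS by auto
  qed
  moreover have "topological_derived S T (Suc m) \<subseteq> carrier S"
    using closure_of_iff[OF dS] by auto
  ultimately show ?case by blast
qed

text \<open>For the converse, enlarge \<open>N\<close> to \<open>N <#> ?E\<close>, which is a
  solvable level. Triviality there puts the representative into \<open>N <#> ?E\<close>, so modulo
  \<open>N\<close> it can be replaced by an element of \<open>?E\<close>.\<close>

lemma mem_topological_derived_iff:
  assumes x: "x \<in> carrier S"
  shows "x \<in> topological_derived S T m \<longleftrightarrow> (\<forall>N\<in>solvable_subgroups \<Sigma> G m. proj N x = N)"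
proof -
  let ?E = "(derived G ^^ m) (carrier G)"
  have E: "?E \<subseteq> carrier G" by (rule G.exp_of_derived_in_carrier) simp
  have "(\<forall>N\<in>I. proj N x \<in> (\<lambda>\<gamma>. N #> \<gamma>) ` ?E) \<longleftrightarrow> (\<forall>N\<in>solvable_subgroups \<Sigma> G m. proj N x = N)"
  proof (intro iffI ballI)
    fix N assume L: "\<forall>N\<in>I. proj N x \<in> (\<lambda>\<gamma>. N #> \<gamma>) ` ?E" and N: "N \<in> solvable_subgroups \<Sigma> G m"
    then obtain \<gamma> where \<gamma>: "\<gamma> \<in> ?E" "proj N x = N #> \<gamma>" by (auto simp: solvable_subgroups_def)
    interpret normal N G using N pro_normal_subgroupsD(1) by (auto simp: solvable_subgroups_def)
    show "proj N x = N" using \<gamma> N E rcos_eq_self_iff by (auto simp: solvable_subgroups_def)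
  next
    fix N assume R: "\<forall>N\<in>solvable_subgroups \<Sigma> G m. proj N x = N" and N: "N \<in> I"
    obtain \<gamma> where \<gamma>: "\<gamma> \<in> carrier G" "proj N x = N #> \<gamma>" using proj_coset[OF N x] .
    let ?M = "N <#> ?E"
    have M: "?M \<in> solvable_subgroups \<Sigma> G m" "N \<subseteq> ?M" using G.set_mult_exp_of_derived[OF N] by auto
    then have MI: "?M \<in> I" by (simp add: solvable_subgroups_def)
    interpret M: normal ?M G using MI by (rule pro_normal_subgroupsD)
    interpret N: normal N G using N by (rule pro_normal_subgroupsD)
    have "proj ?M x = ?M #> \<gamma>" using proj_mono[OF N MI M(2) x \<gamma>] .
    then have "?M #> \<gamma> = ?M" using R M(1) by simp
    then have "\<gamma> \<in> ?M" using \<gamma> M.rcos_eq_self_iff by simp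
    then obtain n e where "n \<in> N" "e \<in> ?E" "\<gamma> = n \<otimes> e" by (auto simp: set_mult_def)
    then have "N #> \<gamma> = N #> e"
      using E G.coset_mult_assoc[OF N.subset, of n e] G.coset_join2[OF _ N.is_subgroup, of n] by auto
    then show "proj N x \<in> (\<lambda>\<gamma>. N #> \<gamma>) ` ?E" using \<gamma> \<open>e \<in> ?E\<close> by auto
  qed
  with bspec[OF conjunct2[OF topological_derived_iff[of m]] x] show ?thesis by (rule HOL.trans)
qed

lemma topological_derived_normal: "topological_derived S T m \<lhd> S"
proof -
  let ?D = "topological_derived S T m"
  have D: "?D = {x \<in> carrier S. \<forall>N\<in>solvable_subgroups \<Sigma> G m. proj N x = N}"
  proof (rule Set.set_eqI)
    fix x
    show "x \<in> ?D \<longleftrightarrow> x \<in> {x \<in> carrier S. \<forall>N\<in>solvable_subgroups \<Sigma> G m. proj N x = N}"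
      using mem_topological_derived_iff[of x m] subsetD[OF conjunct1[OF topological_derived_iff[of m]], of x]
      unfolding mem_Collect_eq by meson
  qed
  have hom: "group_hom S (G Mod N) (proj N)" if "N \<in> solvable_subgroups \<Sigma> G m" for N
    using that by (auto simp: solvable_subgroups_def intro: proj_group_hom)
  have "subgroup ?D S"
  proof (rule S.subgroupI)
    show "?D \<noteq> {}"
      unfolding D using group_hom.hom_one[OF hom]
      by (auto simp: one_FactGroup intro!: exI[of _ "\<one>\<^bsub>S\<^esub>"])
    fix x assume x: "x \<in> ?D"
    have "proj N (inv\<^bsub>S\<^esub> x) = N" if N: "N \<in> solvable_subgroups \<Sigma> G m" for N
    proof -
      interpret p: group_hom S "G Mod N" "proj N" using N by (rule hom)
      show ?thesis using x N p.hom_inv[of x] p.H.inv_one unfolding D by (auto simp: one_FactGroup)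
    qed
    then show "inv\<^bsub>S\<^esub> x \<in> ?D" using x unfolding D by simp
    fix y assume y: "y \<in> ?D"
    have "proj N (x \<otimes>\<^bsub>S\<^esub> y) = N" if N: "N \<in> solvable_subgroups \<Sigma> G m" for N
    proof -
      interpret p: group_hom S "G Mod N" "proj N" using N by (rule hom)
      show ?thesis
        using x y N p.hom_mult[of x y] p.H.r_one[OF p.H.one_closed] unfolding D by (auto simp: one_FactGroup)
    qed
    then show "x \<otimes>\<^bsub>S\<^esub> y \<in> ?D" using x y unfolding D by simp
  qed (auto simp: D)
  moreover have "y \<otimes>\<^bsub>S\<^esub> x \<otimes>\<^bsub>S\<^esub> inv\<^bsub>S\<^esub> y \<in> ?D" if y: "y \<in> carrier S" and x: "x \<in> ?D" for x y
  proof -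
    have "proj N (y \<otimes>\<^bsub>S\<^esub> x \<otimes>\<^bsub>S\<^esub> inv\<^bsub>S\<^esub> y) = N" if N: "N \<in> solvable_subgroups \<Sigma> G m" for N
    proof -
      interpret p: group_hom S "G Mod N" "proj N" using N by (rule hom)
      have "proj N x = \<one>\<^bsub>G Mod N\<^esub>" using x N unfolding D by (simp add: one_FactGroup)
      then have "proj N (y \<otimes>\<^bsub>S\<^esub> x \<otimes>\<^bsub>S\<^esub> inv\<^bsub>S\<^esub> y) = \<one>\<^bsub>G Mod N\<^esub>"
        using x y unfolding D by simp
      then show ?thesis by (simp add: one_FactGroup)
    qed
    then show ?thesis using x y unfolding D by simp
  qed
  ultimately show ?thesis using S.normal_inv_iff by blast
qed

end


section \<open>Torsion and center\<close>

text \<open>\<open>N <#> E\<close> and \<open>E\<close> have the same image in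
  \<open>G Mod N\<close>, and the commutators of that image are trivial.\<close>

lemma (in group) derived_set_mult_subset:
  assumes N: "N \<lhd> G" and E: "E \<subseteq> carrier G" "derived G E \<subseteq> N"
  shows "derived G (N <#> E) \<subseteq> N"
proof
  interpret normal N G by fact
  interpret h: group_hom G "G Mod N" "\<lambda>x. N #> x" by (rule group_hom_Mod)
  have NE: "N <#> E \<subseteq> carrier G" using subset E(1) by (rule set_mult_closed)
  have eq: "N #> (n \<otimes> e) = N #> e" if "n \<in> N" "e \<in> E" for n e
    using that E(1) coset_mult_assoc[OF subset, of n e] coset_join2[OF _ is_subgroup, of n] by auto
  have "(\<lambda>x. N #> x) ` (N <#> E) \<subseteq> (\<lambda>x. N #> x) ` E"
  proof
    fix q assume "q \<in> (\<lambda>x. N #> x) ` (N <#> E)"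
    then obtain n e where "n \<in> N" "e \<in> E" "q = N #> (n \<otimes> e)" by (auto simp: set_mult_def)
    then show "q \<in> (\<lambda>x. N #> x) ` E" using eq by auto
  qed
  then have "derived (G Mod N) ((\<lambda>x. N #> x) ` (N <#> E)) \<subseteq> derived (G Mod N) ((\<lambda>x. N #> x) ` E)"
    by (rule h.H.mono_derived)
  then have sub: "(\<lambda>x. N #> x) ` derived G (N <#> E) \<subseteq> (\<lambda>x. N #> x) ` derived G E"
    using h.derived_img NE E(1) by simp
  fix x assume x: "x \<in> derived G (N <#> E)"
  then obtain y where "y \<in> derived G E" "N #> x = N #> y" using sub by blast
  moreover from this have "N #> y = N" using E(2) rcos_const[OF is_group] by blast
  ultimately show "x \<in> N" using subsetD[OF derived_in_carrier[OF NE] x] rcos_eq_self_iff by simp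
qed

text \<open>From here on the series is handled through \<open>mem_topological_derived_iff\<close>,
  not through closures.\<close>

declare topological_derived.simps(2) [simp del]

section \<open>Torsion\<close>

locale pro_surface = pro_group \<Sigma> "surface_group g" S T proj
  for \<Sigma> g and S :: "('a, 'b) monoid_scheme" and T proj
begin

abbreviation "\<Gamma> \<equiv> surface_group g"
abbreviation "D \<equiv> topological_derived S T"

lemma solvable_subgroupsD:
  assumes "N \<in> solvable_subgroups \<Sigma> \<Gamma> m"
  shows "N \<in> I" "N \<lhd> \<Gamma>"
  using assms by (auto simp: solvable_subgroups_def dest: pro_normal_subgroupsD)

lemma D_subset: "D m \<subseteq> carrier S"
  by (rule conjunct1[OF topological_derived_iff])

lemma D_antimono: "k \<le> m \<Longrightarrow> D m \<subseteq> D k"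
  using D_subset[of m] mem_topological_derived_iff[of _ m] mem_topological_derived_iff[of _ k]
    G.solvable_subgroups_mono[of k m \<Sigma>]
  by (meson subset_iff)

lemma proj_one_iff:
  assumes "N \<in> I" "\<gamma> \<in> carrier \<Gamma>" "proj N x = N #>\<^bsub>\<Gamma>\<^esub> \<gamma>"
  shows "proj N x = N \<longleftrightarrow> \<gamma> \<in> N"
  using normal.rcos_eq_self_iff[OF pro_normal_subgroupsD(1)[OF assms(1)] assms(2)] assms(3) by simp

lemma proj_pow:
  assumes "N \<in> I" "x \<in> carrier S" "\<gamma> \<in> carrier \<Gamma>" "proj N x = N #>\<^bsub>\<Gamma>\<^esub> \<gamma>"
  shows "proj N (x [^]\<^bsub>S\<^esub> (n::nat)) = N #>\<^bsub>\<Gamma>\<^esub> (\<gamma> [^]\<^bsub>\<Gamma>\<^esub> n)"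
proof -
  interpret p: group_hom S "\<Gamma> Mod N" "proj N" using assms(1) by (rule proj_group_hom)
  interpret normal N \<Gamma> using assms(1) by (rule pro_normal_subgroupsD)
  show ?thesis using assms by (simp add: p.hom_nat_pow FactGroup_pow)
qed

text \<open>Separate \<open>x\<close> from \<open>1\<close> by a character with values in \<open>\<int>/e\<close> and lift the latter to a cocycle.\<close>

lemma detecting_cocycle:
  assumes x: "x \<in> D k" and N: "N \<in> solvable_subgroups \<Sigma> \<Gamma> (Suc k)" and ne: "proj N x \<noteq> N"
  obtains H \<Phi> e where "H \<in> solvable_subgroups \<Sigma> \<Gamma> k" "coset_cocycle \<Gamma> H \<Phi>" "sigma_number \<Sigma> e"
    "\<And>\<gamma>. \<gamma> \<in> carrier \<Gamma> \<Longrightarrow> proj N x = N #>\<^bsub>\<Gamma>\<^esub> \<gamma> \<Longrightarrow> \<gamma> \<in> H \<and> \<not> int e dvd \<Phi> H \<gamma>"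
proof -
  let ?E = "(derived \<Gamma> ^^ k) (carrier \<Gamma>)"
  \<comment> \<open>As \<open>x\<close> lies in \<open>D k\<close>, its representatives modulo
    \<open>N\<close> lie in \<open>H\<close>; as \<open>N\<close> contains the next derived
    subgroup, \<open>H\<close> is abelian modulo \<open>N\<close>.\<close>
  define H where "H = N <#>\<^bsub>\<Gamma>\<^esub> ?E"
  have E: "?E \<subseteq> carrier \<Gamma>" by (rule G.exp_of_derived_in_carrier) simp
  have xS: "x \<in> carrier S" using x D_subset by blast
  have NI: "N \<in> I" and Nn: "N \<lhd> \<Gamma>" using N by (rule solvable_subgroupsD)+
  interpret N: normal N \<Gamma> by (rule Nn)
  have H: "H \<in> solvable_subgroups \<Sigma> \<Gamma> k" and NH: "N \<subseteq> H"
    unfolding H_def using G.set_mult_exp_of_derived[OF NI] by blast+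
  interpret H: normal H \<Gamma> using H by (rule solvable_subgroupsD)
  have "derived \<Gamma> ?E \<subseteq> N" using N by (simp add: solvable_subgroups_def)
  then have dH: "derived \<Gamma> H \<subseteq> N" unfolding H_def by (rule G.derived_set_mult_subset[OF Nn E])
  obtain \<gamma>0 where \<gamma>0: "\<gamma>0 \<in> carrier \<Gamma>" "proj N x = N #>\<^bsub>\<Gamma>\<^esub> \<gamma>0" using proj_coset[OF NI xS] .
  have inH: "\<gamma> \<in> H" if "\<gamma> \<in> carrier \<Gamma>" "proj N x = N #>\<^bsub>\<Gamma>\<^esub> \<gamma>" for \<gamma>
  proof -
    have HI: "H \<in> I" using H by (rule solvable_subgroupsD)
    have "proj H x = H #>\<^bsub>\<Gamma>\<^esub> \<gamma>" using proj_mono[OF NI HI NH xS that] .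
    moreover have "proj H x = H" using x H xS mem_topological_derived_iff by blast
    ultimately show ?thesis using proj_one_iff[OF HI that(1)] by blast
  qed
  have \<gamma>0N: "\<gamma>0 \<notin> N" using ne proj_one_iff[OF NI \<gamma>0] by blast
  obtain \<chi> :: "_ \<Rightarrow> int" and e :: nat where \<chi>: "e dvd order (\<Gamma> Mod N)"
    "\<And>y z. y \<in> H \<Longrightarrow> z \<in> H \<Longrightarrow> [\<chi> (y \<otimes>\<^bsub>\<Gamma>\<^esub> z) = \<chi> y + \<chi> z] (mod int e)"
    "\<And>y z. y \<in> H \<Longrightarrow> z \<in> H \<Longrightarrow> N #>\<^bsub>\<Gamma>\<^esub> y = N #>\<^bsub>\<Gamma>\<^esub> z \<Longrightarrow> \<chi> y = \<chi> z" "\<not> int e dvd \<chi> \<gamma>0"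
    using N.subgroup_character_separating[OF pro_normal_subgroupsD(2)[OF NI] H.is_subgroup NH dH inH[OF \<gamma>0] \<gamma>0N]
    by metis
  have e: "sigma_number \<Sigma> e" using pro_normal_subgroupsD(3)[OF NI] \<chi>(1) by (rule sigma_number_dvd)
  then have e0: "int e > 0" by (simp add: sigma_number_def)
  obtain \<Phi> where \<Phi>: "coset_cocycle \<Gamma> H \<Phi>" "\<And>y. y \<in> H \<Longrightarrow> [\<Phi> H y = \<chi> y] (mod int e)"
    using surface_character_lift[OF H.normal_axioms pro_normal_subgroupsD(2)[OF solvable_subgroupsD(1)[OF H]] e0 \<chi>(2)]
    by metis
  have "\<not> int e dvd \<Phi> H \<gamma>" if \<gamma>: "\<gamma> \<in> carrier \<Gamma>" "proj N x = N #>\<^bsub>\<Gamma>\<^esub> \<gamma>" for \<gamma>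
  proof -
    \<comment> \<open>The character depends only on the coset of \<open>N\<close>. The conclusion
      thus holds for every representative, also for those chosen later modulo smaller
      subgroups.\<close>
    have "\<chi> \<gamma> = \<chi> \<gamma>0" using \<gamma> \<gamma>0 inH by (intro \<chi>(3)) auto
    then show ?thesis using \<Phi>(2)[OF inH[OF \<gamma>]] \<chi>(4) cong_dvd_iff by metis
  qed
  then show thesis using that H \<Phi>(1) e inH by blast
qed

text \<open>If \<open>p\<close> is not in \<Sigma>, the image of \<open>x\<close> in a finite
  \<Sigma>-quotient has order dividing both \<open>p\<close> and a number prime to \<open>p\<close>.
  Otherwise a detecting cocycle takes integer values and is additive on \<open>H\<close>, so the
  factor \<open>p\<close> can be cancelled.\<close>

lemma prime_torsion_step:
  fixes p :: nat
  assumes x: "x \<in> D k" and p: "prime p" and xp: "x [^]\<^bsub>S\<^esub> p \<in> D (Suc k)"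
  shows "x \<in> D (Suc k)"
proof -
  have xS: "x \<in> carrier S" using x D_subset by blast
  have "proj N x = N" if N: "N \<in> solvable_subgroups \<Sigma> \<Gamma> (Suc k)" for N
  proof (cases "p \<in> \<Sigma>")
    case False
    have NI: "N \<in> I" and Nn: "N \<lhd> \<Gamma>" using N by (rule solvable_subgroupsD)+
    interpret normal N \<Gamma> by (rule Nn)
    interpret Q: group "\<Gamma> Mod N" by (rule factorgroup_is_group)
    obtain \<gamma> where \<gamma>: "\<gamma> \<in> carrier \<Gamma>" "proj N x = N #>\<^bsub>\<Gamma>\<^esub> \<gamma>" using proj_coset[OF NI xS] .
    have q: "proj N x \<in> carrier (\<Gamma> Mod N)" using \<gamma> by (simp add: carrier_FactGroup)
    have "proj N x [^]\<^bsub>\<Gamma> Mod N\<^esub> p = proj N (x [^]\<^bsub>S\<^esub> p)"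
      using proj_pow[OF NI xS \<gamma>] \<gamma> by (simp add: FactGroup_pow)
    also have "\<dots> = \<one>\<^bsub>\<Gamma> Mod N\<^esub>" using xp N xS mem_topological_derived_iff by (simp add: one_FactGroup)
    finally have "Q.ord (proj N x) dvd p" using q Q.pow_eq_id by blast
    moreover have "Q.ord (proj N x) dvd order (\<Gamma> Mod N)" using q by (rule Q.ord_dvd_group_order)
    moreover have "\<not> p dvd order (\<Gamma> Mod N)"
      using False p pro_normal_subgroupsD(3)[OF NI] by (auto simp: sigma_number_def)
    ultimately have "Q.ord (proj N x) = 1" using p by (metis prime_nat_iff)
    then show ?thesis using q Q.ord_eq_1 by (simp add: one_FactGroup)
  next
    case True
    show ?thesis
    proof (rule ccontr)
      assume "proj N x \<noteq> N"
      then obtain H \<Phi> e where H: "H \<in> solvable_subgroups \<Sigma> \<Gamma> k" and \<Phi>: "coset_cocycle \<Gamma> H \<Phi>"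
        and e: "sigma_number \<Sigma> e"
        and det: "\<And>\<gamma>. \<gamma> \<in> carrier \<Gamma> \<Longrightarrow> proj N x = N #>\<^bsub>\<Gamma>\<^esub> \<gamma> \<Longrightarrow> \<gamma> \<in> H \<and> \<not> int e dvd \<Phi> H \<gamma>"
        using detecting_cocycle[OF x N] by metis
      interpret H: normal H \<Gamma> using H by (rule solvable_subgroupsD)
      \<comment> \<open>Knowing \<open>p\<close> times the value modulo \<open>e\<close> would not
        suffice when \<open>p\<close> divides \<open>e\<close>; modulo \<open>p * e\<close>,
        cancelling \<open>p\<close> leaves exactly divisibility by \<open>e\<close>.\<close>
      define M where "M = cocycle_kernel \<Gamma> H \<Phi> (p * e)"
      have "sigma_number \<Sigma> (p * e)"
        using sigma_number_prime_power[OF p True, of 1] e by (simp add: sigma_number_mult)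
      then have M: "M \<in> solvable_subgroups \<Sigma> \<Gamma> (Suc k)"
        unfolding M_def using H.cocycle_kernel_solvable[OF \<Phi> H] by blast
      then have NM: "N \<inter> M \<in> solvable_subgroups \<Sigma> \<Gamma> (Suc k)" using N G.solvable_subgroups_Int by blast
      have NMI: "N \<inter> M \<in> I" "N \<in> I" using NM N solvable_subgroupsD by blast+
      obtain \<gamma> where \<gamma>: "\<gamma> \<in> carrier \<Gamma>" "proj (N \<inter> M) x = (N \<inter> M) #>\<^bsub>\<Gamma>\<^esub> \<gamma>"
        using proj_coset[OF NMI(1) xS] .
      have "proj N x = N #>\<^bsub>\<Gamma>\<^esub> \<gamma>" using proj_mono[OF NMI _ xS \<gamma>] by simp
      then have d: "\<gamma> \<in> H" "\<not> int e dvd \<Phi> H \<gamma>" using det \<gamma>(1) by blast+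
      have "proj (N \<inter> M) (x [^]\<^bsub>S\<^esub> p) = N \<inter> M" using xp NM xS mem_topological_derived_iff by simp
      then have "\<gamma> [^]\<^bsub>\<Gamma>\<^esub> p \<in> M"
        using proj_one_iff[OF NMI(1) _ proj_pow[OF NMI(1) xS \<gamma>]] \<gamma>(1) by simp
      moreover have H1: "H \<in> carrier (\<Gamma> Mod H)" by (simp add: FactGroup_def H.subgroup_in_rcosets)
      ultimately have "int (p * e) dvd \<Phi> H (\<gamma> [^]\<^bsub>\<Gamma>\<^esub> p)"
        unfolding M_def cocycle_kernel_def by blast
      then have "int p * int e dvd int p * \<Phi> H \<gamma>"
        using H.cocycle_pow_subgroup[OF \<Phi> H1 d(1), of p] by simp
      then have "int e dvd \<Phi> H \<gamma>" using p by (simp add: prime_gt_0_nat)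
      then show False using d by blast
    qed
  qed
  then show ?thesis using xS mem_topological_derived_iff by blast
qed

text \<open>The outer induction removes one prime factor of \<open>n\<close> at a time; for each of
  them, the inner one climbs the derived series from \<open>D 0\<close> to
  \<open>D m\<close>.\<close>

lemma torsion:
  assumes x: "x \<in> carrier S" shows "0 < n \<Longrightarrow> x [^]\<^bsub>S\<^esub> (n::nat) \<in> D m \<Longrightarrow> x \<in> D m"
  using x
proof (induction n arbitrary: x rule: less_induct)
  case (less n)
  show ?case
  proof (cases "n = 1")
    case True
    then show ?thesis using less.prems by simp
  next
    case False
    then obtain p where p: "prime p" "p dvd n" using prime_factor_nat by blast
    then obtain r where r: "n = r * p" by (metis dvd_def mult.commute)
    define y where "y = x [^]\<^bsub>S\<^esub> r"
    have yS: "y \<in> carrier S" and yp: "y [^]\<^bsub>S\<^esub> p \<in> D m"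
      using less.prems by (simp_all add: y_def r S.nat_pow_pow)
    have "y \<in> D k" if "k \<le> m" for k
      using that
    proof (induction k)
      case (Suc k)
      have "y [^]\<^bsub>S\<^esub> p \<in> D (Suc k)" using yp D_antimono[OF Suc.prems] by blast
      moreover have "y \<in> D k" using Suc by simp
      ultimately show ?case by (intro prime_torsion_step[OF _ p(1), of y k])
    qed (use yS in simp)
    then have "x [^]\<^bsub>S\<^esub> r \<in> D m" by (simp add: y_def)
    moreover have "r < n" "0 < r" using r less.prems(1) prime_gt_1_nat[OF p(1)] by auto
    ultimately show ?thesis using less.IH less.prems(3) by blast
  qed
qed

section \<open>Elements that are central modulo \<open>D m\<close>\<close>

context
  fixes z m
  assumes z: "z \<in> carrier S"
    and central: "\<And>y. y \<in> carrier S \<Longrightarrow> z \<otimes>\<^bsub>S\<^esub> y \<otimes>\<^bsub>S\<^esub> inv\<^bsub>S\<^esub> z \<otimes>\<^bsub>S\<^esub> inv\<^bsub>S\<^esub> y \<in> D m"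
begin

text \<open>By density \<delta> is the image of an element of \<open>S\<close>, with which
  \<open>z\<close> commutes modulo \<open>D m\<close>.\<close>

lemma central_commutator:
  assumes M: "M \<in> solvable_subgroups \<Sigma> \<Gamma> m" and \<gamma>: "\<gamma> \<in> carrier \<Gamma>" "proj M z = M #>\<^bsub>\<Gamma>\<^esub> \<gamma>"
    and \<delta>: "\<delta> \<in> carrier \<Gamma>"
  shows "\<gamma> \<otimes>\<^bsub>\<Gamma>\<^esub> \<delta> \<otimes>\<^bsub>\<Gamma>\<^esub> inv\<^bsub>\<Gamma>\<^esub> \<gamma> \<otimes>\<^bsub>\<Gamma>\<^esub> inv\<^bsub>\<Gamma>\<^esub> \<delta> \<in> M"
proof -
  have MI: "M \<in> I" using M by (rule solvable_subgroupsD)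
  interpret normal M \<Gamma> using M by (rule solvable_subgroupsD)
  interpret p: group_hom S "\<Gamma> Mod M" "proj M" using MI by (rule proj_group_hom)
  interpret h: group_hom \<Gamma> "\<Gamma> Mod M" "\<lambda>x. M #>\<^bsub>\<Gamma>\<^esub> x" by (rule group_hom_Mod)
  obtain y where y: "y \<in> carrier S" "proj M y = M #>\<^bsub>\<Gamma>\<^esub> \<delta>" using dense[OF \<delta>] MI by blast
  let ?c = "z \<otimes>\<^bsub>S\<^esub> y \<otimes>\<^bsub>S\<^esub> inv\<^bsub>S\<^esub> z \<otimes>\<^bsub>S\<^esub> inv\<^bsub>S\<^esub> y"
  have "?c \<in> carrier S" using z y by simp
  then have "proj M ?c = M" using central[OF y(1)] M mem_topological_derived_iff by blast
  moreover have "proj M ?c = M #>\<^bsub>\<Gamma>\<^esub> (\<gamma> \<otimes>\<^bsub>\<Gamma>\<^esub> \<delta> \<otimes>\<^bsub>\<Gamma>\<^esub> inv\<^bsub>\<Gamma>\<^esub> \<gamma> \<otimes>\<^bsub>\<Gamma>\<^esub> inv\<^bsub>\<Gamma>\<^esub> \<delta>)"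
    using z y \<gamma> \<delta> by simp
  moreover have "\<gamma> \<otimes>\<^bsub>\<Gamma>\<^esub> \<delta> \<otimes>\<^bsub>\<Gamma>\<^esub> inv\<^bsub>\<Gamma>\<^esub> \<gamma> \<otimes>\<^bsub>\<Gamma>\<^esub> inv\<^bsub>\<Gamma>\<^esub> \<delta> \<in> carrier \<Gamma>" using \<gamma>(1) \<delta> by simp
  ultimately show ?thesis using rcos_eq_self_iff by metis
qed

text \<open>Translating by \<open>z\<close> preserves the number of crossings of lifts of \<open>a\<^sub>i\<close> and \<open>b\<^sub>i\<close>, so the translate
  of the \<open>b\<^sub>i\<close>-cycle through the base point meets the \<open>a\<^sub>i\<close>-cycle through the base point.\<close>

lemma central_in_gen_cosets:
  assumes m: "m = Suc k" and prime: "prime p" "p \<in> \<Sigma>" and i: "i \<in> {1..g}"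
    and H: "H \<in> solvable_subgroups \<Sigma> \<Gamma> k" and \<gamma>: "\<gamma> \<in> carrier \<Gamma>" "proj H z = H #>\<^bsub>\<Gamma>\<^esub> \<gamma>"
  obtains r s :: nat where
    "\<gamma> \<otimes>\<^bsub>\<Gamma>\<^esub> surface_gen_class g (Gen_b i) [^]\<^bsub>\<Gamma>\<^esub> r \<otimes>\<^bsub>\<Gamma>\<^esub>
      inv\<^bsub>\<Gamma>\<^esub> (surface_gen_class g (Gen_a i) [^]\<^bsub>\<Gamma>\<^esub> s) \<in> H"
proof -
  let ?Q = "\<Gamma> Mod H" and ?a = "surface_gen_class g (Gen_a i)" and ?b = "surface_gen_class g (Gen_b i)"
  have HI: "H \<in> I" using H by (rule solvable_subgroupsD)
  have Hn: "H \<lhd> \<Gamma>" using H by (rule solvable_subgroupsD)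
  interpret normal H \<Gamma> by (rule Hn)
  interpret h: group_hom \<Gamma> ?Q "\<lambda>x. H #>\<^bsub>\<Gamma>\<^esub> x" by (rule group_hom_Mod)
  define C where "C = generate ?Q {H #>\<^bsub>\<Gamma>\<^esub> ?a}"
  obtain \<Phi> where \<Phi>: "coset_cocycle \<Gamma> H \<Phi>"
    "\<And>q e. q \<in> carrier ?Q \<Longrightarrow> \<Phi> q (?b [^]\<^bsub>\<Gamma>\<^esub> (e::nat)) =
      (\<Sum>j<e. of_bool (q \<otimes>\<^bsub>?Q\<^esub> (H #>\<^bsub>\<Gamma>\<^esub> ?b) [^]\<^bsub>?Q\<^esub> Suc j \<in> C))"
    unfolding C_def using crossing_cocycle[OF Hn i] by blast
  define e where "e = order ?Q"
  have fin: "finite (carrier ?Q)" using HI by (rule pro_normal_subgroupsD)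
  then have e: "e > 0" unfolding e_def using h.H.order_gt_0_iff_finite by blast
  have "Gen_a i \<in> surface_gens g" "Gen_b i \<in> surface_gens g" using i by auto
  then have c: "?a \<in> carrier \<Gamma>" "?b \<in> carrier \<Gamma>" by (simp_all only: surface_gen_class_closed)
  then have aC: "H #>\<^bsub>\<Gamma>\<^esub> ?a \<in> carrier ?Q" "H #>\<^bsub>\<Gamma>\<^esub> ?b \<in> carrier ?Q" by auto
  define w where "w = ?b [^]\<^bsub>\<Gamma>\<^esub> e"
  have wH: "w \<in> H" unfolding w_def e_def using c(2) by (rule pow_order_Mod)
  have wc: "w \<in> carrier \<Gamma>" unfolding w_def using c by simp
  have e_less: "e < p ^ e" using prime_gt_Suc_0_nat[OF prime(1)] by (rule power_gt_expt)
  \<comment> \<open>Crossing numbers of \<open>w\<close> lie between 0 and \<open>e\<close>. As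
    \<open>e < p ^ e\<close>, congruence modulo \<open>p ^ e\<close> forces them to be equal, and
    only one prime of \<Sigma> is used.\<close>
  define M where "M = cocycle_kernel \<Gamma> H \<Phi> (p ^ e)"
  have M: "M \<in> solvable_subgroups \<Sigma> \<Gamma> m"
    unfolding M_def m using cocycle_kernel_solvable[OF \<Phi>(1) H] sigma_number_prime_power[OF prime] by blast
  have MI: "M \<in> I" using M by (rule solvable_subgroupsD)
  have MH: "M \<subseteq> H" by (auto simp: M_def cocycle_kernel_def)
  \<comment> \<open>The finer subgroup \<open>M\<close> requires a new representative of
    \<open>z\<close>; it defines the same coset of \<open>H\<close> as \<gamma>.\<close>
  obtain \<gamma>' where \<gamma>': "\<gamma>' \<in> carrier \<Gamma>" "proj M z = M #>\<^bsub>\<Gamma>\<^esub> \<gamma>'" using proj_coset[OF MI z] .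
  have \<gamma>\<gamma>': "H #>\<^bsub>\<Gamma>\<^esub> \<gamma> = H #>\<^bsub>\<Gamma>\<^esub> \<gamma>'" using proj_mono[OF MI HI MH z \<gamma>'] \<gamma>(2) by simp
  have H1: "H \<in> carrier ?Q" using h.H.one_closed by (simp add: one_FactGroup)
  have Hq: "H \<otimes>\<^bsub>?Q\<^esub> q = q" if "q \<in> carrier ?Q" for q
    using h.H.l_one[OF that] by (simp add: one_FactGroup)
  define q where "q = H #>\<^bsub>\<Gamma>\<^esub> \<gamma>'"
  have q: "q \<in> carrier ?Q" unfolding q_def using \<gamma>'(1) by simp
  have "\<gamma>' \<otimes>\<^bsub>\<Gamma>\<^esub> w \<otimes>\<^bsub>\<Gamma>\<^esub> inv\<^bsub>\<Gamma>\<^esub> \<gamma>' \<otimes>\<^bsub>\<Gamma>\<^esub> inv\<^bsub>\<Gamma>\<^esub> w \<in> M"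
    using central_commutator[OF M \<gamma>' wc] .
  then have "int (p ^ e) dvd \<Phi> H (\<gamma>' \<otimes>\<^bsub>\<Gamma>\<^esub> w \<otimes>\<^bsub>\<Gamma>\<^esub> inv\<^bsub>\<Gamma>\<^esub> \<gamma>' \<otimes>\<^bsub>\<Gamma>\<^esub> inv\<^bsub>\<Gamma>\<^esub> w)"
    using H1 unfolding M_def cocycle_kernel_def by blast
  \<comment> \<open>Conjugation by \<gamma>' moves the base point from \<open>H\<close> to
    \<open>q\<close>, so the commutator compares the translated cycle with the original one.\<close>
  also have "\<Phi> H (\<gamma>' \<otimes>\<^bsub>\<Gamma>\<^esub> w \<otimes>\<^bsub>\<Gamma>\<^esub> inv\<^bsub>\<Gamma>\<^esub> \<gamma>' \<otimes>\<^bsub>\<Gamma>\<^esub> inv\<^bsub>\<Gamma>\<^esub> w) = \<Phi> q w - \<Phi> H w"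
    using cocycle_add_subgroup[OF \<Phi>(1) H1 inv_op_closed2[OF \<gamma>'(1) wH], of "inv\<^bsub>\<Gamma>\<^esub> w"]
      cocycle_inv_subgroup[OF \<Phi>(1) H1 wH] cocycle_conjugate[OF \<Phi>(1) H1 \<gamma>'(1) wH] Hq[OF q] wc
    by (simp add: q_def)
  finally have dvd: "int (p ^ e) dvd \<Phi> q w - \<Phi> H w" .
  have range: "0 \<le> \<Phi> q' w \<and> \<Phi> q' w \<le> int e" if "q' \<in> carrier ?Q" for q'
  proof -
    have "(\<Sum>j<e. of_bool (q' \<otimes>\<^bsub>?Q\<^esub> (H #>\<^bsub>\<Gamma>\<^esub> ?b) [^]\<^bsub>?Q\<^esub> Suc j \<in> C) :: int) \<le> (\<Sum>j<e. 1)"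
      by (intro sum_mono) simp
    then show ?thesis unfolding w_def \<Phi>(2)[OF that] by (auto intro: sum_nonneg)
  qed
  have "\<bar>\<Phi> q w - \<Phi> H w\<bar> < int (p ^ e)" using range[OF q] range[OF H1] e_less by linarith
  then have eq: "\<Phi> q w = \<Phi> H w" using dvd dvd_imp_le_int[of "\<Phi> q w - \<Phi> H w" "int (p ^ e)"] by fastforce
  have "(H #>\<^bsub>\<Gamma>\<^esub> ?b) [^]\<^bsub>?Q\<^esub> e = \<one>\<^bsub>?Q\<^esub>" unfolding e_def using aC(2) by (rule h.H.pow_order_eq_1)
  \<comment> \<open>The last of the \<open>e\<close> steps, with index \<open>e - 1\<close>, returns
    to the base point, which lies on \<open>C\<close>: the untranslated cycles do meet.\<close>
  then have "H \<otimes>\<^bsub>?Q\<^esub> (H #>\<^bsub>\<Gamma>\<^esub> ?b) [^]\<^bsub>?Q\<^esub> Suc (e - 1) \<in> C"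
    using e Hq[OF h.H.one_closed] unfolding C_def by (simp add: generate.one)
  then have "0 < \<Phi> H w"
    unfolding w_def \<Phi>(2)[OF H1] using e by (intro sum_pos2[of _ "e - 1"]) auto
  then have "\<Phi> q w \<noteq> 0" using eq by simp
  then obtain j where "of_bool (q \<otimes>\<^bsub>?Q\<^esub> (H #>\<^bsub>\<Gamma>\<^esub> ?b) [^]\<^bsub>?Q\<^esub> Suc j \<in> C) \<noteq> (0::int)"
    unfolding w_def \<Phi>(2)[OF q] by (rule sum.not_neutral_contains_not_neutral)
  then have "q \<otimes>\<^bsub>?Q\<^esub> (H #>\<^bsub>\<Gamma>\<^esub> ?b) [^]\<^bsub>?Q\<^esub> Suc j \<in> C" by (simp only: of_bool_eq_0_iff not_not)
  then obtain s :: nat where "q \<otimes>\<^bsub>?Q\<^esub> (H #>\<^bsub>\<Gamma>\<^esub> ?b) [^]\<^bsub>?Q\<^esub> Suc j = (H #>\<^bsub>\<Gamma>\<^esub> ?a) [^]\<^bsub>?Q\<^esub> s"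
    unfolding C_def h.H.generate_pow_on_finite_carrier[OF fin aC(1)] by blast
  then have "H #>\<^bsub>\<Gamma>\<^esub> (\<gamma> \<otimes>\<^bsub>\<Gamma>\<^esub> ?b [^]\<^bsub>\<Gamma>\<^esub> Suc j) = H #>\<^bsub>\<Gamma>\<^esub> (?a [^]\<^bsub>\<Gamma>\<^esub> s)"
    unfolding q_def \<gamma>\<gamma>'[symmetric] using c \<gamma>(1) by (simp add: FactGroup_pow del: nat_pow_Suc)
  then have "\<gamma> \<otimes>\<^bsub>\<Gamma>\<^esub> ?b [^]\<^bsub>\<Gamma>\<^esub> Suc j \<otimes>\<^bsub>\<Gamma>\<^esub> inv\<^bsub>\<Gamma>\<^esub> (?a [^]\<^bsub>\<Gamma>\<^esub> s) \<in> H"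
    using rcos_eq_iff[of "\<gamma> \<otimes>\<^bsub>\<Gamma>\<^esub> ?b [^]\<^bsub>\<Gamma>\<^esub> Suc j" "?a [^]\<^bsub>\<Gamma>\<^esub> s"] c \<gamma>(1) by simp
  then show thesis using that by blast
qed

text \<open>Modulo the order \<open>d\<close> of \<open>\<Gamma> Mod N\<close>, the class of \<open>z\<close> in the abelianization lies both in the span of \<open>a\<^sub>1, b\<^sub>1\<close> and in that
  of \<open>a\<^sub>2, b\<^sub>2\<close>; hence the exponents found for \<open>i = 1\<close> vanish modulo \<open>d\<close>.\<close>

lemma central_in_previous:
  assumes m: "m = Suc k" and k: "k \<ge> 1" and prime: "prime p" "p \<in> \<Sigma>" and g: "g \<ge> 2"
  shows "z \<in> D k"
proof -
  have "proj N z = N" if N: "N \<in> solvable_subgroups \<Sigma> \<Gamma> k" for N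
  proof -
    have NI: "N \<in> I" using N by (rule solvable_subgroupsD)
    interpret N: normal N \<Gamma> using N by (rule solvable_subgroupsD)
    let ?U = "carrier \<Gamma>"
    \<comment> \<open>The quotient by the whole carrier is trivial, so a cocycle over it is a
      homomorphism to the integers, evaluated at the only coset \<open>?U\<close>.\<close>
    have U: "?U \<in> solvable_subgroups \<Sigma> \<Gamma> 0" by (rule G.solvable_subgroups_0)
    interpret U: normal ?U \<Gamma> using U by (rule solvable_subgroupsD)
    interpret UQ: group "\<Gamma> Mod ?U" by (rule U.factorgroup_is_group)
    have U1: "?U \<in> carrier (\<Gamma> Mod ?U)" using UQ.one_closed by (simp add: one_FactGroup)
    \<comment> \<open>All d-th powers lie in \<open>N\<close>, so exponents of generators matter
      only modulo \<open>d\<close>.\<close>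
    define d where "d = order (\<Gamma> Mod N)"
    have d: "sigma_number \<Sigma> d" unfolding d_def using NI by (rule pro_normal_subgroupsD)
    let ?a = "\<lambda>i. surface_gen_class g (Gen_a i)" and ?b = "\<lambda>i. surface_gen_class g (Gen_b i)"
    have gens: "Gen_a i \<in> surface_gens g" "Gen_b i \<in> surface_gens g" if "i \<in> {1..2}" for i
      using that g by auto
    have c: "?a i \<in> carrier \<Gamma>" "?b i \<in> carrier \<Gamma>" if "i \<in> {1..2}" for i
      using gens[OF that] by (simp_all only: surface_gen_class_closed)
    obtain A where A: "coset_cocycle \<Gamma> ?U A"
      "\<And>q x. q \<in> carrier (\<Gamma> Mod ?U) \<Longrightarrow> x \<in> surface_gens g \<Longrightarrow> A q (surface_gen_class g x) = of_bool (x = Gen_a 1)"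
      using exponent_sum_cocycle[OF U.normal_axioms] by metis
    obtain B where B: "coset_cocycle \<Gamma> ?U B"
      "\<And>q x. q \<in> carrier (\<Gamma> Mod ?U) \<Longrightarrow> x \<in> surface_gens g \<Longrightarrow> B q (surface_gen_class g x) = of_bool (x = Gen_b 1)"
      using exponent_sum_cocycle[OF U.normal_axioms] by metis
    define KA where "KA = cocycle_kernel \<Gamma> ?U A d"
    define KB where "KB = cocycle_kernel \<Gamma> ?U B d"
    have "KA \<in> solvable_subgroups \<Sigma> \<Gamma> k" "KB \<in> solvable_subgroups \<Sigma> \<Gamma> k"
      unfolding KA_def KB_def
      using U.cocycle_kernel_solvable[OF A(1) U d] U.cocycle_kernel_solvable[OF B(1) U d]
        G.solvable_subgroups_mono[OF k, of \<Sigma>] by auto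
    then have H: "N \<inter> (KA \<inter> KB) \<in> solvable_subgroups \<Sigma> \<Gamma> k"
      using N by (intro G.solvable_subgroups_Int)
    have HI: "N \<inter> (KA \<inter> KB) \<in> I" using H by (rule solvable_subgroupsD)
    obtain \<gamma> where \<gamma>: "\<gamma> \<in> carrier \<Gamma>" "proj (N \<inter> (KA \<inter> KB)) z = (N \<inter> (KA \<inter> KB)) #>\<^bsub>\<Gamma>\<^esub> \<gamma>"
      using proj_coset[OF HI z] .
    have gen_values: "A ?U (?a i) = of_bool (i = 1)" "A ?U (?b i) = 0"
        "B ?U (?a i) = 0" "B ?U (?b i) = of_bool (i = 1)" if "i \<in> {1..2}" for i
      using A(2)[OF U1 gens(1)[OF that]] A(2)[OF U1 gens(2)[OF that]]
        B(2)[OF U1 gens(1)[OF that]] B(2)[OF U1 gens(2)[OF that]]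
      by (simp_all only: surface_gen.inject surface_gen.distinct of_bool_eq)
    have exps: "\<exists>r s :: nat. \<gamma> \<otimes>\<^bsub>\<Gamma>\<^esub> ?b i [^]\<^bsub>\<Gamma>\<^esub> r \<otimes>\<^bsub>\<Gamma>\<^esub> inv\<^bsub>\<Gamma>\<^esub> (?a i [^]\<^bsub>\<Gamma>\<^esub> s) \<in> N \<and>
        int d dvd A ?U \<gamma> - int s * of_bool (i = 1) \<and> int d dvd B ?U \<gamma> + int r * of_bool (i = 1)"
      if i: "i \<in> {1..2}" for i
    proof -
      have "i \<in> {1..g}" using i g by auto
      then obtain r s :: nat where rs:
        "\<gamma> \<otimes>\<^bsub>\<Gamma>\<^esub> ?b i [^]\<^bsub>\<Gamma>\<^esub> r \<otimes>\<^bsub>\<Gamma>\<^esub> inv\<^bsub>\<Gamma>\<^esub> (?a i [^]\<^bsub>\<Gamma>\<^esub> s) \<in> N \<inter> (KA \<inter> KB)"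
        using central_in_gen_cosets[OF m prime _ H \<gamma>] by metis
      have val: "\<Psi> ?U (\<gamma> \<otimes>\<^bsub>\<Gamma>\<^esub> ?b i [^]\<^bsub>\<Gamma>\<^esub> r \<otimes>\<^bsub>\<Gamma>\<^esub> inv\<^bsub>\<Gamma>\<^esub> (?a i [^]\<^bsub>\<Gamma>\<^esub> s))
          = \<Psi> ?U \<gamma> + int r * \<Psi> ?U (?b i) - int s * \<Psi> ?U (?a i)" if \<Psi>: "coset_cocycle \<Gamma> ?U \<Psi>" for \<Psi>
        using c[OF i] \<gamma>(1) U.cocycle_add_subgroup[OF \<Psi> U1] U.cocycle_inv_subgroup[OF \<Psi> U1]
          U.cocycle_pow_subgroup[OF \<Psi> U1] by simp
      have "int d dvd A ?U (\<gamma> \<otimes>\<^bsub>\<Gamma>\<^esub> ?b i [^]\<^bsub>\<Gamma>\<^esub> r \<otimes>\<^bsub>\<Gamma>\<^esub> inv\<^bsub>\<Gamma>\<^esub> (?a i [^]\<^bsub>\<Gamma>\<^esub> s))"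
        "int d dvd B ?U (\<gamma> \<otimes>\<^bsub>\<Gamma>\<^esub> ?b i [^]\<^bsub>\<Gamma>\<^esub> r \<otimes>\<^bsub>\<Gamma>\<^esub> inv\<^bsub>\<Gamma>\<^esub> (?a i [^]\<^bsub>\<Gamma>\<^esub> s))"
        using rs U1 unfolding KA_def KB_def cocycle_kernel_def by blast+
      then have "int d dvd A ?U \<gamma> - int s * of_bool (i = 1)" "int d dvd B ?U \<gamma> + int r * of_bool (i = 1)"
        unfolding val[OF A(1)] val[OF B(1)] gen_values[OF i] by simp_all
      then show ?thesis using rs by blast
    qed
    obtain r s :: nat where rs: "\<gamma> \<otimes>\<^bsub>\<Gamma>\<^esub> ?b 1 [^]\<^bsub>\<Gamma>\<^esub> r \<otimes>\<^bsub>\<Gamma>\<^esub> inv\<^bsub>\<Gamma>\<^esub> (?a 1 [^]\<^bsub>\<Gamma>\<^esub> s) \<in> N"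
      "int d dvd A ?U \<gamma> - int s" "int d dvd B ?U \<gamma> + int r"
    proof -
      have "1 \<in> {1..2::nat}" by simp
      from exps[OF this] show thesis using that by auto
    qed
    \<comment> \<open>For \<open>i = 2\<close> the correcting powers have exponent sum zero in the
      generators of index 1, so both sums of \<gamma> itself vanish modulo \<open>d\<close>.\<close>
    have "int d dvd A ?U \<gamma>" "int d dvd B ?U \<gamma>"
    proof -
      have "2 \<in> {1..2::nat}" by simp
      from exps[OF this] show "int d dvd A ?U \<gamma>" "int d dvd B ?U \<gamma>" by auto
    qed
    then have "d dvd s" "d dvd r"
      using rs(2,3) by (simp_all add: dvd_diff_right_iff dvd_add_right_iff)
    have powN: "x [^]\<^bsub>\<Gamma>\<^esub> t \<in> N" if xt: "x \<in> carrier \<Gamma>" "d dvd t" for x and t :: nat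
    proof -
      obtain l where "t = d * l" using xt(2) by blast
      moreover have "(x [^]\<^bsub>\<Gamma>\<^esub> d) [^]\<^bsub>\<Gamma>\<^esub> l \<in> N"
        unfolding d_def by (rule G.subgroup_nat_pow_closed[OF N.is_subgroup N.pow_order_Mod[OF xt(1)]])
      ultimately show ?thesis using xt(1) by (simp add: G.nat_pow_pow)
    qed
    define u v where uv: "u = ?b 1 [^]\<^bsub>\<Gamma>\<^esub> r" "v = ?a 1 [^]\<^bsub>\<Gamma>\<^esub> s"
    have uvN: "u \<in> N" "v \<in> N" using powN \<open>d dvd s\<close> \<open>d dvd r\<close> c[of 1] by (auto simp: uv)
    have "(\<gamma> \<otimes>\<^bsub>\<Gamma>\<^esub> u \<otimes>\<^bsub>\<Gamma>\<^esub> inv\<^bsub>\<Gamma>\<^esub> v) \<otimes>\<^bsub>\<Gamma>\<^esub> v \<otimes>\<^bsub>\<Gamma>\<^esub> inv\<^bsub>\<Gamma>\<^esub> u \<in> N"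
      using rs(1) uvN N.is_subgroup unfolding uv[symmetric]
      by (metis subgroup.m_closed N.m_inv_closed)
    then have "\<gamma> \<in> N" using \<gamma>(1) N.mem_carrier[OF uvN(1)] N.mem_carrier[OF uvN(2)] by (simp add: G.m_assoc)
    moreover have "proj N z = N #>\<^bsub>\<Gamma>\<^esub> \<gamma>" using proj_mono[OF HI NI _ z \<gamma>] by simp
    ultimately show ?thesis using proj_one_iff[OF NI \<gamma>(1)] by blast
  qed
  then show ?thesis using z mem_topological_derived_iff by blast
qed

text \<open>The transfer of a cocycle \<open>\<Phi>\<close>, namely the sum of all \<open>\<Phi> q\<close>, is a homomorphism on the whole group,
  so it kills \<open>z\<close> modulo any \<open>\<Sigma>\<close>-number; as \<open>z\<close> is central, the summands agree.\<close>

lemma central_trivial: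
  assumes m: "m = Suc k" and k: "k \<ge> 1" and zk: "z \<in> D k"
  shows "z \<in> D m"
proof -
  have "proj N z = N" if N: "N \<in> solvable_subgroups \<Sigma> \<Gamma> m" for N
  proof (rule ccontr)
    assume "proj N z \<noteq> N"
    then obtain H \<Phi> e where H: "H \<in> solvable_subgroups \<Sigma> \<Gamma> k" and \<Phi>: "coset_cocycle \<Gamma> H \<Phi>"
      and e: "sigma_number \<Sigma> e"
      and det: "\<And>\<gamma>. \<gamma> \<in> carrier \<Gamma> \<Longrightarrow> proj N z = N #>\<^bsub>\<Gamma>\<^esub> \<gamma> \<Longrightarrow> \<gamma> \<in> H \<and> \<not> int e dvd \<Phi> H \<gamma>"
      using detecting_cocycle[OF zk N[unfolded m]] by metis
    have HI: "H \<in> I" using H by (rule solvable_subgroupsD)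
    interpret H: normal H \<Gamma> using H by (rule solvable_subgroupsD)
    let ?Q = "\<Gamma> Mod H"
    interpret h: group_hom \<Gamma> ?Q "\<lambda>x. H #>\<^bsub>\<Gamma>\<^esub> x" by (rule H.group_hom_Mod)
    have fin: "finite (carrier ?Q)" using HI by (rule pro_normal_subgroupsD)
    have H1: "H \<in> carrier ?Q" using h.H.one_closed by (simp add: one_FactGroup)
    let ?U = "carrier \<Gamma>"
    have U: "?U \<in> solvable_subgroups \<Sigma> \<Gamma> 0" by (rule G.solvable_subgroups_0)
    interpret U: normal ?U \<Gamma> using U by (rule solvable_subgroupsD)
    interpret UQ: group "\<Gamma> Mod ?U" by (rule U.factorgroup_is_group)
    have U1: "?U \<in> carrier (\<Gamma> Mod ?U)" using UQ.one_closed by (simp add: one_FactGroup)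
    \<comment> \<open>The first argument is a dummy: it gives the transfer the form of a cocycle
      over the trivial quotient, so that \<open>cocycle_kernel_solvable\<close> applies.\<close>
    define tr where "tr q x = (\<Sum>q\<in>carrier ?Q. \<Phi> q x)" for q :: "surface_gen word set set" and x
    have tr: "coset_cocycle \<Gamma> ?U tr"
      unfolding cocycle_def
    proof (intro ballI)
      fix q x y assume "q \<in> carrier (\<Gamma> Mod ?U)" and x: "x \<in> carrier \<Gamma>" and y: "y \<in> carrier \<Gamma>"
      have "(\<Sum>q\<in>carrier ?Q. \<Phi> q (x \<otimes>\<^bsub>\<Gamma>\<^esub> y))
          = (\<Sum>q\<in>carrier ?Q. \<Phi> q x) + (\<Sum>q\<in>carrier ?Q. \<Phi> (q \<otimes>\<^bsub>?Q\<^esub> (H #>\<^bsub>\<Gamma>\<^esub> x)) y)"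
        unfolding sum.distrib[symmetric] using H.cocycle_add[OF \<Phi> _ x y] by (rule sum.cong[OF HOL.refl])
      also have "(\<Sum>q\<in>carrier ?Q. \<Phi> (q \<otimes>\<^bsub>?Q\<^esub> (H #>\<^bsub>\<Gamma>\<^esub> x)) y) = (\<Sum>q\<in>carrier ?Q. \<Phi> q y)"
        using x by (intro h.H.sum_translate[where F = "\<lambda>q. \<Phi> q y"]) simp
      finally show "tr q (x \<otimes>\<^bsub>\<Gamma>\<^esub> y) = tr q x + tr (q \<otimes>\<^bsub>\<Gamma> Mod ?U\<^esub> (?U #>\<^bsub>\<Gamma>\<^esub> x)) y"
        by (simp add: tr_def)
    qed
    define d where "d = order ?Q"
    have d: "sigma_number \<Sigma> d" unfolding d_def using HI by (rule pro_normal_subgroupsD)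
    \<comment> \<open>The factor \<open>d\<close> is spent at the end, when \<open>d\<close> equal
      summands are replaced by \<open>d\<close> times one of them; divisibility by \<open>e\<close>
      remains.\<close>
    have de: "sigma_number \<Sigma> (d * e)" using d e by (rule sigma_number_mult)
    define M where "M = cocycle_kernel \<Gamma> H \<Phi> (d * e)"
    define K where "K = cocycle_kernel \<Gamma> ?U tr (d * e)"
    have M: "M \<in> solvable_subgroups \<Sigma> \<Gamma> m" unfolding M_def m by (rule H.cocycle_kernel_solvable[OF \<Phi> H de])
    have K1: "K \<in> solvable_subgroups \<Sigma> \<Gamma> k"
      unfolding K_def using U.cocycle_kernel_solvable[OF tr U de] G.solvable_subgroups_mono[OF k, of \<Sigma>] by auto
    then have Km: "K \<in> solvable_subgroups \<Sigma> \<Gamma> m" using G.solvable_subgroups_mono[of k m \<Sigma>] m by auto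
    \<comment> \<open>One representative of \<open>z\<close> modulo \<open>L\<close> serves for
      detection at \<open>N\<close>, for commutators at \<open>M\<close> and for the transfer at
      \<open>K\<close>.\<close>
    define L where "L = N \<inter> (M \<inter> K)"
    have L: "L \<in> solvable_subgroups \<Sigma> \<Gamma> m" unfolding L_def using N M Km by (intro G.solvable_subgroups_Int)
    have LI: "L \<in> I" using L by (rule solvable_subgroupsD)
    have sub: "L \<subseteq> N" "L \<subseteq> M" "L \<subseteq> K" by (auto simp: L_def)
    obtain \<gamma> where \<gamma>: "\<gamma> \<in> carrier \<Gamma>" "proj L z = L #>\<^bsub>\<Gamma>\<^esub> \<gamma>" using proj_coset[OF LI z] .
    have \<gamma>H: "\<gamma> \<in> H" "\<not> int e dvd \<Phi> H \<gamma>"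
      using det[OF \<gamma>(1) proj_mono[OF LI solvable_subgroupsD(1)[OF N] sub(1) z \<gamma>]] by auto
    have KI: "K \<in> I" using K1 by (rule solvable_subgroupsD)
    have "proj K z = K" using zk K1 z mem_topological_derived_iff by blast
    then have "\<gamma> \<in> K" using proj_one_iff[OF KI \<gamma>(1) proj_mono[OF LI KI sub(3) z \<gamma>]] by blast
    then have "int (d * e) dvd tr ?U \<gamma>" using U1 unfolding K_def cocycle_kernel_def by blast
    then have dvd_tr: "int (d * e) dvd (\<Sum>q\<in>carrier ?Q. \<Phi> q \<gamma>)" by (simp add: tr_def)
    have "int (d * e) dvd \<Phi> H \<gamma> - \<Phi> q \<gamma>" if q: "q \<in> carrier ?Q" for q
    proof -
      obtain c where c: "c \<in> carrier \<Gamma>" "q = H #>\<^bsub>\<Gamma>\<^esub> c" using q by (auto simp: carrier_FactGroup)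
      define u where "u = \<gamma> \<otimes>\<^bsub>\<Gamma>\<^esub> c \<otimes>\<^bsub>\<Gamma>\<^esub> inv\<^bsub>\<Gamma>\<^esub> \<gamma> \<otimes>\<^bsub>\<Gamma>\<^esub> inv\<^bsub>\<Gamma>\<^esub> c"
      have "u \<in> M"
        unfolding u_def using central_commutator[OF M \<gamma>(1) proj_mono[OF LI solvable_subgroupsD(1)[OF M] sub(2) z \<gamma>] c(1)] .
      then have u: "u \<in> H" "int (d * e) dvd \<Phi> H u" using H1 unfolding M_def cocycle_kernel_def by blast+
      have "u \<otimes>\<^bsub>\<Gamma>\<^esub> (c \<otimes>\<^bsub>\<Gamma>\<^esub> \<gamma> \<otimes>\<^bsub>\<Gamma>\<^esub> inv\<^bsub>\<Gamma>\<^esub> c) = \<gamma>" using \<gamma>(1) c(1) by (simp add: u_def G.m_assoc)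
      then have "\<Phi> H \<gamma> = \<Phi> H u + \<Phi> H (c \<otimes>\<^bsub>\<Gamma>\<^esub> \<gamma> \<otimes>\<^bsub>\<Gamma>\<^esub> inv\<^bsub>\<Gamma>\<^esub> c)"
        using H.cocycle_add_subgroup[OF \<Phi> H1 u(1), of "c \<otimes>\<^bsub>\<Gamma>\<^esub> \<gamma> \<otimes>\<^bsub>\<Gamma>\<^esub> inv\<^bsub>\<Gamma>\<^esub> c"] \<gamma>(1) c(1) by simp
      also have "\<Phi> H (c \<otimes>\<^bsub>\<Gamma>\<^esub> \<gamma> \<otimes>\<^bsub>\<Gamma>\<^esub> inv\<^bsub>\<Gamma>\<^esub> c) = \<Phi> q \<gamma>"
        using H.cocycle_conjugate[OF \<Phi> H1 c(1) \<gamma>H(1)] h.H.l_one[OF q] c(2) by (simp add: one_FactGroup)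
      finally show ?thesis using u(2) by simp
    qed
    then have "int (d * e) dvd (\<Sum>q\<in>carrier ?Q. \<Phi> H \<gamma> - \<Phi> q \<gamma>)" by (rule dvd_sum)
    then have "int (d * e) dvd int d * \<Phi> H \<gamma> - (\<Sum>q\<in>carrier ?Q. \<Phi> q \<gamma>)"
      by (simp add: sum_subtractf d_def order_def)
    then have "int (d * e) dvd int d * \<Phi> H \<gamma>" using dvd_tr by (metis dvd_add diff_add_cancel)
    then have "int e dvd \<Phi> H \<gamma>" using d by (simp add: sigma_number_def)
    then show False using \<gamma>H(2) by blast
  qed
  then show ?thesis using z mem_topological_derived_iff by blast
qed

end

end

theorem corollary1:
  fixes \<Sigma> :: "nat set" and g m :: nat
    and S :: "('a, 'b) monoid_scheme" and T :: "'a topology"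
  assumes "\<Sigma> \<noteq> {}" and "\<forall>p\<in>\<Sigma>. prime p"
    and "g \<ge> 2"
    and "pro_surface_group \<Sigma> g S T"
    and "m \<ge> 2"
  shows "torsion_free (max_solvable_quotient S T m) \<and>
         center_free (max_solvable_quotient S T m)"
proof -
  obtain p where p: "prime p" "p \<in> \<Sigma>" using assms(1,2) by blast
  have S: "group S" using assms(4) by (simp add: pro_surface_group_def)
  obtain h where h: "h \<in> iso (pro_completion \<Sigma> (surface_group g)) S"
    "homeomorphic_map (pro_completion_topology \<Sigma> (surface_group g)) T h"
    using assms(4) by (auto simp: pro_surface_group_def)
  interpret pro_group \<Sigma> "surface_group g" S T
    "\<lambda>N x. inv_into (carrier (pro_completion \<Sigma> (surface_group g))) h x N"
    by (rule pro_group_of_iso[OF group_surface_group S h])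
  interpret pro_surface \<Sigma> g S T
    "\<lambda>N x. inv_into (carrier (pro_completion \<Sigma> (surface_group g))) h x N"
    by unfold_locales
  interpret D: normal "D m" S by (rule topological_derived_normal)
  interpret Q: group "S Mod D m" by (rule D.factorgroup_is_group)
  interpret q: group_hom S "S Mod D m" "\<lambda>x. D m #>\<^bsub>S\<^esub> x" by (rule D.group_hom_Mod)
  have one: "D m #>\<^bsub>S\<^esub> x = \<one>\<^bsub>S Mod D m\<^esub> \<longleftrightarrow> x \<in> D m" if "x \<in> carrier S" for x
    using D.rcos_eq_self_iff[OF that] by (simp add: one_FactGroup)
  have "torsion_free (S Mod D m)"
    unfolding torsion_free_def
  proof (intro ballI allI impI)
    fix c n assume "c \<in> carrier (S Mod D m)" and n: "0 < n \<and> c [^]\<^bsub>S Mod D m\<^esub> (n::nat) = \<one>\<^bsub>S Mod D m\<^esub>"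
    then obtain x where x: "x \<in> carrier S" "c = D m #>\<^bsub>S\<^esub> x" by (auto simp: carrier_FactGroup)
    then have "x [^]\<^bsub>S\<^esub> n \<in> D m" using n one[of "x [^]\<^bsub>S\<^esub> n"] by (simp add: D.FactGroup_pow)
    then show "c = \<one>\<^bsub>S Mod D m\<^esub>" using torsion[OF x(1)] n x one by blast
  qed
  moreover have "center_free (S Mod D m)"
    unfolding center_free_def
  proof
    show "{\<one>\<^bsub>S Mod D m\<^esub>} \<subseteq> center (S Mod D m)" by (simp add: center_def)
    show "center (S Mod D m) \<subseteq> {\<one>\<^bsub>S Mod D m\<^esub>}"
    proof
      fix c assume c: "c \<in> center (S Mod D m)"
      then obtain z where z: "z \<in> carrier S" "c = D m #>\<^bsub>S\<^esub> z"
        by (auto simp: center_def carrier_FactGroup)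
      have "z \<otimes>\<^bsub>S\<^esub> y \<otimes>\<^bsub>S\<^esub> inv\<^bsub>S\<^esub> z \<otimes>\<^bsub>S\<^esub> inv\<^bsub>S\<^esub> y \<in> D m" if y: "y \<in> carrier S" for y
      proof -
        have "c \<otimes>\<^bsub>S Mod D m\<^esub> (D m #>\<^bsub>S\<^esub> y) = (D m #>\<^bsub>S\<^esub> y) \<otimes>\<^bsub>S Mod D m\<^esub> c"
          using c y by (simp add: center_def carrier_FactGroup)
        then have "D m #>\<^bsub>S\<^esub> (z \<otimes>\<^bsub>S\<^esub> y) = D m #>\<^bsub>S\<^esub> (y \<otimes>\<^bsub>S\<^esub> z)"
          using q.hom_mult[OF z(1) y] q.hom_mult[OF y z(1)] z(2) by metis
        then have "z \<otimes>\<^bsub>S\<^esub> y \<otimes>\<^bsub>S\<^esub> inv\<^bsub>S\<^esub> (y \<otimes>\<^bsub>S\<^esub> z) \<in> D m"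
          using D.rcos_eq_iff[of "z \<otimes>\<^bsub>S\<^esub> y" "y \<otimes>\<^bsub>S\<^esub> z"] z(1) y by blast
        then show ?thesis using z(1) y by (simp add: S.inv_mult_group S.m_assoc)
      qed
      note central = z(1) this
      obtain k where k: "m = Suc k" "k \<ge> 1" using assms(5) by (cases m) auto
      have "z \<in> D m"
        using central_trivial[OF central k] central_in_previous[OF central k p assms(3)] by blast
      then show "c \<in> {\<one>\<^bsub>S Mod D m\<^esub>}" using one z by blast
    qed
  qed
  ultimately show ?thesis by (simp add: max_solvable_quotient_def)
qed

end
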